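(* Let $(M,J)$ be an almost complex manifold. There is a diagram of cohomologies, with arrows $$H^k_{d+d^c}\longrightarrow H^k_d,\qquad H^k_{d+d^c}\longrightarrow H^k_{d^c},\qquad H^k_d\longrightarrow H^k_{dd^c},\qquad H^k_{d^c}\longrightarrow H^k_{dd^c},$$ and a horizontal isomorphism $$H^k_d\;\overset{J}{\underset{\sim}{\longleftrightarrow}}\;H^k_{d^c},$$ that generalizes to the case of almost complex manifolds the diagram (D) of cohomologies of a complex manifold, which has arrows $H^{p,q}_{BC}\to H^{p+q}_d$, $H^{p,q}_{BC}\to H^{p+q}_{d^c}$, $H^{p+q}_d\to H^{p,q}_A$, $H^{p+q}_{d^c}\to H^{p,q}_A$ and the isomorphism $H^{p+q}_d\cong H^{p+q}_{d^c}$ provided by $J$.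
   Context: An almost complex manifold $(M,J)$ is a smooth $2m$-manifold with a smooth $(1,1)$-tensor field $J$ satisfying $J^2=-\mathrm{Id}$. $A^k$ is the space of smooth complex $k$-forms, with bigrading $A^k=\bigoplus_{p+q=k}A^{p,q}$ induced by $J$. $J$ acts on forms by duality, preserving the bigrading, and $d^c:=J^{-1}dJ$. $H^k_d$ is complex de Rham cohomology and $H^k_{d^c}:=(\ker d^c\cap A^k)/(\operatorname{Im}d^c\cap A^k)$ is $d^c$-cohomology. When $J$ is integrable (complex manifold), $dd^c+d^cd=0$ and the Bott-Chern and Aeppli cohomologies appearing in (D) are $$H^{p,q}_{BC}:=\frac{\ker d\cap\ker d^c\cap A^{p,q}}{\operatorname{Im}dd^c\cap A^{p,q}},\qquad H^{p,q}_A:=\frac{\ker dd^c\cap A^{p,q}}{(\operatorname{Im}d+\operatorname{Im}d^c)\cap A^{p,q}}.$$ For general $J$, let $B^\bullet:=\{\alpha\in A^\bullet:(dd^c+d^cd)\alpha=0\}$ and $C^\bullet:=A^\bullet/\operatorname{Im}(dd^c+d^cd)$, graded by degree of forms; $d$ and $d^c$ act on both. The Bott-Chern cohomology of $(M,J)$ is $$H^k_{d+d^c}:=\frac{\ker(d\colon B^k\to B^{k+1})\cap\ker(d^c\colon B^k\to B^{k+1})}{\operatorname{Im}(dd^c\colon B^{k-2}\to B^k)},$$ and the Aeppli cohomology of $(M,J)$ is $$H^k_{dd^c}:=\frac{\ker(dd^c\colon C^k\to C^{k+2})}{\operatorname{Im}(d\colon C^{k-1}\to C^k)+\operatorname{Im}(d^c\colon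 C^{k-1}\to C^k)}.$$ *)

theory Defs
  imports
    "HOL-Analysis.Analysis"
    "HOL-Library.Function_Algebras"
    "HOL-Algebra.AbelCoset"
    "HOL-Algebra.Module"
begin

section \<open>Smooth manifolds\<close>

text \<open>For open \<open>S\<close>; \<open>C\<^sup>k\<close> is defined by iterated directional derivatives.\<close>

primrec Ck_on :: "nat \<Rightarrow> 'e::euclidean_space set \<Rightarrow> ('e \<Rightarrow> 'b::real_normed_vector) \<Rightarrow> bool" where
  "Ck_on 0 S f \<longleftrightarrow> continuous_on S f"
| "Ck_on (Suc k) S f \<longleftrightarrow>
     (\<forall>x\<in>S. f differentiable (at x)) \<and> (\<forall>v. Ck_on k S (\<lambda>x. frechet_derivative f (at x) v))"

definition smooth_on :: "'e::euclidean_space set \<Rightarrow> ('e \<Rightarrow> 'b::real_normed_vector) \<Rightarrow> bool" where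
  "smooth_on S f \<longleftrightarrow> (\<forall>k. Ck_on k S f)"

text \<open>A chart \<open>(U, f)\<close> consists of its domain and its coordinate map, with values in the
  Euclidean model space; only the values of \<open>f\<close> on \<open>U\<close> matter.\<close>

type_synonym ('a, 'e) chart = "'a set \<times> ('a \<Rightarrow> 'e)"

definition chart :: "'a topology \<Rightarrow> ('a, 'e::euclidean_space) chart \<Rightarrow> bool" where
  "chart M c \<longleftrightarrow> openin M (fst c) \<and> open (snd c ` fst c) \<and>
     homeomorphic_map (subtopology M (fst c)) (top_of_set (snd c ` fst c)) (snd c)"

definition chart_inv :: "('a, 'e) chart \<Rightarrow> 'e \<Rightarrow> 'a" where
  "chart_inv c = inv_into (fst c) (snd c)"

definition transition :: "('a, 'e) chart \<Rightarrow> ('a, 'e) chart \<Rightarrow> 'e \<Rightarrow> 'e" where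
  "transition c c' = snd c' \<circ> chart_inv c"

definition compatible :: "('a, 'e::euclidean_space) chart \<Rightarrow> ('a, 'e) chart \<Rightarrow> bool" where
  "compatible c c' \<longleftrightarrow>
     smooth_on (snd c ` (fst c \<inter> fst c')) (transition c c') \<and>
     smooth_on (snd c' ` (fst c \<inter> fst c')) (transition c' c)"

definition smooth_manifold :: "'a topology \<Rightarrow> ('a, 'e::euclidean_space) chart set \<Rightarrow> bool" where
  "smooth_manifold M \<A> \<longleftrightarrow>
     Hausdorff_space M \<and> second_countable M \<and>
     (\<forall>c\<in>\<A>. chart M c) \<and> (\<Union>c\<in>\<A>. fst c) = topspace M \<and>
     (\<forall>c\<in>\<A>. \<forall>c'\<in>\<A>. compatible c c') \<and>
     (\<forall>c. chart M c \<and> (\<forall>c'\<in>\<A>. compatible c c') \<longrightarrow> c \<in> \<A>)"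

text \<open>The differential at the point \<open>x\<close> of the change of coordinates from \<open>c\<close> to \<open>c'\<close>. A
  tangent vector at \<open>x\<close> is given by its coordinate vectors in the charts around \<open>x\<close>, which are
  related by these linear maps.\<close>

definition jac :: "('a, 'e::euclidean_space) chart \<Rightarrow> ('a, 'e) chart \<Rightarrow> 'a \<Rightarrow> 'e \<Rightarrow> 'e" where
  "jac c c' x = frechet_derivative (transition c c') (at (snd c x))"

section \<open>Almost complex structures\<close>

text \<open>A tensor field is given by its expressions in all charts of the atlas, subject to the
  transformation law: \<open>J c x\<close> is the endomorphism of the tangent space at \<open>x\<close>, written in the
  coordinates of \<open>c\<close>. Values for \<open>c \<notin> \<A>\<close> or \<open>x\<close> outside of the domain of \<open>c\<close> are irrelevant.\<close>

type_synonym ('a, 'e) endo = "('a, 'e) chart \<Rightarrow> 'a \<Rightarrow> 'e \<Rightarrow> 'e"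

definition tensor_field_1_1 :: "('a, 'e::euclidean_space) chart set \<Rightarrow> ('a, 'e) endo \<Rightarrow> bool" where
  "tensor_field_1_1 \<A> J \<longleftrightarrow>
     (\<forall>c\<in>\<A>. \<forall>x\<in>fst c. linear (J c x)) \<and>
     (\<forall>c\<in>\<A>. \<forall>v. smooth_on (snd c ` fst c) (\<lambda>y. J c (chart_inv c y) v)) \<and>
     (\<forall>c\<in>\<A>. \<forall>c'\<in>\<A>. \<forall>x\<in>fst c \<inter> fst c'. \<forall>v. J c' x (jac c c' x v) = jac c c' x (J c x v))"

definition almost_complex_manifold ::
  "'a topology \<Rightarrow> ('a, 'e::euclidean_space) chart set \<Rightarrow> ('a, 'e) endo \<Rightarrow> bool" where
  "almost_complex_manifold M \<A> J \<longleftrightarrow>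
     smooth_manifold M \<A> \<and> even DIM('e) \<and> tensor_field_1_1 \<A> J \<and>
     (\<forall>c\<in>\<A>. \<forall>x\<in>fst c. \<forall>v. J c x (J c x v) = - v)"

text \<open>\<open>J\<close> comes from a complex manifold: the model space with the complex structure \<open>J0\<close> is a copy
  of \<open>\<complex>\<^sup>m\<close>, and there are charts around all points in which \<open>J\<close> is multiplication by \<open>\<i>\<close>. The
  differentials of the transition maps of these charts commute with \<open>J0\<close> by the transformation
  law, so these charts form a holomorphic atlas.\<close>

definition integrable_acs :: "('a, 'e::euclidean_space) chart set \<Rightarrow> ('a, 'e) endo \<Rightarrow> bool" where
  "integrable_acs \<A> J \<longleftrightarrow>
     (\<exists>J0. linear J0 \<and> (\<forall>v. J0 (J0 v) = - v) \<and>
       (\<forall>x\<in>(\<Union>c\<in>\<A>. fst c). \<exists>c\<in>\<A>. x \<in> fst c \<and> (\<forall>y\<in>fst c. J c y = J0)))"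

section \<open>Complex differential forms\<close>

text \<open>Alternating real-multilinear complex-valued forms of degree \<open>k\<close>; they take lists of \<open>k\<close>
  vectors as arguments and are extended by \<open>0\<close> to other lists. Degrees are integers; in negative
  degrees there is only the form \<open>0\<close>.\<close>

definition alternating_form :: "int \<Rightarrow> ('e::real_vector list \<Rightarrow> complex) \<Rightarrow> bool" where
  "alternating_form k \<phi> \<longleftrightarrow>
     (\<forall>vs. int (length vs) \<noteq> k \<longrightarrow> \<phi> vs = 0) \<and>
     (\<forall>vs i. i < length vs \<longrightarrow> linear (\<lambda>v. \<phi> (vs[i := v]))) \<and>
     (\<forall>vs i j. i < j \<and> j < length vs \<and> vs ! i = vs ! j \<longrightarrow> \<phi> vs = 0)"

type_synonym ('a, 'e) form = "('a, 'e) chart \<Rightarrow> 'a \<Rightarrow> 'e list \<Rightarrow> complex"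

text \<open>The space \<open>A\<^sup>k\<close>. Outside of the atlas and of the chart domains forms are normalised to \<open>0\<close>,
  so that equality of forms is equality of functions.\<close>

definition forms :: "('a, 'e::euclidean_space) chart set \<Rightarrow> int \<Rightarrow> ('a, 'e) form set" where
  "forms \<A> k = {\<alpha>.
     (\<forall>c x. \<not> (c \<in> \<A> \<and> x \<in> fst c) \<longrightarrow> \<alpha> c x = 0) \<and>
     (\<forall>c\<in>\<A>. \<forall>x\<in>fst c. alternating_form k (\<alpha> c x)) \<and>
     (\<forall>c\<in>\<A>. \<forall>vs. smooth_on (snd c ` fst c) (\<lambda>y. \<alpha> c (chart_inv c y) vs)) \<and>
     (\<forall>c\<in>\<A>. \<forall>c'\<in>\<A>. \<forall>x\<in>fst c \<inter> fst c'. \<forall>vs. \<alpha> c x vs = \<alpha> c' x (map (jac c c' x) vs))}"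

text \<open>\<open>(d\<alpha>)(v\<^sub>0, \<dots>, v\<^sub>k) = \<Sum>\<^sub>i (-1)\<^sup>i D\<alpha>(v\<^sub>i)(v\<^sub>0, \<dots>, v\<^sub>i omitted, \<dots>, v\<^sub>k)\<close> in coordinates.\<close>

definition ext_d :: "('a, 'e::euclidean_space) chart set \<Rightarrow> ('a, 'e) form \<Rightarrow> ('a, 'e) form" where
  "ext_d \<A> \<alpha> c x vs =
     (if c \<in> \<A> \<and> x \<in> fst c
      then \<Sum>i<length vs. (-1) ^ i *
        frechet_derivative (\<lambda>y. \<alpha> c (chart_inv c y) (take i vs @ drop (Suc i) vs))
          (at (snd c x)) (vs ! i)
      else 0)"

text \<open>\<open>(J\<alpha>)(v\<^sub>1, \<dots>, v\<^sub>k) = \<alpha>(Jv\<^sub>1, \<dots>, Jv\<^sub>k)\<close>, i.e. \<open>J\<close> is multiplication by \<open>\<i>\<^sup>p\<^sup>-\<^sup>q\<close> on \<open>A\<^sup>p\<^sup>,\<^sup>q\<close>.\<close>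

definition J_act :: "('a, 'e) endo \<Rightarrow> ('a, 'e) form \<Rightarrow> ('a, 'e) form" where
  "J_act J \<alpha> c x vs = \<alpha> c x (map (J c x) vs)"

definition J_act_inv :: "('a, 'e) endo \<Rightarrow> ('a, 'e) form \<Rightarrow> ('a, 'e) form" where
  "J_act_inv J \<alpha> c x vs = \<alpha> c x (map (inv_into UNIV (J c x)) vs)"

definition d_c :: "('a, 'e::euclidean_space) chart set \<Rightarrow> ('a, 'e) endo \<Rightarrow> ('a, 'e) form \<Rightarrow> ('a, 'e) form"
  where "d_c \<A> J \<alpha> = J_act_inv J (ext_d \<A> (J_act J \<alpha>))"

definition dd_c :: "('a, 'e::euclidean_space) chart set \<Rightarrow> ('a, 'e) endo \<Rightarrow> ('a, 'e) form \<Rightarrow> ('a, 'e) form"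
  where "dd_c \<A> J \<alpha> = ext_d \<A> (d_c \<A> J \<alpha>)"

definition anti_d :: "('a, 'e::euclidean_space) chart set \<Rightarrow> ('a, 'e) endo \<Rightarrow> ('a, 'e) form \<Rightarrow> ('a, 'e) form"
  where "anti_d \<A> J \<alpha> = ext_d \<A> (d_c \<A> J \<alpha>) + d_c \<A> J (ext_d \<A> \<alpha>)"

subsection \<open>Bigrading\<close>

text \<open>A pair \<open>(u, v)\<close> stands for the complexified tangent vector \<open>u + \<i>v\<close>. The complex-multilinear
  extension of a real-multilinear form to such vectors:\<close>

fun cext :: "('e list \<Rightarrow> complex) \<Rightarrow> ('e \<times> 'e) list \<Rightarrow> complex" where
  "cext \<phi> [] = \<phi> []"
| "cext \<phi> (z # zs) = cext (\<lambda>vs. \<phi> (fst z # vs)) zs + \<i> * cext (\<lambda>vs. \<phi> (snd z # vs)) zs"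

text \<open>The eigenspaces \<open>Jz = \<i>z\<close> and \<open>Jz = -\<i>z\<close>.\<close>

definition T10 :: "('e::real_vector \<Rightarrow> 'e) \<Rightarrow> ('e \<times> 'e) set" where
  "T10 j = {(u, v). j u = - v \<and> j v = u}"

definition T01 :: "('e::real_vector \<Rightarrow> 'e) \<Rightarrow> ('e \<times> 'e) set" where
  "T01 j = {(u, v). j u = v \<and> j v = - u}"

text \<open>\<open>A\<^sup>p\<^sup>,\<^sup>q\<close>: the forms of degree \<open>p + q\<close> that vanish on all tuples of vectors of type \<open>(1,0)\<close> and
  \<open>(0,1)\<close>, unless \<open>p\<close> of them have type \<open>(1,0)\<close> and \<open>q\<close> have type \<open>(0,1)\<close>. By alternation it is
  enough to consider tuples in which the vectors of type \<open>(1,0)\<close> come first.\<close>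

definition forms_pq ::
  "('a, 'e::euclidean_space) chart set \<Rightarrow> ('a, 'e) endo \<Rightarrow> int \<Rightarrow> int \<Rightarrow> ('a, 'e) form set" where
  "forms_pq \<A> J p q = {\<alpha> \<in> forms \<A> (p + q).
     \<forall>c\<in>\<A>. \<forall>x\<in>fst c. \<forall>zs ws. set zs \<subseteq> T10 (J c x) \<and> set ws \<subseteq> T01 (J c x) \<and>
       \<not> (int (length zs) = p \<and> int (length ws) = q) \<longrightarrow> cext (\<alpha> c x) (zs @ ws) = 0}"

text \<open>The component in \<open>A\<^sup>p\<^sup>,\<^sup>q\<close> of a form \<open>\<alpha>\<close> of degree \<open>p + q\<close>.\<close>

definition part_pq ::
  "('a, 'e::euclidean_space) chart set \<Rightarrow> ('a, 'e) endo \<Rightarrow> int \<Rightarrow> int \<Rightarrow> ('a, 'e) form \<Rightarrow> ('a, 'e) form" where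
  "part_pq \<A> J p q \<alpha> =
     (THE f. (\<forall>r. f r \<in> forms_pq \<A> J r (p + q - r)) \<and> \<alpha> = (\<Sum>r\<in>{0..p + q}. f r)) p"

section \<open>Complex vector spaces and their quotients\<close>

definition complex_ring :: "complex ring" where
  "complex_ring = \<lparr>carrier = UNIV, mult = (*), one = 1, zero = 0, add = (+)\<rparr>"

text \<open>The record type of modules extends that of rings; the fields \<open>mult\<close> and \<open>one\<close> of a module
  play no role.\<close>

definition form_module :: "('a, 'e) form set \<Rightarrow> (complex, ('a, 'e) form) module" where
  "form_module V = \<lparr>carrier = V, mult = undefined, one = undefined, zero = 0, add = (+),
     smult = (\<lambda>z \<alpha> c x vs. z * \<alpha> c x vs)\<rparr>"

definition quot_module :: "('r, 'm) module \<Rightarrow> 'm set \<Rightarrow> ('r, 'm set) module" where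
  "quot_module V N = \<lparr>carrier = a_rcosets\<^bsub>V\<^esub> N, mult = undefined, one = undefined, zero = N,
     add = set_add V, smult = (\<lambda>z X. \<Union>v\<in>X. N +>\<^bsub>V\<^esub> (z \<odot>\<^bsub>V\<^esub> v))\<rparr>"

definition complex_linear :: "(complex, 'm) module \<Rightarrow> (complex, 'n) module \<Rightarrow> ('m \<Rightarrow> 'n) \<Rightarrow> bool" where
  "complex_linear V W F \<longleftrightarrow>
     Module.module complex_ring V \<and> Module.module complex_ring W \<and> F \<in> carrier V \<rightarrow> carrier W \<and>
     (\<forall>u\<in>carrier V. \<forall>v\<in>carrier V. F (u \<oplus>\<^bsub>V\<^esub> v) = F u \<oplus>\<^bsub>W\<^esub> F v) \<and>
     (\<forall>z. \<forall>v\<in>carrier V. F (z \<odot>\<^bsub>V\<^esub> v) = z \<odot>\<^bsub>W\<^esub> F v)"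

text \<open>\<open>F: V \<rightarrow> W\<close> is a well-defined linear map with \<open>F [\<alpha>] = [f \<alpha>]\<close> for all representatives
  \<open>\<alpha> \<in> Z\<close>, where \<open>cl\<close> and \<open>cl'\<close> send representatives to their classes in \<open>V\<close> and \<open>W\<close>.\<close>

definition induced ::
  "(complex, 'm) module \<Rightarrow> (complex, 'n) module \<Rightarrow> 'f set \<Rightarrow> ('f \<Rightarrow> 'm) \<Rightarrow> ('f \<Rightarrow> 'n) \<Rightarrow> ('f \<Rightarrow> 'f) \<Rightarrow>
    ('m \<Rightarrow> 'n) \<Rightarrow> bool" where
  "induced V W Z cl cl' f F \<longleftrightarrow> complex_linear V W F \<and> (\<forall>\<alpha>\<in>Z. F (cl \<alpha>) = cl' (f \<alpha>))"

section \<open>Cohomologies\<close>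

text \<open>Each cohomology comes with its representatives \<open>Z_\<dots>\<close>, the subspace \<open>N_\<dots>\<close> that is divided
  out, the quotient \<open>H_\<dots>\<close> and the map \<open>cl_\<dots>\<close> from representatives to classes.\<close>

context
  fixes \<A> :: "('a, 'e::euclidean_space) chart set" and J :: "('a, 'e) endo"
begin

definition Z_d :: "int \<Rightarrow> ('a, 'e) form set" where
  "Z_d k = {\<alpha> \<in> forms \<A> k. ext_d \<A> \<alpha> = 0}"
definition N_d :: "int \<Rightarrow> ('a, 'e) form set" where
  "N_d k = ext_d \<A> ` forms \<A> (k - 1)"
definition H_d :: "int \<Rightarrow> (complex, ('a, 'e) form set) module" where
  "H_d k = quot_module (form_module (Z_d k)) (N_d k)"
definition cl_d :: "int \<Rightarrow> ('a, 'e) form \<Rightarrow> ('a, 'e) form set" where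
  "cl_d k \<alpha> = N_d k +>\<^bsub>form_module (Z_d k)\<^esub> \<alpha>"

definition Z_dc :: "int \<Rightarrow> ('a, 'e) form set" where
  "Z_dc k = {\<alpha> \<in> forms \<A> k. d_c \<A> J \<alpha> = 0}"
definition N_dc :: "int \<Rightarrow> ('a, 'e) form set" where
  "N_dc k = d_c \<A> J ` forms \<A> (k - 1)"
definition H_dc :: "int \<Rightarrow> (complex, ('a, 'e) form set) module" where
  "H_dc k = quot_module (form_module (Z_dc k)) (N_dc k)"
definition cl_dc :: "int \<Rightarrow> ('a, 'e) form \<Rightarrow> ('a, 'e) form set" where
  "cl_dc k \<alpha> = N_dc k +>\<^bsub>form_module (Z_dc k)\<^esub> \<alpha>"

subsection \<open>Bott-Chern cohomology of an almost complex manifold\<close>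

definition B_forms :: "int \<Rightarrow> ('a, 'e) form set" where
  "B_forms k = {\<alpha> \<in> forms \<A> k. anti_d \<A> J \<alpha> = 0}"

definition Z_BC :: "int \<Rightarrow> ('a, 'e) form set" where
  "Z_BC k = {\<alpha> \<in> B_forms k. ext_d \<A> \<alpha> = 0 \<and> d_c \<A> J \<alpha> = 0}"
definition N_BC :: "int \<Rightarrow> ('a, 'e) form set" where
  "N_BC k = dd_c \<A> J ` B_forms (k - 2)"
definition H_BC :: "int \<Rightarrow> (complex, ('a, 'e) form set) module" where
  "H_BC k = quot_module (form_module (Z_BC k)) (N_BC k)"
definition cl_BC :: "int \<Rightarrow> ('a, 'e) form \<Rightarrow> ('a, 'e) form set" where
  "cl_BC k \<alpha> = N_BC k +>\<^bsub>form_module (Z_BC k)\<^esub> \<alpha>"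

subsection \<open>Aeppli cohomology of an almost complex manifold\<close>

definition C_forms :: "int \<Rightarrow> (complex, ('a, 'e) form set) module" where
  "C_forms k = quot_module (form_module (forms \<A> k)) (anti_d \<A> J ` forms \<A> (k - 2))"

definition to_C :: "int \<Rightarrow> ('a, 'e) form \<Rightarrow> ('a, 'e) form set" where
  "to_C k \<alpha> = (anti_d \<A> J ` forms \<A> (k - 2)) +>\<^bsub>form_module (forms \<A> k)\<^esub> \<alpha>"

text \<open>The operators \<open>C\<^sup>k \<rightarrow> C\<^sup>k\<^sup>+\<^sup>1\<close> induced by \<open>d\<close> and \<open>d\<^sup>c\<close>.\<close>

definition d_C :: "int \<Rightarrow> ('a, 'e) form set \<Rightarrow> ('a, 'e) form set" where
  "d_C k X = (\<Union>\<alpha>\<in>X. to_C (k + 1) (ext_d \<A> \<alpha>))"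

definition dc_C :: "int \<Rightarrow> ('a, 'e) form set \<Rightarrow> ('a, 'e) form set" where
  "dc_C k X = (\<Union>\<alpha>\<in>X. to_C (k + 1) (d_c \<A> J \<alpha>))"

definition ker_ddc_C :: "int \<Rightarrow> ('a, 'e) form set set" where
  "ker_ddc_C k = {X \<in> carrier (C_forms k). d_C (k + 1) (dc_C k X) = \<zero>\<^bsub>C_forms (k + 2)\<^esub>}"

definition Z_A :: "int \<Rightarrow> ('a, 'e) form set" where
  "Z_A k = {\<alpha> \<in> forms \<A> k. to_C k \<alpha> \<in> ker_ddc_C k}"
definition N_A :: "int \<Rightarrow> ('a, 'e) form set set" where
  "N_A k = set_add (C_forms k)
     (d_C (k - 1) ` carrier (C_forms (k - 1))) (dc_C (k - 1) ` carrier (C_forms (k - 1)))"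
definition H_A :: "int \<Rightarrow> (complex, ('a, 'e) form set set) module" where
  "H_A k = quot_module ((C_forms k)\<lparr>carrier := ker_ddc_C k\<rparr>) (N_A k)"
definition cl_A :: "int \<Rightarrow> ('a, 'e) form \<Rightarrow> ('a, 'e) form set set" where
  "cl_A k \<alpha> = N_A k +>\<^bsub>C_forms k\<^esub> to_C k \<alpha>"

subsection \<open>Bott-Chern and Aeppli cohomology of a complex manifold\<close>

definition Z_BC_pq :: "int \<Rightarrow> int \<Rightarrow> ('a, 'e) form set" where
  "Z_BC_pq p q = {\<alpha> \<in> forms_pq \<A> J p q. ext_d \<A> \<alpha> = 0 \<and> d_c \<A> J \<alpha> = 0}"
definition N_BC_pq :: "int \<Rightarrow> int \<Rightarrow> ('a, 'e) form set" where
  "N_BC_pq p q = dd_c \<A> J ` forms \<A> (p + q - 2) \<inter> forms_pq \<A> J p q"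
definition H_BC_pq :: "int \<Rightarrow> int \<Rightarrow> (complex, ('a, 'e) form set) module" where
  "H_BC_pq p q = quot_module (form_module (Z_BC_pq p q)) (N_BC_pq p q)"
definition cl_BC_pq :: "int \<Rightarrow> int \<Rightarrow> ('a, 'e) form \<Rightarrow> ('a, 'e) form set" where
  "cl_BC_pq p q \<alpha> = N_BC_pq p q +>\<^bsub>form_module (Z_BC_pq p q)\<^esub> \<alpha>"

definition Z_A_pq :: "int \<Rightarrow> int \<Rightarrow> ('a, 'e) form set" where
  "Z_A_pq p q = {\<alpha> \<in> forms_pq \<A> J p q. dd_c \<A> J \<alpha> = 0}"
definition N_A_pq :: "int \<Rightarrow> int \<Rightarrow> ('a, 'e) form set" where
  "N_A_pq p q = {ext_d \<A> \<beta> + d_c \<A> J \<gamma> | \<beta> \<gamma>.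
     \<beta> \<in> forms \<A> (p + q - 1) \<and> \<gamma> \<in> forms \<A> (p + q - 1)} \<inter> forms_pq \<A> J p q"
definition H_A_pq :: "int \<Rightarrow> int \<Rightarrow> (complex, ('a, 'e) form set) module" where
  "H_A_pq p q = quot_module (form_module (Z_A_pq p q)) (N_A_pq p q)"
definition cl_A_pq :: "int \<Rightarrow> int \<Rightarrow> ('a, 'e) form \<Rightarrow> ('a, 'e) form set" where
  "cl_A_pq p q \<alpha> = N_A_pq p q +>\<^bsub>form_module (Z_A_pq p q)\<^esub> \<alpha>"

end

end

theory Submission
  imports Defs
begin

text \<open>For arbitrary \<open>J\<close> everything follows from \<open>d\<^sup>2 = (d\<^sup>c)\<^sup>2 = 0\<close>: then \<open>dd\<^sup>c + d\<^sup>cd\<close> commutes with \<open>d\<close> and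
  \<open>d\<^sup>c\<close>, and \<open>J\<close>, whose square on \<open>k\<close>-forms is \<open>(-1)\<^sup>k\<close>, conjugates \<open>d\<close> into \<open>d\<^sup>c\<close>. In the integrable
  case let \<open>R\<^sub>t\<close> be the action of \<open>cos t + sin t J\<close> on forms. Forms of type \<open>(p, q)\<close> are those on which \<open>R\<^sub>t\<close>
  is multiplication by \<open>e\<^sup>i\<^sup>t\<^sup>(\<^sup>p\<^sup>-\<^sup>q\<^sup>)\<close>. In a chart where \<open>J\<close> is constant one reads off
  \<open>d R\<^sub>t = R\<^sub>t (cos t d + sin t d\<^sup>c)\<close> and \<open>dd\<^sup>c + d\<^sup>cd = 0\<close>. Therefore \<open>(d \<plusminus> i d\<^sup>c) / 2\<close> have type \<open>(1, 0)\<close>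
  and \<open>(0, 1)\<close>, \<open>dd\<^sup>c\<close> has type \<open>(1, 1)\<close>, and the Bott-Chern and Aeppli cohomologies split into their
  \<open>(p, q)\<close>-parts.\<close>

section \<open>Smooth functions\<close>

text \<open>Forms are families of coordinate expressions, so it is a theorem that
  \<open>ext_d\<close> respects changes of charts. The obstruction is the Hessian of the transition
  map; it is symmetric, and a double alternating sum with a symmetric kernel vanishes. The same
  cancellation gives \<open>d d = 0\<close> and, in charts where \<open>J\<close> is constant, the
  anticommutation of \<open>d\<close> and \<open>dc\<close>. Types are tested pointwise on
  complexified vectors, while the (p, q)-component has to be a smooth form with the right
  transformation law. Rotations bridge this gap: they come from smooth tensor fields, hence preserve
  the spaces of forms, and components are finite combinations of them. On k-forms the weights
  \<open>p - q = 2 * p - k\<close> differ by at most \<open>2 * k\<close>, so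
  \<open>2 * k + 1\<close> equidistant angles separate them. For general \<open>J\<close>,
  membership of \<beta> in B is what makes \<open>d (dc \<beta>)\<close> closed under
  \<open>dc\<close>; dually, passing to C is what kills \<open>d (dc \<alpha>)\<close> for d-closed
  \<alpha>. In the integrable case B is the space of all forms, C is the same space up to wrapping
  forms into singletons, and the bigraded groups are compared with the graded ones by inclusion and
  by projection to components.\<close>

lemma Ck_on_cong:
  assumes "open S" "\<And>x. x \<in> S \<Longrightarrow> f x = g x" "Ck_on k S f"
  shows "Ck_on k S g"
  using assms(2,3)
proof (induction k arbitrary: f g)
  case 0
  then show ?case by (simp cong: continuous_on_cong)
next
  case (Suc k)
  have fd: "(g has_derivative frechet_derivative f (at x)) (at x)" if "x \<in> S" for x
  proof -
    have "(f has_derivative frechet_derivative f (at x)) (at x)"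
      by (rule frechet_derivative_works[THEN iffD1]) (use Suc.prems that in simp)
    then show ?thesis
      by (rule has_derivative_transform_within_open[OF _ assms(1) that]) (simp add: Suc.prems)
  qed
  then have eq: "frechet_derivative f (at x) = frechet_derivative g (at x)" if "x \<in> S" for x
    using frechet_derivative_at that by blast
  have "Ck_on k S (\<lambda>x. frechet_derivative g (at x) v)" for v
  proof (rule Suc.IH)
    show "Ck_on k S (\<lambda>x. frechet_derivative f (at x) v)" using Suc.prems by simp
  qed (simp add: eq)
  then show ?case
    using fd unfolding Ck_on.simps differentiable_def by blast
qed

lemma Ck_on_Suc_D: "Ck_on (Suc k) S f \<Longrightarrow> Ck_on k S f"
proof (induction k arbitrary: f)
  case 0
  then show ?case
    by (auto intro!: differentiable_imp_continuous_on differentiable_at_imp_differentiable_on)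
qed auto

text \<open>Derivatives on an open set only see the values there. This matters because coordinate
  expressions of forms are meaningful only on the image of a chart.\<close>

lemma smooth_on_cong:
  assumes "open S" "smooth_on S f" "\<And>x. x \<in> S \<Longrightarrow> f x = g x"
  shows "smooth_on S g"
  using assms Ck_on_cong unfolding smooth_on_def by blast

lemma smooth_on_differentiable: "smooth_on S f \<Longrightarrow> x \<in> S \<Longrightarrow> f differentiable (at x)"
  unfolding smooth_on_def by (auto dest: spec[of _ "Suc 0"])

lemma smooth_on_has_derivative:
  "smooth_on S f \<Longrightarrow> x \<in> S \<Longrightarrow> (f has_derivative frechet_derivative f (at x)) (at x)"
  using smooth_on_differentiable frechet_derivative_works by blast

lemma smooth_on_frechet_derivative:
  "smooth_on S f \<Longrightarrow> smooth_on S (\<lambda>x. frechet_derivative f (at x) v)"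
  unfolding smooth_on_def
proof (intro allI)
  fix k assume "\<forall>k. Ck_on k S f"
  then have "Ck_on (Suc k) S f" ..
  then show "Ck_on k S (\<lambda>x. frechet_derivative f (at x) v)" by simp
qed

lemma smooth_on_continuous_on: "smooth_on S f \<Longrightarrow> continuous_on S f"
  unfolding smooth_on_def by (auto dest: spec[of _ 0])

lemma Ck_on_const: "Ck_on k S (\<lambda>x. c)"
  by (induction k arbitrary: c) auto

lemma smooth_on_const [simp]: "smooth_on S (\<lambda>x. c)"
  by (simp add: smooth_on_def Ck_on_const)

text \<open>Any formula for the derivative that is valid on \<open>S\<close> may replace
  \<open>frechet_derivative\<close>; the closure properties below are inductions through this
  rule.\<close>

lemma Ck_on_SucI:
  assumes "open S" "\<And>x. x \<in> S \<Longrightarrow> (f has_derivative f' x) (at x)"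
    and "\<And>v. Ck_on k S (\<lambda>x. f' x v)"
  shows "Ck_on (Suc k) S f"
proof -
  have "Ck_on k S (\<lambda>x. frechet_derivative f (at x) v)" for v
    by (rule Ck_on_cong[OF assms(1) _ assms(3)[of v]]) (simp add: frechet_derivative_at[OF assms(2), symmetric])
  then show ?thesis using assms(2) by (auto simp: differentiable_def)
qed

lemma Ck_on_bounded_linear:
  assumes "open S" "bounded_linear L" "Ck_on k S f"
  shows "Ck_on k S (\<lambda>x. L (f x))"
  using assms(3)
proof (induction k arbitrary: f)
  case 0
  then show ?case using assms(2) by (simp add: linear_continuous_on_compose linear_continuous_on
        bounded_linear.continuous_on)
next
  case (Suc k)
  have D: "(f has_derivative frechet_derivative f (at x)) (at x)" if "x \<in> S" for x
    by (rule frechet_derivative_works[THEN iffD1]) (use Suc.prems that in simp)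
  have fd: "((\<lambda>x. L (f x)) has_derivative (\<lambda>v. L (frechet_derivative f (at x) v))) (at x)"
    if "x \<in> S" for x
    by (rule bounded_linear.has_derivative[OF assms(2) D[OF that]])
  show ?case
  proof (rule Ck_on_SucI[OF assms(1) fd])
    fix v show "Ck_on k S (\<lambda>x. L (frechet_derivative f (at x) v))"
      by (rule Suc.IH) (use Suc.prems in simp)
  qed
qed

lemma smooth_on_bounded_linear:
  "open S \<Longrightarrow> bounded_linear L \<Longrightarrow> smooth_on S f \<Longrightarrow> smooth_on S (\<lambda>x. L (f x))"
  by (simp add: smooth_on_def Ck_on_bounded_linear)

lemma Ck_on_add:
  assumes "open S" "Ck_on k S f" "Ck_on k S g"
  shows "Ck_on k S (\<lambda>x. f x + g x)"
  using assms(2,3)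
proof (induction k arbitrary: f g)
  case 0
  then show ?case by (simp add: continuous_on_add)
next
  case (Suc k)
  have D: "(f has_derivative frechet_derivative f (at x)) (at x)"
    "(g has_derivative frechet_derivative g (at x)) (at x)" if "x \<in> S" for x
    by (rule frechet_derivative_works[THEN iffD1]; use Suc.prems that in simp)+
  have fd: "((\<lambda>x. f x + g x) has_derivative
      (\<lambda>v. frechet_derivative f (at x) v + frechet_derivative g (at x) v)) (at x)" if "x \<in> S" for x
    by (rule has_derivative_add[OF D(1)[OF that] D(2)[OF that]])
  show ?case
  proof (rule Ck_on_SucI[OF assms(1) fd])
    fix v show "Ck_on k S (\<lambda>x. frechet_derivative f (at x) v + frechet_derivative g (at x) v)"
      by (rule Suc.IH) (use Suc.prems in simp_all)
  qed
qed

lemma smooth_on_add: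
  "open S \<Longrightarrow> smooth_on S f \<Longrightarrow> smooth_on S g \<Longrightarrow> smooth_on S (\<lambda>x. f x + g x)"
  by (simp add: smooth_on_def Ck_on_add)

lemma smooth_on_sum:
  "open S \<Longrightarrow> (\<And>i. i \<in> I \<Longrightarrow> smooth_on S (f i)) \<Longrightarrow> smooth_on S (\<lambda>x. \<Sum>i\<in>I. f i x)"
  by (induction I rule: infinite_finite_induct) (simp_all add: smooth_on_add)

lemma Ck_on_scaleR:
  fixes f :: "'e::euclidean_space \<Rightarrow> real"
  assumes "open S" "Ck_on k S f" "Ck_on k S g"
  shows "Ck_on k S (\<lambda>x. f x *\<^sub>R g x)"
  using assms(2,3)
proof (induction k arbitrary: f g)
  case 0
  then show ?case by (simp add: continuous_on_scaleR)
next
  case (Suc k)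
  have D: "(f has_derivative frechet_derivative f (at x)) (at x)"
    "(g has_derivative frechet_derivative g (at x)) (at x)" if "x \<in> S" for x
    by (rule frechet_derivative_works[THEN iffD1]; use Suc.prems that in simp)+
  have fd: "((\<lambda>x. f x *\<^sub>R g x) has_derivative
      (\<lambda>v. f x *\<^sub>R frechet_derivative g (at x) v + frechet_derivative f (at x) v *\<^sub>R g x)) (at x)"
    if "x \<in> S" for x
    by (rule has_derivative_scaleR[OF D(1)[OF that] D(2)[OF that]])
  show ?case
  proof (rule Ck_on_SucI[OF assms(1) fd])
    \<comment> \<open>The product rule brings back \<open>f\<close> and \<open>g\<close> themselves,
      which are one degree more regular than required here.\<close>
    fix v
    show "Ck_on k S (\<lambda>x. f x *\<^sub>R frechet_derivative g (at x) v + frechet_derivative f (at x) v *\<^sub>R g x)"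
      by (rule Ck_on_add[OF assms(1)]; rule Suc.IH)
        (use Suc.prems Ck_on_Suc_D[OF Suc.prems(1)] Ck_on_Suc_D[OF Suc.prems(2)] in simp_all)
  qed
qed

lemma smooth_on_scaleR:
  fixes f :: "'e::euclidean_space \<Rightarrow> real"
  shows "open S \<Longrightarrow> smooth_on S f \<Longrightarrow> smooth_on S g \<Longrightarrow> smooth_on S (\<lambda>x. f x *\<^sub>R g x)"
  by (simp add: smooth_on_def Ck_on_scaleR)

lemma smooth_on_cmult:
  fixes f :: "'e::euclidean_space \<Rightarrow> complex"
  shows "open S \<Longrightarrow> smooth_on S f \<Longrightarrow> smooth_on S (\<lambda>x. z * f x)"
  by (rule smooth_on_bounded_linear) (auto intro: bounded_linear_mult_right)

lemma smooth_on_inner: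
  "open S \<Longrightarrow> smooth_on S f \<Longrightarrow> smooth_on S (\<lambda>x. f x \<bullet> b)"
  by (rule smooth_on_bounded_linear) (auto intro: bounded_linear_inner_left)

subsection \<open>Symmetry of second derivatives\<close>

text \<open>The second difference over the parallelogram with sides \<open>h u\<close> and
  \<open>h v\<close> is evaluated by two mean value theorems: along \<open>u\<close> for the
  increment in direction \<open>v\<close>, then along \<open>v\<close> for the derivative
  \<open>D\<close> in direction \<open>u\<close>.\<close>

lemma second_difference_mean_value:
  fixes f :: "'e::euclidean_space \<Rightarrow> real"
  assumes h: "h > 0"
    and S: "\<And>s t. 0 \<le> s \<Longrightarrow> s \<le> h \<Longrightarrow> 0 \<le> t \<Longrightarrow> t \<le> h \<Longrightarrow> x + s *\<^sub>R u + t *\<^sub>R v \<in> S"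
    and f: "smooth_on S f"
  shows "\<exists>s t. 0 \<le> s \<and> s \<le> h \<and> 0 \<le> t \<and> t \<le> h \<and>
    f (x + h *\<^sub>R u + h *\<^sub>R v) - f (x + h *\<^sub>R u) - f (x + h *\<^sub>R v) + f x =
      h * h * frechet_derivative (\<lambda>y. frechet_derivative f (at y) u) (at (x + s *\<^sub>R u + t *\<^sub>R v)) v"
proof -
  define D where "D y = frechet_derivative f (at y) u" for y
  have fd: "((\<lambda>s. f (x + s *\<^sub>R u + t *\<^sub>R v)) has_derivative (\<lambda>r. r * D (x + s *\<^sub>R u + t *\<^sub>R v))) (at s)"
    if "0 \<le> s" "s \<le> h" "0 \<le> t" "t \<le> h" for s t
  proof -
    have F: "(f has_derivative frechet_derivative f (at (x + s *\<^sub>R u + t *\<^sub>R v)))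
        (at (x + s *\<^sub>R u + t *\<^sub>R v))" (is "(f has_derivative ?F) _")
      using S[OF that] f smooth_on_has_derivative by blast
    have "((\<lambda>s. f (x + s *\<^sub>R u + t *\<^sub>R v)) has_derivative (\<lambda>r. ?F (r *\<^sub>R u))) (at s)"
      by (rule has_derivative_compose[where g = f and g' = ?F]) (auto intro!: derivative_eq_intros F)
    moreover have "?F (r *\<^sub>R u) = r * D (x + s *\<^sub>R u + t *\<^sub>R v)" for r
      unfolding D_def using linear_scale[OF has_derivative_linear[OF F]] by simp
    ultimately show ?thesis by simp
  qed
  have Dd: "((\<lambda>t. D (x + s *\<^sub>R u + t *\<^sub>R v)) has_derivative
      (\<lambda>r. r * frechet_derivative D (at (x + s *\<^sub>R u + t *\<^sub>R v)) v)) (at t)"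
    if "0 \<le> s" "s \<le> h" "0 \<le> t" "t \<le> h" for s t
  proof -
    have "smooth_on S D" unfolding D_def using f smooth_on_frechet_derivative by blast
    then have F: "(D has_derivative frechet_derivative D (at (x + s *\<^sub>R u + t *\<^sub>R v)))
        (at (x + s *\<^sub>R u + t *\<^sub>R v))" (is "(D has_derivative ?F) _")
      using S[OF that] smooth_on_has_derivative by blast
    have "((\<lambda>t. D (x + s *\<^sub>R u + t *\<^sub>R v)) has_derivative (\<lambda>r. ?F (r *\<^sub>R v))) (at t)"
      by (rule has_derivative_compose[where g = D and g' = ?F]) (auto intro!: derivative_eq_intros F)
    moreover have "?F (r *\<^sub>R v) = r * ?F v" for r
      using linear_scale[OF has_derivative_linear[OF F]] by simp
    ultimately show ?thesis by simp
  qed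
  have "\<exists>s\<in>{0<..<h}. (f (x + h *\<^sub>R u + h *\<^sub>R v) - f (x + h *\<^sub>R u + 0 *\<^sub>R v)) -
      (f (x + 0 *\<^sub>R u + h *\<^sub>R v) - f (x + 0 *\<^sub>R u + 0 *\<^sub>R v)) =
      (h - 0) * D (x + s *\<^sub>R u + h *\<^sub>R v) - (h - 0) * D (x + s *\<^sub>R u + 0 *\<^sub>R v)"
  proof (rule mvt_simple[where f = "\<lambda>s. f (x + s *\<^sub>R u + h *\<^sub>R v) - f (x + s *\<^sub>R u + 0 *\<^sub>R v)"])
    show "((\<lambda>s. f (x + s *\<^sub>R u + h *\<^sub>R v) - f (x + s *\<^sub>R u + 0 *\<^sub>R v)) has_derivative
        (\<lambda>r. r * D (x + s *\<^sub>R u + h *\<^sub>R v) - r * D (x + s *\<^sub>R u + 0 *\<^sub>R v))) (at s within {0..h})"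
      if "0 \<le> s" "s \<le> h" for s
      by (rule has_derivative_at_withinI[OF has_derivative_diff[OF fd fd]]) (use h that in simp_all)
  qed (rule h)
  then obtain s where s: "s \<in> {0<..<h}" and 1: "f (x + h *\<^sub>R u + h *\<^sub>R v) - f (x + h *\<^sub>R u) -
      (f (x + h *\<^sub>R v) - f x) = h * (D (x + s *\<^sub>R u + h *\<^sub>R v) - D (x + s *\<^sub>R u))"
    by (auto simp: algebra_simps)
  have "\<exists>t\<in>{0<..<h}. D (x + s *\<^sub>R u + h *\<^sub>R v) - D (x + s *\<^sub>R u + 0 *\<^sub>R v) =
      (h - 0) * frechet_derivative D (at (x + s *\<^sub>R u + t *\<^sub>R v)) v"
  proof (rule mvt_simple[where f = "\<lambda>t. D (x + s *\<^sub>R u + t *\<^sub>R v)"])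
    show "((\<lambda>t. D (x + s *\<^sub>R u + t *\<^sub>R v)) has_derivative
        (\<lambda>r. r * frechet_derivative D (at (x + s *\<^sub>R u + t *\<^sub>R v)) v)) (at t within {0..h})"
      if "0 \<le> t" "t \<le> h" for t
      by (rule has_derivative_at_withinI[OF Dd]) (use s that in simp_all)
  qed (rule h)
  then obtain t where t: "t \<in> {0<..<h}" and 2: "D (x + s *\<^sub>R u + h *\<^sub>R v) - D (x + s *\<^sub>R u) =
      h * frechet_derivative D (at (x + s *\<^sub>R u + t *\<^sub>R v)) v"
    by auto
  have "f (x + h *\<^sub>R u + h *\<^sub>R v) - f (x + h *\<^sub>R u) - f (x + h *\<^sub>R v) + f x =
      h * h * frechet_derivative D (at (x + s *\<^sub>R u + t *\<^sub>R v)) v"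
    using 1 2 by simp
  then show ?thesis
    unfolding D_def using s t by (intro exI[of _ s] exI[of _ t]) auto
qed

text \<open>The second difference is symmetric in \<open>u\<close> and \<open>v\<close>, so
  \<open>D u v\<close> at one point of a small parallelogram equals \<open>D v u\<close> at another.
  Both points are close to \<open>x\<close>, and continuity does the rest.\<close>

lemma second_derivative_commute_real:
  fixes f :: "'e::euclidean_space \<Rightarrow> real"
  assumes S: "open S" "x \<in> S" and f: "smooth_on S f"
  shows "frechet_derivative (\<lambda>y. frechet_derivative f (at y) u) (at x) v =
    frechet_derivative (\<lambda>y. frechet_derivative f (at y) v) (at x) u"
proof -
  define D where "D u v y = frechet_derivative (\<lambda>y. frechet_derivative f (at y) u) (at y) v" for u v y
  have "\<bar>D u v x - D v u x\<bar> \<le> e" if e: "e > 0" for e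
  proof -
    have "\<exists>d>0. \<forall>y. dist y x < d \<longrightarrow> y \<in> S \<and> dist (D u v y) (D u v x) < e / 2" for u v
    proof -
      have "continuous_on S (D u v)"
        unfolding D_def
        by (intro smooth_on_continuous_on smooth_on_frechet_derivative f)
      then obtain d1 where "d1 > 0" "\<And>y. y \<in> S \<Longrightarrow> dist y x < d1 \<Longrightarrow> dist (D u v y) (D u v x) < e / 2"
        using S e unfolding continuous_on_iff by (meson half_gt_zero)
      moreover obtain d2 where "d2 > 0" "\<And>y. dist y x < d2 \<Longrightarrow> y \<in> S"
        using S by (meson open_dist)
      ultimately show ?thesis by (intro exI[of _ "min d1 d2"]) auto
    qed
    then obtain d1 d2 where d1: "d1 > 0" "\<And>y. dist y x < d1 \<Longrightarrow> y \<in> S \<and> dist (D u v y) (D u v x) < e / 2"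
      and d2: "d2 > 0" "\<And>y. dist y x < d2 \<Longrightarrow> y \<in> S \<and> dist (D v u y) (D v u x) < e / 2"
      by metis
    \<comment> \<open>Small enough to keep the parallelogram within \<open>min d1 d2\<close> of
      \<open>x\<close>; the summand 1 keeps the denominator positive when \<open>u\<close> and
      \<open>v\<close> are zero.\<close>
    define h where "h = min d1 d2 / (2 * (norm u + norm v + 1))"
    have pos: "norm u + norm v + 1 > 0" by (simp add: add_nonneg_pos)
    have h: "h > 0" unfolding h_def using d1 d2 pos by simp
    have hd: "h * (norm u + norm v) < min d1 d2"
    proof -
      have "h * (norm u + norm v) \<le> h * (norm u + norm v + 1)" using h by simp
      also have "\<dots> = min d1 d2 / 2" unfolding h_def using pos by (simp add: field_simps)
      also have "\<dots> < min d1 d2" using d1 d2 by auto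
      finally show ?thesis .
    qed
    \<comment> \<open>Formulated for sides \<open>a\<close>, \<open>b\<close> with the same sum of
      norms as \<open>u\<close>, \<open>v\<close>, so that it serves both orders of the two
      directions.\<close>
    have dist: "dist (x + s *\<^sub>R a + t *\<^sub>R b) x < min d1 d2"
      if "0 \<le> s" "s \<le> h" "0 \<le> t" "t \<le> h" "norm a + norm b = norm u + norm v" for s t a b
    proof -
      have "dist (x + s *\<^sub>R a + t *\<^sub>R b) x = norm (s *\<^sub>R a + t *\<^sub>R b)" by (simp add: dist_norm)
      also have "\<dots> \<le> s * norm a + t * norm b" using that by (metis norm_triangle_le norm_scaleR abs_of_nonneg order_refl)
      also have "\<dots> \<le> h * norm a + h * norm b" using that by (intro add_mono mult_right_mono) auto
      also have "\<dots> = h * (norm u + norm v)" using that by (metis distrib_left)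
      also note hd
      finally show ?thesis .
    qed
    have SS: "x + s *\<^sub>R a + t *\<^sub>R b \<in> S"
      if "0 \<le> s" "s \<le> h" "0 \<le> t" "t \<le> h" "norm a + norm b = norm u + norm v" for s t a b
      using dist[OF that] d1 by auto
    obtain s t where st: "0 \<le> s" "s \<le> h" "0 \<le> t" "t \<le> h"
      and 1: "f (x + h *\<^sub>R u + h *\<^sub>R v) - f (x + h *\<^sub>R u) - f (x + h *\<^sub>R v) + f x =
        h * h * D u v (x + s *\<^sub>R u + t *\<^sub>R v)"
      using second_difference_mean_value[OF h SS f, of u v] unfolding D_def by auto
    obtain s' t' where st': "0 \<le> s'" "s' \<le> h" "0 \<le> t'" "t' \<le> h"
      and 2: "f (x + h *\<^sub>R v + h *\<^sub>R u) - f (x + h *\<^sub>R v) - f (x + h *\<^sub>R u) + f x =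
        h * h * D v u (x + s' *\<^sub>R v + t' *\<^sub>R u)"
      using second_difference_mean_value[OF h SS f, of v u] unfolding D_def by auto
    have "x + h *\<^sub>R v + h *\<^sub>R u = x + h *\<^sub>R u + h *\<^sub>R v" by simp
    then have "h * h * D u v (x + s *\<^sub>R u + t *\<^sub>R v) = h * h * D v u (x + s' *\<^sub>R v + t' *\<^sub>R u)"
      unfolding 1[symmetric] 2[symmetric] by (simp only:)
    then have "D u v (x + s *\<^sub>R u + t *\<^sub>R v) = D v u (x + s' *\<^sub>R v + t' *\<^sub>R u)"
      using h by simp
    moreover have "dist (D u v (x + s *\<^sub>R u + t *\<^sub>R v)) (D u v x) < e / 2"
      using d1(2) dist[OF st] by simp
    moreover have "dist (D v u (x + s' *\<^sub>R v + t' *\<^sub>R u)) (D v u x) < e / 2"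
      using d2(2) dist[OF st'] by simp
    ultimately show ?thesis unfolding dist_real_def by linarith
  qed
  then have "D u v x = D v u x"
    by (metis abs_ge_zero abs_0_eq add_0 eq_iff_diff_eq_0 field_le_epsilon order_antisym)
  then show ?thesis by (simp add: D_def)
qed

lemma frechet_derivative_inner:
  "f differentiable (at x) \<Longrightarrow>
    frechet_derivative (\<lambda>y. f y \<bullet> b) (at x) v = frechet_derivative f (at x) v \<bullet> b"
  by (simp flip: frechet_derivative_at[OF has_derivative_inner_left[OF frechet_derivative_works[THEN iffD1]]])

lemma frechet_derivative_cong:
  assumes "open S" "x \<in> S" "\<And>y. y \<in> S \<Longrightarrow> f y = g y"
  shows "frechet_derivative f (at x) = frechet_derivative g (at x)"
proof -
  have "(f has_derivative f') (at x) \<longleftrightarrow> (g has_derivative f') (at x)" for f'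
    using has_derivative_transform_within_open[OF _ assms(1,2), of f f' UNIV g]
      has_derivative_transform_within_open[OF _ assms(1,2), of g f' UNIV f] assms(3) by auto
  then show ?thesis by (simp add: frechet_derivative_def)
qed

lemma second_derivative_commute:
  fixes f :: "'e::euclidean_space \<Rightarrow> 'b::euclidean_space"
  assumes S: "open S" "x \<in> S" and f: "smooth_on S f"
  shows "frechet_derivative (\<lambda>y. frechet_derivative f (at y) u) (at x) v =
    frechet_derivative (\<lambda>y. frechet_derivative f (at y) v) (at x) u"
proof (rule euclidean_eqI)
  fix b :: 'b
  have *: "frechet_derivative (\<lambda>y. frechet_derivative f (at y) u) (at x) v \<bullet> b =
      frechet_derivative (\<lambda>y. frechet_derivative (\<lambda>y. f y \<bullet> b) (at y) u) (at x) v" for u v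
  proof -
    have "frechet_derivative (\<lambda>y. frechet_derivative f (at y) u) (at x) v \<bullet> b =
        frechet_derivative (\<lambda>y. frechet_derivative f (at y) u \<bullet> b) (at x) v"
      by (rule frechet_derivative_inner[symmetric])
         (rule smooth_on_differentiable[OF smooth_on_frechet_derivative[OF f] S(2)])
    also have "\<dots> = frechet_derivative (\<lambda>y. frechet_derivative (\<lambda>y. f y \<bullet> b) (at y) u) (at x) v"
      by (rule fun_cong, rule frechet_derivative_cong[OF S])
         (simp add: frechet_derivative_inner smooth_on_differentiable[OF f])
    finally show ?thesis .
  qed
  show "frechet_derivative (\<lambda>y. frechet_derivative f (at y) u) (at x) v \<bullet> b =
      frechet_derivative (\<lambda>y. frechet_derivative f (at y) v) (at x) u \<bullet> b"
    unfolding * by (rule second_derivative_commute_real[OF S smooth_on_inner[OF S(1) f]])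
qed

section \<open>Alternating forms\<close>

lemma alternating_form_degree: "alternating_form k \<phi> \<Longrightarrow> int (length vs) \<noteq> k \<Longrightarrow> \<phi> vs = 0"
  by (simp add: alternating_form_def)

lemma alternating_form_linear:
  assumes "alternating_form k \<phi>"
  shows "linear (\<lambda>v. \<phi> (v # us))"
proof -
  have "linear (\<lambda>v. \<phi> ((0 # us)[0 := v]))"
    using assms unfolding alternating_form_def by blast
  then show ?thesis by simp
qed

lemma alternating_form_Cons:
  assumes "alternating_form k \<phi>"
  shows "alternating_form (k - 1) (\<lambda>us. \<phi> (v # us))"
  unfolding alternating_form_def
proof (intro conjI allI impI)
  fix vs :: "'a list" and i
  assume "i < length vs"
  then have "linear (\<lambda>w. \<phi> ((v # vs)[Suc i := w]))"
    using assms unfolding alternating_form_def by (metis Suc_mono length_Cons)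
  then show "linear (\<lambda>w. \<phi> (v # vs[i := w]))" by simp
next
  fix vs :: "'a list" and i j
  assume "i < j \<and> j < length vs \<and> vs ! i = vs ! j"
  then have "Suc i < Suc j \<and> Suc j < length (v # vs) \<and> (v # vs) ! Suc i = (v # vs) ! Suc j"
    by simp
  then show "\<phi> (v # vs) = 0"
    using assms unfolding alternating_form_def by blast
qed (use assms in \<open>auto simp: alternating_form_def\<close>)

lemma alternating_form_repeat: "alternating_form k \<phi> \<Longrightarrow> \<phi> (v # v # us) = 0"
  unfolding alternating_form_def
  by (elim conjE allE[of _ "v # v # us"] allE[of _ 0] allE[of _ "Suc 0"]) auto

text \<open>Polarisation: expand the value at \<open>u + v\<close> repeated. The hypotheses concern
  the first two slots only, because \<open>alternating_formI\<close> uses this before \<phi> is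
  known to be alternating.\<close>

lemma antisymmetric_if_repeat:
  assumes "\<And>v. \<phi> (v # v # us) = (0::complex)" "\<And>us. linear (\<lambda>v. \<phi> (v # us))"
    "\<And>u. linear (\<lambda>v. \<phi> (u # v # us))"
  shows "\<phi> (u # v # us) = - \<phi> (v # u # us)"
proof -
  have "0 = \<phi> ((u + v) # (u + v) # us)" using assms(1) by simp
  also have "\<dots> = \<phi> (u # u # us) + \<phi> (u # v # us) + (\<phi> (v # u # us) + \<phi> (v # v # us))"
    using linear_add[OF assms(2)] linear_add[OF assms(3)] by simp
  finally show ?thesis using assms(1) by (simp add: eq_neg_iff_add_eq_0)
qed

lemma alternating_form_swap:
  assumes "alternating_form k \<phi>"
  shows "\<phi> (u # v # us) = - \<phi> (v # u # us)"
  by (rule antisymmetric_if_repeat)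
    (auto intro: alternating_form_repeat[OF assms] alternating_form_linear[OF assms]
      alternating_form_linear[OF alternating_form_Cons[OF assms]])

text \<open>An inductive criterion adapted to recursion over argument lists. A repetition of the
  head further down is moved into the tail by exchanging the first two entries, and there
  alternation is already available.\<close>

lemma alternating_formI:
  assumes deg: "\<And>vs. int (length vs) \<noteq> k \<Longrightarrow> \<phi> vs = 0"
    and lin: "\<And>us. linear (\<lambda>v. \<phi> (v # us))"
    and tl: "\<And>v. alternating_form (k - 1) (\<lambda>us. \<phi> (v # us))"
    and rep: "\<And>v us. \<phi> (v # v # us) = 0"
  shows "alternating_form k \<phi>"
proof -
  have mem: "\<phi> (v # us) = 0" if "v \<in> set us" for v us
  proof (cases us)
    case Nil
    then show ?thesis using that by simp
  next
    case (Cons u us')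
    show ?thesis
    proof (cases "u = v")
      case True
      then show ?thesis using Cons rep by simp
    next
      case False
      then have "v \<in> set us'" using that Cons by simp
      then obtain j where j: "j < length us'" "us' ! j = v" by (auto simp: in_set_conv_nth)
      have "0 < Suc j \<and> Suc j < length (v # us') \<and> (v # us') ! 0 = (v # us') ! Suc j"
        using j by simp
      then have "\<phi> (u # v # us') = 0"
        using tl[of u] unfolding alternating_form_def by blast
      moreover have "\<phi> (v # u # us') = - \<phi> (u # v # us')"
        by (rule antisymmetric_if_repeat) (auto intro: rep lin alternating_form_linear[OF tl])
      ultimately show ?thesis using Cons by simp
    qed
  qed
  show ?thesis
    unfolding alternating_form_def
  proof (intro conjI allI impI)
    fix vs :: "'a list" and i
    assume i: "i < length vs"
    then obtain v us where vs: "vs = v # us" by (cases vs) auto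
    show "linear (\<lambda>w. \<phi> (vs[i := w]))"
    proof (cases i)
      case 0
      then show ?thesis using lin vs by simp
    next
      case (Suc i')
      then have "linear (\<lambda>w. \<phi> (v # us[i' := w]))"
        using tl[of v] i vs unfolding alternating_form_def by simp
      then show ?thesis using Suc vs by simp
    qed
  next
    fix vs :: "'a list" and i j
    assume ij: "i < j \<and> j < length vs \<and> vs ! i = vs ! j"
    then obtain v us where vs: "vs = v # us" by (cases vs) auto
    from ij obtain j' where j': "j = Suc j'" by (cases j) auto
    show "\<phi> vs = 0"
    proof (cases i)
      case 0
      then show ?thesis using ij vs j' by (auto intro!: mem simp: in_set_conv_nth)
    next
      case (Suc i')
      then have "i' < j' \<and> j' < length us \<and> us ! i' = us ! j'" using ij vs j' by simp
      then show ?thesis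
        using tl[of v] vs unfolding alternating_form_def by blast
    qed
  qed (rule deg)
qed

lemma alternating_form_zero [simp]: "alternating_form k (\<lambda>vs. 0)"
  by (simp add: alternating_form_def linear_zero)

lemma alternating_form_negative: "alternating_form k \<phi> \<Longrightarrow> k < 0 \<Longrightarrow> \<phi> = (\<lambda>vs. 0)"
  by (auto simp: alternating_form_def)

lemma alternating_form_add:
  "alternating_form k \<phi> \<Longrightarrow> alternating_form k \<psi> \<Longrightarrow> alternating_form k (\<lambda>vs. \<phi> vs + \<psi> vs)"
  unfolding alternating_form_def by (fastforce intro: linear_compose_add)

lemma linear_cmult_complex:
  fixes f :: "'a::real_vector \<Rightarrow> complex"
  shows "linear f \<Longrightarrow> linear (\<lambda>v. z * f v)"
  by (simp add: linear_iff algebra_simps)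

lemma alternating_form_cmult:
  "alternating_form k \<phi> \<Longrightarrow> alternating_form k (\<lambda>vs. z * \<phi> vs)"
  unfolding alternating_form_def by (auto intro: linear_cmult_complex)

lemma alternating_form_diff:
  assumes "alternating_form k \<phi>" "alternating_form k \<psi>"
  shows "alternating_form k (\<lambda>vs. \<phi> vs - \<psi> vs)"
  using alternating_form_add[OF assms(1) alternating_form_cmult[OF assms(2), of "-1"]] by simp

lemma alternating_form_map:
  assumes "alternating_form k \<phi>" "linear M"
  shows "alternating_form k (\<lambda>vs. \<phi> (map M vs))"
  unfolding alternating_form_def
proof (intro conjI allI impI)
  fix vs :: "'b list" and i
  assume "i < length vs"
  then have "linear (\<lambda>w. \<phi> ((map M vs)[i := w]))"
    using assms(1) unfolding alternating_form_def by simp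
  then have "linear ((\<lambda>w. \<phi> ((map M vs)[i := w])) \<circ> M)"
    using assms(2) linear_compose by blast
  then show "linear (\<lambda>w. \<phi> (map M (vs[i := w])))" by (simp add: o_def map_update)
next
  fix vs :: "'b list" and i j
  assume "i < j \<and> j < length vs \<and> vs ! i = vs ! j"
  then have "i < j \<and> j < length (map M vs) \<and> map M vs ! i = map M vs ! j" by simp
  then show "\<phi> (map M vs) = 0"
    using assms(1) unfolding alternating_form_def by blast
qed (use assms(1) in \<open>auto simp: alternating_form_def\<close>)

text \<open>Trades a varying argument for fixed basis vectors with varying scalar coefficients, to
  which the ordinary product rule applies.\<close>

lemma linear_Basis_sum:
  fixes v :: "'e::euclidean_space"
  shows "linear f \<Longrightarrow> (\<Sum>b\<in>Basis. (v \<bullet> b) *\<^sub>R f b) = f v"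
  by (metis (no_types, lifting) euclidean_representation linear_scale linear_sum sum.cong)

subsection \<open>Alternating sums\<close>

text \<open>\<open>altsum F [v\<^sub>0, \<dots>, v\<^sub>k] = \<Sum>\<^sub>i (-1)\<^sup>i F v\<^sub>i [v\<^sub>0, \<dots>, v\<^sub>i omitted, \<dots>, v\<^sub>k]\<close>. The recursive form
  replaces all index computations by inductions.\<close>

fun altsum :: "('v \<Rightarrow> 'v list \<Rightarrow> complex) \<Rightarrow> 'v list \<Rightarrow> complex" where
  "altsum F [] = 0"
| "altsum F (v # vs) = F v vs - altsum (\<lambda>w ws. F w (v # ws)) vs"

lemma altsum_eq_sum:
  "altsum F vs = (\<Sum>i<length vs. (-1) ^ i * F (vs ! i) (take i vs @ drop (Suc i) vs))"
proof (induction vs arbitrary: F)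
  case (Cons v vs)
  show ?case by (simp add: Cons.IH sum.lessThan_Suc_shift sum_negf del: sum.lessThan_Suc)
qed simp

lemma altsum_add: "altsum (\<lambda>w ws. F w ws + G w ws) vs = altsum F vs + altsum G vs"
  by (induction vs arbitrary: F G) auto

lemma altsum_cmult: "altsum (\<lambda>w ws. z * F w ws) vs = z * altsum F vs"
  by (induction vs arbitrary: F) (auto simp: algebra_simps)

lemma altsum_minus: "altsum (\<lambda>w ws. - F w ws) vs = - altsum F vs"
  using altsum_cmult[of "-1" F vs] by simp

lemma altsum_diff: "altsum (\<lambda>w ws. F w ws - G w ws) vs = altsum F vs - altsum G vs"
  using altsum_add[of F "\<lambda>w ws. - G w ws" vs] by (simp add: altsum_minus)

lemma altsum_zero [simp]: "altsum (\<lambda>w ws. 0) vs = 0"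
  using altsum_cmult[of 0] by simp

lemma altsum_map: "altsum F (map M vs) = altsum (\<lambda>w ws. F (M w) (map M ws)) vs"
  by (induction vs arbitrary: F) auto

lemma altsum_degree:
  "(\<And>v us. int (length us) \<noteq> k \<Longrightarrow> F v us = 0) \<Longrightarrow> int (length vs) \<noteq> k + 1 \<Longrightarrow> altsum F vs = 0"
proof (induction vs arbitrary: F k)
  case (Cons v vs)
  then have "altsum (\<lambda>w ws. F w (v # ws)) vs = 0"
    by (intro Cons.IH[of "k - 1"]) auto
  then show ?case using Cons.prems by simp
qed simp

lemma linear_altsum:
  "(\<And>w ws. linear (\<lambda>v. G v w ws)) \<Longrightarrow> linear (\<lambda>v. altsum (G v) vs)"
proof (induction vs arbitrary: G)
  case Nil
  then show ?case by (simp add: linear_zero)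
next
  case (Cons u vs)
  then show ?case by (auto intro!: linear_compose_sub)
qed

text \<open>Each unordered pair of positions is taken out in two orders, with opposite signs. This
  one cancellation gives the chart independence of the exterior derivative, \<open>d d = 0\<close>,
  and the anticommutation of \<open>d\<close> and \<open>dc\<close> in the integrable case.\<close>

lemma altsum_twice:
  "(\<And>u v us. G u v us = G v u us) \<Longrightarrow> altsum (\<lambda>u us. altsum (G u) us) vs = 0"
proof (induction vs arbitrary: G)
  case (Cons v vs)
  have "altsum (\<lambda>w ws. altsum (\<lambda>z zs. G w z (v # zs)) ws) vs = 0"
    by (rule Cons.IH) (rule Cons.prems)
  \<comment> \<open>These are the sums in which the head is taken out second or first; symmetry of
    \<open>G\<close> makes them cancel.\<close>
  moreover have "altsum (\<lambda>w. G w v) vs = altsum (G v) vs"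
    by (rule arg_cong[where f = "\<lambda>F. altsum F vs"], intro ext, rule Cons.prems)
  ultimately show ?case by (simp add: altsum_diff)
qed simp

text \<open>Induction on the degree: fixing the head \<open>v\<close> leaves \<open>F v\<close>
  minus an alternating sum of the contracted family, whose degree is one lower; for a doubled head
  the two leading terms cancel. Negative degrees are split off because the induction runs over
  natural numbers.\<close>

lemma alternating_form_altsum:
  assumes "\<And>v. alternating_form k (F v)" "\<And>us. linear (\<lambda>v. F v us)"
  shows "alternating_form (k + 1) (altsum F)"
proof (cases "k < 0")
  case True
  then have "F = (\<lambda>w ws. 0)"
    using alternating_form_negative[OF assms(1)] by auto
  then have "altsum F = (\<lambda>vs. 0)" by (simp add: ext)
  then show ?thesis by simp
next
  case False
  have *: "alternating_form (int n) (altsum F)"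
    if "\<And>v. alternating_form (int n - 1) (F v)" "\<And>us. linear (\<lambda>v. F v us)" for n F
    using that
  proof (induction n arbitrary: F)
    case 0
    then have "F = (\<lambda>w ws. 0)"
      using alternating_form_negative[OF 0(1)] by auto
    then have "altsum F = (\<lambda>vs. 0)" by (simp add: ext)
    then show ?case by simp
  next
    case (Suc n)
    have F: "alternating_form (int n) (F v)" for v
      using Suc.prems(1)[of v] by simp
    show ?case
    proof (rule alternating_formI)
      show "altsum F vs = 0" if "int (length vs) \<noteq> int (Suc n)" for vs
        by (rule altsum_degree[of "int n"]) (use that alternating_form_degree[OF F] in auto)
      have "linear (\<lambda>v. altsum (\<lambda>w ws. F w (v # ws)) us)" for us
        by (rule linear_altsum) (rule alternating_form_linear[OF F])
      then show "linear (\<lambda>v. altsum F (v # us))" for us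
        by (auto intro!: linear_compose_sub Suc.prems)
      have "alternating_form (int n) (altsum (\<lambda>w ws. F w (v # ws)))" for v
        by (rule Suc.IH) (auto intro: alternating_form_Cons[OF F] Suc.prems)
      then show "alternating_form (int (Suc n) - 1) (\<lambda>us. altsum F (v # us))" for v
        using F by (simp add: alternating_form_diff)
      show "altsum F (v # v # us) = 0" for v us
        using alternating_form_repeat[OF F] by simp
    qed
  qed
  have "int (nat (k + 1)) = k + 1" using False by simp
  then show ?thesis using *[of "nat (k + 1)" F] assms by (metis add_diff_cancel_right')
qed

subsection \<open>Pulling back along a varying linear map\<close>

text \<open>Leibniz rule for a form whose coefficients and arguments both vary. Alternation allows
  the differentiated argument to be moved to the front, and the resulting signs turn the argument
  terms into an \<open>altsum\<close>.\<close>

lemma has_derivative_alternating_map: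
  fixes \<phi> :: "'d::real_normed_vector \<Rightarrow> 'e::euclidean_space list \<Rightarrow> complex"
  assumes "open S" "x \<in> S"
    and "\<And>y. y \<in> S \<Longrightarrow> alternating_form k (\<phi> y)"
    and "\<And>us. ((\<lambda>y. \<phi> y us) has_derivative \<phi>' us) (at x)"
    and M: "\<And>w. ((\<lambda>y. M y w) has_derivative M' w) (at x)"
  shows "((\<lambda>y. \<phi> y (map (M y) ws)) has_derivative
    (\<lambda>h. \<phi>' (map (M x) ws) h + altsum (\<lambda>u us. \<phi> x (M' u h # map (M x) us)) ws)) (at x)"
  using assms(3,4)
proof (induction ws arbitrary: \<phi> \<phi>' k)
  case Nil
  then show ?case by simp
next
  case (Cons w ws)
  let ?L = "map (M x) ws"
  note lin = alternating_form_linear[OF Cons.prems(1)]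
  \<comment> \<open>Linearity of \<open>\<phi>'\<close> in the first slot is inherited from \<phi>
    by uniqueness of derivatives.\<close>
  have \<phi>'_lin: "\<phi>' (v # us) h = (\<Sum>b\<in>Basis. (v \<bullet> b) *\<^sub>R \<phi>' (b # us) h)" for v us h
  proof -
    have "((\<lambda>y. \<Sum>b\<in>Basis. (v \<bullet> b) *\<^sub>R \<phi> y (b # us)) has_derivative
        (\<lambda>h. \<Sum>b\<in>Basis. (v \<bullet> b) *\<^sub>R \<phi>' (b # us) h)) (at x)"
      by (intro has_derivative_sum has_derivative_scaleR_right Cons.prems)
    then have "((\<lambda>y. \<phi> y (v # us)) has_derivative
        (\<lambda>h. \<Sum>b\<in>Basis. (v \<bullet> b) *\<^sub>R \<phi>' (b # us) h)) (at x)"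
      by (rule has_derivative_transform_within_open[OF _ assms(1,2)])
         (simp add: linear_Basis_sum[OF lin])
    from has_derivative_unique[OF Cons.prems(2) this] show ?thesis by (rule fun_cong)
  qed
  have IH: "((\<lambda>y. \<phi> y (b # map (M y) ws)) has_derivative
      (\<lambda>h. \<phi>' (b # ?L) h + altsum (\<lambda>u us. \<phi> x (b # M' u h # map (M x) us)) ws)) (at x)" for b
    by (rule Cons.IH) (auto intro!: alternating_form_Cons[OF Cons.prems(1)] Cons.prems(2))
  have "((\<lambda>y. \<Sum>b\<in>Basis. (M y w \<bullet> b) *\<^sub>R \<phi> y (b # map (M y) ws)) has_derivative
      (\<lambda>h. \<Sum>b\<in>Basis. (M x w \<bullet> b) *\<^sub>R
          (\<phi>' (b # ?L) h + altsum (\<lambda>u us. \<phi> x (b # M' u h # map (M x) us)) ws) +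
        (M' w h \<bullet> b) *\<^sub>R \<phi> x (b # ?L))) (at x)"
    by (intro has_derivative_sum has_derivative_scaleR IH has_derivative_inner_left M)
  then have "((\<lambda>y. \<phi> y (map (M y) (w # ws))) has_derivative
      (\<lambda>h. \<Sum>b\<in>Basis. (M x w \<bullet> b) *\<^sub>R
          (\<phi>' (b # ?L) h + altsum (\<lambda>u us. \<phi> x (b # M' u h # map (M x) us)) ws) +
        (M' w h \<bullet> b) *\<^sub>R \<phi> x (b # ?L))) (at x)"
    by (rule has_derivative_transform_within_open[OF _ assms(1,2)])
       (simp add: linear_Basis_sum[OF lin])
  moreover have "(\<Sum>b\<in>Basis. (M x w \<bullet> b) *\<^sub>R
          (\<phi>' (b # ?L) h + altsum (\<lambda>u us. \<phi> x (b # M' u h # map (M x) us)) ws) +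
        (M' w h \<bullet> b) *\<^sub>R \<phi> x (b # ?L)) =
      \<phi>' (map (M x) (w # ws)) h + altsum (\<lambda>u us. \<phi> x (M' u h # map (M x) us)) (w # ws)" for h
  proof -
    have "linear (\<lambda>v. altsum (\<lambda>u us. \<phi> x (v # M' u h # map (M x) us)) ws)"
      by (rule linear_altsum) (rule lin[OF assms(2)])
    then have "(\<Sum>b\<in>Basis. (M x w \<bullet> b) *\<^sub>R altsum (\<lambda>u us. \<phi> x (b # M' u h # map (M x) us)) ws) =
        altsum (\<lambda>u us. \<phi> x (M x w # M' u h # map (M x) us)) ws"
      by (rule linear_Basis_sum)
    \<comment> \<open>Exchanging the first two arguments produces the sign in the recursive clause
      of \<open>altsum\<close>.\<close>
    also have "\<dots> = - altsum (\<lambda>u us. \<phi> x (M' u h # M x w # map (M x) us)) ws"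
      by (subst alternating_form_swap[OF Cons.prems(1)[OF assms(2)]]) (rule altsum_minus)
    finally show ?thesis
      by (simp add: scaleR_add_right sum.distrib linear_Basis_sum[OF lin[OF assms(2)]]
          \<phi>'_lin[of "M x w"])
  qed
  ultimately show ?case by simp
qed

lemma smooth_on_alternating_map:
  fixes \<phi> :: "'d::euclidean_space \<Rightarrow> 'e::euclidean_space list \<Rightarrow> complex"
  assumes "open S" "\<And>w. smooth_on S (\<lambda>y. M y w)"
    and "\<And>y. y \<in> S \<Longrightarrow> alternating_form k (\<phi> y)" "\<And>us. smooth_on S (\<lambda>y. \<phi> y us)"
  shows "smooth_on S (\<lambda>y. \<phi> y (map (M y) ws))"
  using assms(3,4)
proof (induction ws arbitrary: \<phi> k)
  case Nil
  then show ?case by simp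
next
  case (Cons w ws)
  note lin = alternating_form_linear[OF Cons.prems(1)]
  have IH: "smooth_on S (\<lambda>y. \<phi> y (b # map (M y) ws))" for b
    by (rule Cons.IH) (auto intro!: alternating_form_Cons[OF Cons.prems(1)] Cons.prems(2))
  have "smooth_on S (\<lambda>y. \<Sum>b\<in>Basis. (M y w \<bullet> b) *\<^sub>R \<phi> y (b # map (M y) ws))"
    using assms(1,2) IH by (intro smooth_on_sum smooth_on_scaleR smooth_on_inner)
  then show ?case
    by (rule smooth_on_cong[OF assms(1)]) (simp add: linear_Basis_sum[OF lin])
qed

subsection \<open>Complex-multilinear extension\<close>

lemma cext_add: "cext (\<lambda>vs. \<phi> vs + \<psi> vs) zs = cext \<phi> zs + cext \<psi> zs"
  by (induction zs arbitrary: \<phi> \<psi>) (auto simp: algebra_simps)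

lemma cext_cmult: "cext (\<lambda>vs. a * \<phi> vs) zs = a * cext \<phi> zs"
  by (induction zs arbitrary: \<phi>) (auto simp: algebra_simps)

lemma cext_zero [simp]: "cext (\<lambda>vs. 0) zs = 0"
  using cext_cmult[of 0] by simp

lemma cext_minus: "cext (\<lambda>vs. - \<phi> vs) zs = - cext \<phi> zs"
  using cext_cmult[of "-1"] by simp

lemma cext_sum: "cext (\<lambda>vs. \<Sum>i\<in>I. \<phi> i vs) zs = (\<Sum>i\<in>I. cext (\<phi> i) zs)"
  by (induction I rule: infinite_finite_induct) (auto simp: cext_add)

lemma cext_map: "cext (\<lambda>vs. \<phi> (map R vs)) zs = cext \<phi> (map (map_prod R R) zs)"
proof (induction zs arbitrary: \<phi>)
  case (Cons z zs)
  show ?case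
    using Cons.IH[of "\<lambda>vs. \<phi> (R (fst z) # vs)"] Cons.IH[of "\<lambda>vs. \<phi> (R (snd z) # vs)"] by simp
qed simp

lemma cext_linear:
  assumes "alternating_form k \<phi>"
  shows "linear (\<lambda>v. cext (\<lambda>vs. \<phi> (v # vs)) zs)"
proof -
  have 1: "\<phi> ((u + v) # vs) = \<phi> (u # vs) + \<phi> (v # vs)" for u v vs
    using linear_add[OF alternating_form_linear[OF assms]] .
  have 2: "\<phi> ((r *\<^sub>R v) # vs) = complex_of_real r * \<phi> (v # vs)" for r v vs
    using linear_scale[OF alternating_form_linear[OF assms]] by (simp add: scaleR_conv_of_real)
  show ?thesis
    by (simp add: linear_iff 1 2 cext_add cext_cmult scaleR_conv_of_real)
qed

lemma cext_swap:
  assumes "alternating_form k \<phi>"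
  shows "cext \<phi> (as @ z # w # bs) = - cext \<phi> (as @ w # z # bs)"
  using assms
proof (induction as arbitrary: \<phi> k)
  case Nil
  have "cext (\<lambda>vs. \<phi> (a # b # vs)) bs = - cext (\<lambda>vs. \<phi> (b # a # vs)) bs" for a b
    by (subst alternating_form_swap[OF Nil]) (rule cext_minus)
  from this[of "fst z" "fst w"] this[of "fst z" "snd w"] this[of "snd z" "fst w"]
    this[of "snd z" "snd w"]
  show ?case by (simp add: algebra_simps)
next
  case (Cons a as)
  show ?case
    using Cons.IH[OF alternating_form_Cons[OF Cons.prems]] by simp
qed

text \<open>One sign per exchange. It serves to bring vectors of type (1,0) in front of those of
  type (0,1), the order in which \<open>forms_pq\<close> tests forms.\<close>

lemma cext_move:
  assumes "alternating_form k \<phi>"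
  shows "cext \<phi> (zs @ ws @ m # ms) = (-1) ^ length ws * cext \<phi> (zs @ m # ws @ ms)"
proof (induction ws arbitrary: zs)
  case (Cons w ws)
  show ?case
    using Cons.IH[of "zs @ [w]"] cext_swap[OF assms, of zs w m "ws @ ms"] by simp
qed simp

lemma cext_real:
  assumes "alternating_form k \<phi>"
  shows "cext \<phi> (map (\<lambda>v. (v, 0)) vs) = \<phi> vs"
  using assms
proof (induction vs arbitrary: \<phi> k)
  case (Cons v vs)
  show ?case
    using Cons.IH[OF alternating_form_Cons[OF Cons.prems]] linear_0[OF cext_linear[OF Cons.prems]]
    by simp
qed simp

text \<open>Complex linearity applied to \<open>2u = (u + iv) + (u - iv)\<close>. With
  \<open>v = j u\<close> it splits a real vector into its parts of type (0,1) and (1,0).\<close>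

lemma cext_half_sum:
  assumes "alternating_form k \<phi>"
  shows "2 * cext \<phi> (as @ (u, 0) # bs) = cext \<phi> (as @ (u, v) # bs) + cext \<phi> (as @ (u, - v) # bs)"
  using assms
proof (induction as arbitrary: \<phi> k)
  case Nil
  show ?case
    using linear_0[OF cext_linear[OF Nil]] linear_neg[OF cext_linear[OF Nil]] by simp
next
  case (Cons a as)
  from Cons.IH[OF alternating_form_Cons[OF Cons.prems], of "fst a"]
    Cons.IH[OF alternating_form_Cons[OF Cons.prems], of "snd a"]
  show ?case by (simp add: algebra_simps)
qed

text \<open>A real vector \<open>v\<close> is half the sum of \<open>(v, j v)\<close> of type (0,1)
  and \<open>(v, - j v)\<close> of type (1,0), so values on real vectors are combinations of values
  on tuples of pure type, and these can be sorted up to sign.\<close>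

lemma alternating_form_eq_0_if_cext:
  fixes \<phi> :: "'e::real_vector list \<Rightarrow> complex"
  assumes \<phi>: "alternating_form k \<phi>" and j: "linear j" "\<And>v. j (j v) = - v"
    and zero: "\<And>zs ws. set zs \<subseteq> T10 j \<Longrightarrow> set ws \<subseteq> T01 j \<Longrightarrow> cext \<phi> (zs @ ws) = 0"
  shows "\<phi> vs = 0"
proof -
  have 1: "cext \<phi> (zs @ ws @ ms) = 0"
    if "set zs \<subseteq> T10 j" "set ws \<subseteq> T01 j" "set ms \<subseteq> T10 j \<union> T01 j" for zs ws ms
    using that
  proof (induction ms arbitrary: zs ws)
    case Nil
    then show ?case using zero by simp
  next
    case (Cons m ms)
    show ?case
    proof (cases "m \<in> T01 j")
      case True
      then show ?thesis using Cons.IH[of zs "ws @ [m]"] Cons.prems by simp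
    next
      case False
      then show ?thesis
        using Cons.IH[of "zs @ [m]" ws] Cons.prems cext_move[OF \<phi>, of zs ws m ms] by simp
    qed
  qed
  \<comment> \<open>Real arguments are replaced one at a time; \<open>ms\<close> collects the
    vectors of pure type chosen so far.\<close>
  have "cext \<phi> (ms @ map (\<lambda>v. (v, 0)) vs) = 0" if "set ms \<subseteq> T10 j \<union> T01 j" for ms
    using that
  proof (induction vs arbitrary: ms)
    case Nil
    then show ?case using 1[of "[]" "[]" ms] by simp
  next
    case (Cons v vs)
    have "cext \<phi> ((ms @ [(v, j v)]) @ map (\<lambda>v. (v, 0)) vs) = 0"
      by (rule Cons.IH) (use Cons.prems j in \<open>auto simp: T01_def\<close>)
    moreover have "cext \<phi> ((ms @ [(v, - j v)]) @ map (\<lambda>v. (v, 0)) vs) = 0"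
      by (rule Cons.IH) (use Cons.prems j in \<open>auto simp: T10_def linear_neg\<close>)
    ultimately show ?case
      using cext_half_sum[OF \<phi>, of ms v "map (\<lambda>v. (v, 0)) vs" "j v"] by simp
  qed
  from this[of "[]"] show ?thesis using cext_real[OF \<phi>] by simp
qed

text \<open>The rotation by the angle \<open>t\<close> acts on the eigenspaces by \<open>e\<^sup>i\<^sup>t\<close> and \<open>e\<^sup>-\<^sup>i\<^sup>t\<close>.\<close>

definition rot :: "('e::real_vector \<Rightarrow> 'e) \<Rightarrow> real \<Rightarrow> 'e \<Rightarrow> 'e" where
  "rot j t v = cos t *\<^sub>R v + sin t *\<^sub>R j v"

lemma linear_rot: "linear j \<Longrightarrow> linear (rot j t)"
  unfolding rot_def by (intro linear_compose_add linear_compose_scale_right linear_ident)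

text \<open>The two components are the real and imaginary parts of \<open>cis t\<close> times
  \<open>u + iv\<close>, so this is complex linearity of the extension in the first slot.\<close>

lemma cext_head_cis:
  assumes "alternating_form k \<phi>"
  shows "cext \<phi> ((cos t *\<^sub>R u - sin t *\<^sub>R v, cos t *\<^sub>R v + sin t *\<^sub>R u) # zs) =
    cis t * cext \<phi> ((u, v) # zs)"
proof -
  let ?f = "\<lambda>v. cext (\<lambda>vs. \<phi> (v # vs)) zs"
  note l = cext_linear[OF assms, of zs]
  have "?f (cos t *\<^sub>R u - sin t *\<^sub>R v) = cos t *\<^sub>R ?f u - sin t *\<^sub>R ?f v"
    using linear_diff[OF l] linear_scale[OF l] by simp
  moreover have "?f (cos t *\<^sub>R v + sin t *\<^sub>R u) = cos t *\<^sub>R ?f v + sin t *\<^sub>R ?f u"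
    using linear_add[OF l] linear_scale[OF l] by simp
  ultimately show ?thesis
    by (simp add: complex_eq_iff algebra_simps)
qed

lemma cext_rot_T10:
  assumes "alternating_form k \<phi>" "z \<in> T10 j"
  shows "cext \<phi> (map_prod (rot j t) (rot j t) z # zs) = cis t * cext \<phi> (z # zs)"
proof -
  obtain u v where z: "z = (u, v)" by (cases z)
  then have "j u = - v" "j v = u" using assms(2) by (auto simp: T10_def)
  then show ?thesis
    using cext_head_cis[OF assms(1), of t u v] by (simp only: z rot_def map_prod_simp) simp
qed

lemma cext_rot_T01:
  assumes "alternating_form k \<phi>" "z \<in> T01 j"
  shows "cext \<phi> (map_prod (rot j t) (rot j t) z # zs) = cis (- t) * cext \<phi> (z # zs)"
proof -
  obtain u v where z: "z = (u, v)" by (cases z)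
  then have "j u = v" "j v = - u" using assms(2) by (auto simp: T01_def)
  then show ?thesis
    using cext_head_cis[OF assms(1), of "- t" u v] by (simp only: z rot_def map_prod_simp) simp
qed

lemma cext_rot:
  assumes "alternating_form k \<phi>" "set zs \<subseteq> T10 j" "set ws \<subseteq> T01 j"
  shows "cext (\<lambda>vs. \<phi> (map (rot j t) vs)) (zs @ ws) =
    cis (t * (real (length zs) - real (length ws))) * cext \<phi> (zs @ ws)"
proof -
  have 1: "cext \<phi> (map (map_prod (rot j t) (rot j t)) ws) = cis (- t * length ws) * cext \<phi> ws"
    if "alternating_form k \<phi>" for k \<phi>
    using assms(3) that
  proof (induction ws arbitrary: \<phi> k)
    case (Cons w ws)
    have "cext \<phi> (map (map_prod (rot j t) (rot j t)) (w # ws)) =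
        cis (- t) * cext \<phi> (w # map (map_prod (rot j t) (rot j t)) ws)"
      using cext_rot_T01[OF Cons.prems(2)] Cons.prems(1) by simp
    also have "\<dots> = cis (- t) * (cis (- t * length ws) * cext \<phi> (w # ws))"
      using Cons.prems(1) Cons.IH[OF _ alternating_form_Cons[OF Cons.prems(2)]]
      by (simp add: algebra_simps)
    also have "\<dots> = cis (- t * length (w # ws)) * cext \<phi> (w # ws)"
      by (simp only: mult.assoc[symmetric] cis_mult) (simp add: algebra_simps)
    finally show ?case .
  qed simp
  have "cext \<phi> (map (map_prod (rot j t) (rot j t)) (zs @ ws)) =
      cis (t * (real (length zs) - real (length ws))) * cext \<phi> (zs @ ws)"
    using assms(2,1)
  proof (induction zs arbitrary: \<phi> k)
    case Nil
    then show ?case using 1 by simp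
  next
    case (Cons w zs)
    have "cext \<phi> (map (map_prod (rot j t) (rot j t)) ((w # zs) @ ws)) =
        cis t * cext \<phi> (w # map (map_prod (rot j t) (rot j t)) (zs @ ws))"
      using cext_rot_T10[OF Cons.prems(2)] Cons.prems(1) by simp
    also have "\<dots> = cis t * (cis (t * (real (length zs) - real (length ws))) * cext \<phi> (w # zs @ ws))"
      using Cons.prems(1) Cons.IH[OF _ alternating_form_Cons[OF Cons.prems(2)]]
      by (simp add: algebra_simps)
    also have "\<dots> = cis (t * (real (length (w # zs)) - real (length ws))) * cext \<phi> ((w # zs) @ ws)"
      by (simp only: mult.assoc[symmetric] cis_mult) (simp add: algebra_simps)
    finally show ?case .
  qed
  then show ?thesis by (simp add: cext_map)
qed

section \<open>Quotient modules\<close>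

lemma cring_complex_ring: "cring complex_ring"
proof (rule cringI)
  show "abelian_group complex_ring"
    by (rule abelian_groupI)
       (auto simp: complex_ring_def algebra_simps intro!: exI[of _ "- x" for x])
  show "comm_monoid complex_ring"
    by (rule comm_monoidI) (auto simp: complex_ring_def)
qed (auto simp: complex_ring_def algebra_simps)

lemma complex_ring_simps [simp]:
  "carrier complex_ring = UNIV" "a \<oplus>\<^bsub>complex_ring\<^esub> b = a + b" "a \<otimes>\<^bsub>complex_ring\<^esub> b = a * b"
  "\<zero>\<^bsub>complex_ring\<^esub> = 0" "\<one>\<^bsub>complex_ring\<^esub> = 1"
  by (auto simp: complex_ring_def)

lemma (in module) submoduleI':
  assumes "H \<subseteq> carrier M" "\<zero>\<^bsub>M\<^esub> \<in> H"
    and add: "\<And>a b. a \<in> H \<Longrightarrow> b \<in> H \<Longrightarrow> a \<oplus>\<^bsub>M\<^esub> b \<in> H"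
    and smult: "\<And>a x. a \<in> carrier R \<Longrightarrow> x \<in> H \<Longrightarrow> a \<odot>\<^bsub>M\<^esub> x \<in> H"
  shows "submodule H R M"
proof (rule submoduleI)
  fix a assume a: "a \<in> H"
  then have "\<ominus>\<^bsub>M\<^esub> a = (\<ominus> \<one>) \<odot>\<^bsub>M\<^esub> a"
    using assms(1) smult_l_minus[of \<one> a] by auto
  then show "\<ominus>\<^bsub>M\<^esub> a \<in> H" using smult a by simp
qed (use assms in auto)

lemma mem_a_r_coset_iff: "v \<in> N +>\<^bsub>G\<^esub> x \<longleftrightarrow> (\<exists>n\<in>N. v = n \<oplus>\<^bsub>G\<^esub> x)"
  by (auto simp: a_r_coset_def')

text \<open>The cohomologies are quotients of such pairs of numerator and denominator; the locale
  collects the coset arithmetic of the record \<open>quot_module\<close>.\<close>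

locale module_pair = module R V
  for R :: "('r, 's) ring_scheme" and V :: "('r, 'm) module" (structure) +
  fixes N
  assumes submodule: "submodule N R V"
begin

lemma abelian_subgroup: "abelian_subgroup N V"
  using submodule by (intro abelian_subgroupI3 additive_subgroupI)
    (auto simp: submodule_def intro: M.abelian_group_axioms)

sublocale abelian_subgroup N V by (rule abelian_subgroup)

lemma smult_mem: "a \<in> carrier R \<Longrightarrow> x \<in> N \<Longrightarrow> a \<odot> x \<in> N"
  using submodule by (rule submodule.smult_closed)

lemma carrier_quot: "carrier (quot_module V N) = (\<lambda>x. N +> x) ` carrier V"
  by (auto simp: quot_module_def A_RCOSETS_def' a_r_coset_def')

lemma coset_in_quot: "x \<in> carrier V \<Longrightarrow> N +> x \<in> carrier (quot_module V N)"
  by (simp add: carrier_quot)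

lemma quot_zero: "\<zero>\<^bsub>quot_module V N\<^esub> = N"
  by (simp add: quot_module_def)

lemma quot_add:
  "x \<in> carrier V \<Longrightarrow> y \<in> carrier V \<Longrightarrow> (N +> x) \<oplus>\<^bsub>quot_module V N\<^esub> (N +> y) = N +> (x \<oplus> y)"
  by (simp add: quot_module_def a_rcos_sum)

lemma coset_absorb:
  assumes "n \<in> N" "x \<in> carrier V" shows "N +> (n \<oplus> x) = N +> x"
proof -
  have "n \<oplus> x \<in> N +> x" using assms unfolding mem_a_r_coset_iff by blast
  then show ?thesis using a_repr_independence[OF _ assms(2) a_subgroup] by simp
qed

lemma coset_eq_iff:
  assumes "x \<in> carrier V" "y \<in> carrier V"
  shows "N +> x = N +> y \<longleftrightarrow> (\<exists>n\<in>N. x = n \<oplus> y)"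
proof
  assume "N +> x = N +> y"
  then have "x \<in> N +> y" using a_rcos_self[OF assms(1)] by simp
  then show "\<exists>n\<in>N. x = n \<oplus> y" unfolding mem_a_r_coset_iff .
next
  assume "\<exists>n\<in>N. x = n \<oplus> y"
  then obtain n where n: "n \<in> N" "x = n \<oplus> y" ..
  show "N +> x = N +> y" unfolding n(2) by (rule coset_absorb[OF n(1) assms(2)])
qed

text \<open>The scalar multiplication of \<open>quot_module\<close> is a union over all
  representatives. Their multiples differ by elements of \<open>N\<close>, so the family is
  constant.\<close>

lemma quot_smult:
  assumes "a \<in> carrier R" "x \<in> carrier V"
  shows "a \<odot>\<^bsub>quot_module V N\<^esub> (N +> x) = N +> (a \<odot> x)"
proof -
  have "N +> (a \<odot> v) = N +> (a \<odot> x)" if v: "v \<in> N +> x" for v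
  proof -
    obtain n where n: "n \<in> N" "v = n \<oplus> x" using v unfolding mem_a_r_coset_iff by blast
    have "a \<odot> v = (a \<odot> n) \<oplus> (a \<odot> x)"
      unfolding n(2) by (rule smult_r_distr[OF assms(1) subsetD[OF a_subset n(1)] assms(2)])
    then show ?thesis using coset_absorb[OF smult_mem[OF assms(1) n(1)]] assms by simp
  qed
  moreover have "N +> x \<noteq> {}" using a_rcos_self[OF assms(2)] by blast
  ultimately show ?thesis by (simp add: quot_module_def SUP_eq_const)
qed

lemma module_quot: "Module.module R (quot_module V N)"
proof (rule moduleI)
  show "cring R" by (rule R.cring_axioms)
  show "abelian_group (quot_module V N)"
  proof (rule abelian_groupI)
    have zero: "\<zero>\<^bsub>quot_module V N\<^esub> = N +> \<zero>"
      using a_coset_join2[OF _ a_subgroup] by (simp add: quot_zero)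
    then show "\<zero>\<^bsub>quot_module V N\<^esub> \<in> carrier (quot_module V N)"
      by (simp add: coset_in_quot)
    fix X assume "X \<in> carrier (quot_module V N)"
    then obtain x where x: "x \<in> carrier V" "X = N +> x" by (auto simp: carrier_quot)
    show "\<zero>\<^bsub>quot_module V N\<^esub> \<oplus>\<^bsub>quot_module V N\<^esub> X = X"
      using x by (simp add: zero quot_add)
    have "(N +> (\<ominus> x)) \<oplus>\<^bsub>quot_module V N\<^esub> X = \<zero>\<^bsub>quot_module V N\<^esub>"
      using x by (simp add: zero quot_add M.l_neg)
    then show "\<exists>Y\<in>carrier (quot_module V N). Y \<oplus>\<^bsub>quot_module V N\<^esub> X = \<zero>\<^bsub>quot_module V N\<^esub>"
      using x coset_in_quot by blast
  qed (auto simp: carrier_quot quot_add M.a_ac)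
qed (auto simp: carrier_quot quot_add quot_smult smult_l_distr smult_r_distr smult_assoc1)

lemma finsum_quot:
  assumes "finite A" "a \<in> A \<rightarrow> carrier V"
  shows "(\<Oplus>\<^bsub>quot_module V N\<^esub>p\<in>A. N +> a p) = N +> (\<Oplus>p\<in>A. a p)"
  using assms
proof (induction A rule: finite_induct)
  case empty
  interpret Q: module R "quot_module V N" by (rule module_quot)
  show ?case using a_coset_join2[OF _ a_subgroup] by (simp add: quot_zero)
next
  case (insert p A)
  interpret Q: module R "quot_module V N" by (rule module_quot)
  have "(\<Oplus>\<^bsub>quot_module V N\<^esub>p\<in>insert p A. N +> a p) =
      (N +> a p) \<oplus>\<^bsub>quot_module V N\<^esub> (\<Oplus>\<^bsub>quot_module V N\<^esub>p\<in>A. N +> a p)"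
    using insert by (intro Q.finsum_insert) (auto intro!: coset_in_quot)
  also have "\<dots> = N +> (\<Oplus>p\<in>insert p A. a p)"
    using insert by (auto simp: quot_add Pi_def)
  finally show ?case .
qed

end

text \<open>A union over representatives avoids choosing one. The operators \<open>d_C\<close> and
  \<open>dc_C\<close> have exactly this shape, and since only the target pair enters, one function
  can serve several source quotients.\<close>

definition quot_map :: "('s, 'w) module \<Rightarrow> 'w set \<Rightarrow> ('v \<Rightarrow> 'w) \<Rightarrow> 'v set \<Rightarrow> 'w set" where
  "quot_map W K f X = (\<Union>v\<in>X. K +>\<^bsub>W\<^esub> f v)"

locale pair_map =
  V: module_pair complex_ring V N + W: module_pair complex_ring W K
  for V :: "(complex, 'v) module" and N and W :: "(complex, 'w) module" and K +
  fixes f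
  assumes f_mem: "v \<in> carrier V \<Longrightarrow> f v \<in> carrier W"
    and f_add: "u \<in> carrier V \<Longrightarrow> v \<in> carrier V \<Longrightarrow> f (u \<oplus>\<^bsub>V\<^esub> v) = f u \<oplus>\<^bsub>W\<^esub> f v"
    and f_smult: "v \<in> carrier V \<Longrightarrow> f (z \<odot>\<^bsub>V\<^esub> v) = z \<odot>\<^bsub>W\<^esub> f v"
    and f_sub: "v \<in> N \<Longrightarrow> f v \<in> K"
begin

lemma quot_map_coset:
  assumes "v \<in> carrier V" shows "quot_map W K f (N +>\<^bsub>V\<^esub> v) = K +>\<^bsub>W\<^esub> f v"
proof -
  have "K +>\<^bsub>W\<^esub> f u = K +>\<^bsub>W\<^esub> f v" if u: "u \<in> N +>\<^bsub>V\<^esub> v" for u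
  proof -
    obtain n where n: "n \<in> N" "u = n \<oplus>\<^bsub>V\<^esub> v" using u unfolding mem_a_r_coset_iff by blast
    have "f u = f n \<oplus>\<^bsub>W\<^esub> f v"
      unfolding n(2) by (rule f_add[OF subsetD[OF V.a_subset n(1)] assms])
    then show ?thesis using W.coset_absorb[OF f_sub[OF n(1)] f_mem[OF assms]] by simp
  qed
  moreover have "N +>\<^bsub>V\<^esub> v \<noteq> {}" using V.a_rcos_self[OF assms] by blast
  ultimately show ?thesis unfolding quot_map_def by (intro SUP_eq_const)
qed

lemma complex_linear_quot_map:
  "complex_linear (quot_module V N) (quot_module W K) (quot_map W K f)"
  unfolding complex_linear_def
  by (auto simp: V.module_quot W.module_quot V.carrier_quot W.carrier_quot quot_map_coset f_mem
      V.quot_add W.quot_add f_add V.quot_smult W.quot_smult f_smult)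

lemma inj_on_quot_map:
  assumes "\<And>v. v \<in> carrier V \<Longrightarrow> f v \<in> K \<Longrightarrow> v \<in> N"
  shows "inj_on (quot_map W K f) (carrier (quot_module V N))"
proof (rule inj_onI)
  fix X Y assume "X \<in> carrier (quot_module V N)" "Y \<in> carrier (quot_module V N)"
    and eq: "quot_map W K f X = quot_map W K f Y"
  then obtain u v where uv: "u \<in> carrier V" "v \<in> carrier V" "X = N +>\<^bsub>V\<^esub> u" "Y = N +>\<^bsub>V\<^esub> v"
    by (auto simp: V.carrier_quot)
  then have "\<exists>n\<in>K. f u = n \<oplus>\<^bsub>W\<^esub> f v"
    using eq by (simp add: quot_map_coset W.coset_eq_iff f_mem)
  then obtain n where n: "n \<in> K" "f u = n \<oplus>\<^bsub>W\<^esub> f v" ..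
  note n_in = subsetD[OF W.a_subset n(1)]
  define w where "w = u \<oplus>\<^bsub>V\<^esub> (\<ominus>\<^bsub>V\<^esub> v)"
  have w: "w \<in> carrier V" "w \<oplus>\<^bsub>V\<^esub> v = u"
    using uv by (auto simp: w_def V.M.a_assoc V.M.l_neg)
  then have "f w \<oplus>\<^bsub>W\<^esub> f v = n \<oplus>\<^bsub>W\<^esub> f v" using f_add[OF w(1) uv(2)] n by simp
  then have "f w = n" using W.M.add.right_cancel[OF f_mem[OF uv(2)] f_mem[OF w(1)] n_in] by simp
  then have "w \<in> N" using assms w n by simp
  then show "X = Y" using uv w V.coset_absorb[of w v] by simp
qed

lemma surj_quot_map:
  assumes "\<And>w. w \<in> carrier W \<Longrightarrow> \<exists>v\<in>carrier V. f v = w"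
  shows "quot_map W K f ` carrier (quot_module V N) = carrier (quot_module W K)"
proof -
  have "f ` carrier V = carrier W" using assms f_mem by blast
  then show ?thesis
    unfolding V.carrier_quot W.carrier_quot image_image
    by (metis (no_types, lifting) image_cong image_image quot_map_coset)
qed

end

lemma module_form_module:
  assumes "0 \<in> Z" "\<And>\<alpha> \<beta>. \<alpha> \<in> Z \<Longrightarrow> \<beta> \<in> Z \<Longrightarrow> \<alpha> + \<beta> \<in> Z"
    and "\<And>z \<alpha>. \<alpha> \<in> Z \<Longrightarrow> (\<lambda>c x vs. z * \<alpha> c x vs) \<in> Z"
  shows "Module.module complex_ring (form_module Z)"
proof (rule moduleI)
  show "cring complex_ring" by (rule cring_complex_ring)
  show "abelian_group (form_module Z)"
  proof (rule abelian_groupI)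
    fix \<alpha> assume "\<alpha> \<in> carrier (form_module Z)"
    then have "(\<lambda>c x vs. (-1) * \<alpha> c x vs) \<in> Z" using assms(3)[of \<alpha> "-1"] by (simp add: form_module_def)
    then show "\<exists>\<beta>\<in>carrier (form_module Z). \<beta> \<oplus>\<^bsub>form_module Z\<^esub> \<alpha> = \<zero>\<^bsub>form_module Z\<^esub>"
      by (auto simp: form_module_def fun_eq_iff intro!: bexI)
  qed (auto simp: form_module_def assms add.assoc add.commute)
qed (auto simp: form_module_def assms fun_eq_iff algebra_simps)

section \<open>Differential forms on a manifold\<close>

text \<open>The scalar multiplication of \<open>form_module\<close> as a named function, which makes
  the theory of subspaces of a \<open>vector_space\<close> available for sets of forms.\<close>

definition fscale :: "complex \<Rightarrow> ('a, 'e) form \<Rightarrow> ('a, 'e) form" where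
  "fscale z \<alpha> = (\<lambda>c x vs. z * \<alpha> c x vs)"

lemma fscale_apply [simp]: "fscale z \<alpha> c x vs = z * \<alpha> c x vs"
  by (simp add: fscale_def)

interpretation fscale: vector_space fscale
  by unfold_locales (auto simp: fun_eq_iff algebra_simps)

lemma sum_form_apply: "(\<Sum>i\<in>I. f i) c x vs = (\<Sum>i\<in>I. f i c x vs)"
  for f :: "'i \<Rightarrow> ('a, 'e) form"
  by (induction I rule: infinite_finite_induct) auto

section \<open>Differentiation of alternating sums and of families of alternating forms\<close>

lemma has_derivative_altsum:
  assumes "\<And>u ws. ((\<lambda>y. F y u ws) has_derivative F' u ws) (at x)"
  shows "((\<lambda>y. altsum (F y) vs) has_derivative (\<lambda>h. altsum (\<lambda>u ws. F' u ws h) vs)) (at x)"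
  using assms
proof (induction vs arbitrary: F F')
  case (Cons v vs)
  show ?case unfolding altsum.simps
    by (intro has_derivative_diff Cons.prems) (rule Cons.IH, rule Cons.prems)
qed simp

lemma smooth_on_altsum:
  "open S \<Longrightarrow> (\<And>u ws. smooth_on S (\<lambda>y. F y u ws)) \<Longrightarrow> smooth_on S (\<lambda>y. altsum (F y) vs)"
proof (induction vs arbitrary: F)
  case (Cons v vs)
  have "smooth_on S (\<lambda>y. F y v vs + (-1) * altsum (\<lambda>w ws. F y w (v # ws)) vs)"
    by (intro smooth_on_add smooth_on_cmult Cons.IH Cons.prems)
  then show ?case by simp
qed simp

text \<open>Degree, multilinearity and alternation are linear identities between values of
  \<open>\<phi> y\<close> that hold for all \<open>y\<close> near \<open>x\<close>; uniqueness of
  derivatives transfers them to \<open>\<phi>'\<close>.\<close>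

lemma alternating_form_derivative:
  fixes \<phi> :: "'d::euclidean_space \<Rightarrow> 'e::euclidean_space list \<Rightarrow> complex"
  assumes "open S" "x \<in> S" and alt: "\<And>y. y \<in> S \<Longrightarrow> alternating_form k (\<phi> y)"
    and der: "\<And>us. ((\<lambda>y. \<phi> y us) has_derivative \<phi>' us) (at x)"
  shows "alternating_form k (\<lambda>us. \<phi>' us v)"
proof -
  have zero: "\<phi>' us v = 0" if "\<And>y. y \<in> S \<Longrightarrow> \<phi> y us = 0" for us
  proof -
    have "((\<lambda>y. 0) has_derivative \<phi>' us) (at x)"
      by (rule has_derivative_transform_within_open[OF der assms(1,2)]) (rule that)
    from has_derivative_unique[OF this has_derivative_const] show ?thesis by (rule fun_cong)
  qed
  have lin: "linear (\<lambda>w. \<phi>' (us[i := w]) v)" if i: "i < length us" for us i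
  proof -
    have "linear (\<lambda>w. \<phi> y (us[i := w]))" if "y \<in> S" for y
      using alt[OF that] i unfolding alternating_form_def by blast
    note l = this
    have "\<phi>' (us[i := a + b]) = (\<lambda>h. \<phi>' (us[i := a]) h + \<phi>' (us[i := b]) h)" for a b
      by (rule has_derivative_unique[OF der], rule has_derivative_transform_within_open
          [OF has_derivative_add[OF der der] assms(1,2)]) (simp add: linear_add[OF l])
    moreover have "\<phi>' (us[i := r *\<^sub>R a]) = (\<lambda>h. r *\<^sub>R \<phi>' (us[i := a]) h)" for r a
      by (rule has_derivative_unique[OF der], rule has_derivative_transform_within_open
          [OF has_derivative_scaleR_right[OF der] assms(1,2)]) (simp add: linear_scale[OF l])
    ultimately show ?thesis by (simp add: linear_iff)
  qed
  show ?thesis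
    unfolding alternating_form_def
  proof (intro conjI allI impI)
    fix vs :: "'e list" assume "int (length vs) \<noteq> k"
    then show "\<phi>' vs v = 0" by (intro zero) (simp add: alternating_form_degree[OF alt])
  next
    fix vs :: "'e list" and i j assume *: "i < j \<and> j < length vs \<and> vs ! i = vs ! j"
    show "\<phi>' vs v = 0"
    proof (rule zero)
      fix y assume "y \<in> S"
      from alt[OF this] * show "\<phi> y vs = 0" unfolding alternating_form_def by blast
    qed
  qed (rule lin)
qed

lemma alternating_form_neg:
  assumes "alternating_form k \<phi>"
  shows "\<phi> (map (\<lambda>v. - f v) vs) = (-1) ^ length vs * \<phi> (map f vs)"
  using assms
proof (induction vs arbitrary: \<phi> k)
  case (Cons v vs)
  show ?case
    using Cons.IH[OF alternating_form_Cons[OF Cons.prems]]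
      linear_neg[OF alternating_form_linear[OF Cons.prems]] by simp
qed simp

locale manifold =
  fixes M :: "'a topology" and A :: "('a, 'e::euclidean_space) chart set"
  assumes smooth_manifold: "smooth_manifold M A"
begin

lemma chart: "c \<in> A \<Longrightarrow> chart M c"
  using smooth_manifold unfolding smooth_manifold_def by blast

lemma open_image: "c \<in> A \<Longrightarrow> open (snd c ` fst c)"
  using chart unfolding chart_def by blast

lemma chart_inv_coord [simp]:
  assumes "c \<in> A" "x \<in> fst c" shows "chart_inv c (snd c x) = x"
proof -
  have "homeomorphic_map (subtopology M (fst c)) (top_of_set (snd c ` fst c)) (snd c)"
    "openin M (fst c)"
    using chart[OF assms(1)] unfolding chart_def by auto
  then have "inj_on (snd c) (topspace (subtopology M (fst c)))"
    using homeomorphic_imp_injective_map by blast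
  moreover have "topspace (subtopology M (fst c)) = fst c"
    using openin_subset[OF \<open>openin M (fst c)\<close>] by auto
  ultimately show ?thesis unfolding chart_inv_def using assms by simp
qed

lemma chart_inv_mem:
  assumes "c \<in> A" "y \<in> snd c ` fst c" shows "chart_inv c y \<in> fst c" "snd c (chart_inv c y) = y"
  using assms by auto

text \<open>Smoothness of transition maps is given on images of overlaps only; differentiating there
  requires these images to be open.\<close>

lemma open_overlap:
  assumes "c \<in> A" "c' \<in> A" shows "open (snd c ` (fst c \<inter> fst c'))"
proof -
  have h: "homeomorphic_map (subtopology M (fst c)) (top_of_set (snd c ` fst c)) (snd c)"
    using chart[OF assms(1)] unfolding chart_def by auto
  have "openin M (fst c \<inter> fst c')"
    using chart[OF assms(1)] chart[OF assms(2)] unfolding chart_def by (auto intro: openin_Int)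
  then have "openin (subtopology M (fst c)) (fst c \<inter> fst c')"
    by (auto simp: openin_subtopology)
  then have "openin (top_of_set (snd c ` fst c)) (snd c ` (fst c \<inter> fst c'))"
    using homeomorphic_imp_open_map[OF h] unfolding open_map_def by blast
  then show ?thesis
    using openin_open_trans open_image[OF assms(1)] by blast
qed

lemma smooth_transition:
  "c \<in> A \<Longrightarrow> c' \<in> A \<Longrightarrow> smooth_on (snd c ` (fst c \<inter> fst c')) (transition c c')"
  using smooth_manifold unfolding smooth_manifold_def compatible_def by blast

lemma transition_coord [simp]:
  "c \<in> A \<Longrightarrow> x \<in> fst c \<Longrightarrow> transition c c' (snd c x) = snd c' x"
  by (simp add: transition_def)

lemma linear_jac:
  assumes "c \<in> A" "c' \<in> A" "x \<in> fst c \<inter> fst c'" shows "linear (jac c c' x)"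
  unfolding jac_def
  using smooth_on_differentiable[OF smooth_transition[OF assms(1,2)]] assms(3)
  by (intro linear_frechet_derivative) auto

subsection \<open>Vector space structure\<close>

lemma formsI:
  assumes "\<And>c x. \<not> (c \<in> A \<and> x \<in> fst c) \<Longrightarrow> \<alpha> c x = 0"
    and "\<And>c x. c \<in> A \<Longrightarrow> x \<in> fst c \<Longrightarrow> alternating_form k (\<alpha> c x)"
    and "\<And>c vs. c \<in> A \<Longrightarrow> smooth_on (snd c ` fst c) (\<lambda>y. \<alpha> c (chart_inv c y) vs)"
    and "\<And>c c' x vs. c \<in> A \<Longrightarrow> c' \<in> A \<Longrightarrow> x \<in> fst c \<Longrightarrow> x \<in> fst c' \<Longrightarrow>
      \<alpha> c x vs = \<alpha> c' x (map (jac c c' x) vs)"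
  shows "\<alpha> \<in> forms A k"
  unfolding forms_def mem_Collect_eq using assms by blast

lemma forms_outside:
  assumes "\<alpha> \<in> forms A k" "\<not> (c \<in> A \<and> x \<in> fst c)" shows "\<alpha> c x vs = 0"
proof -
  have "\<alpha> c x = 0" using assms unfolding forms_def by blast
  then show ?thesis by simp
qed

lemma forms_alternating: "\<alpha> \<in> forms A k \<Longrightarrow> c \<in> A \<Longrightarrow> x \<in> fst c \<Longrightarrow> alternating_form k (\<alpha> c x)"
  unfolding forms_def by blast

lemma forms_smooth:
  "\<alpha> \<in> forms A k \<Longrightarrow> c \<in> A \<Longrightarrow> smooth_on (snd c ` fst c) (\<lambda>y. \<alpha> c (chart_inv c y) vs)"
  unfolding forms_def by blast

lemma forms_jac:
  "\<alpha> \<in> forms A k \<Longrightarrow> c \<in> A \<Longrightarrow> c' \<in> A \<Longrightarrow> x \<in> fst c \<Longrightarrow> x \<in> fst c' \<Longrightarrow>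
    \<alpha> c x vs = \<alpha> c' x (map (jac c c' x) vs)"
  unfolding forms_def by blast

lemma forms_eqI:
  assumes "\<alpha> \<in> forms A k" "\<beta> \<in> forms A l"
    and "\<And>c x vs. c \<in> A \<Longrightarrow> x \<in> fst c \<Longrightarrow> \<alpha> c x vs = \<beta> c x vs"
  shows "\<alpha> = \<beta>"
  using assms(3) forms_outside[OF assms(1)] forms_outside[OF assms(2)] by (intro ext) metis

text \<open>The transformation law makes equality of forms local.\<close>

lemma forms_eqI_cover:
  assumes \<alpha>: "\<alpha> \<in> forms A k" and \<beta>: "\<beta> \<in> forms A l"
    and cover: "\<And>x. x \<in> (\<Union>c\<in>A. fst c) \<Longrightarrow> \<exists>c\<in>A. x \<in> fst c \<and> (\<forall>vs. \<alpha> c x vs = \<beta> c x vs)"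
  shows "\<alpha> = \<beta>"
proof (rule forms_eqI[OF \<alpha> \<beta>])
  fix c x vs assume c: "c \<in> A" "x \<in> fst c"
  then obtain c' where c': "c' \<in> A" "x \<in> fst c'" "\<And>vs. \<alpha> c' x vs = \<beta> c' x vs"
    using cover by blast
  show "\<alpha> c x vs = \<beta> c x vs"
    using forms_jac[OF \<alpha> c(1) c'(1) c(2) c'(2)] forms_jac[OF \<beta> c(1) c'(1) c(2) c'(2)] c'(3) by simp
qed

lemma zero_forms [simp]: "0 \<in> forms A k"
  by (rule formsI) (auto simp: zero_fun_def)

lemma add_forms [intro]:
  assumes "\<alpha> \<in> forms A k" "\<beta> \<in> forms A k" shows "\<alpha> + \<beta> \<in> forms A k"
proof (rule formsI)
  show "(\<alpha> + \<beta>) c x = 0" if "\<not> (c \<in> A \<and> x \<in> fst c)" for c x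
    using forms_outside[OF assms(1) that] forms_outside[OF assms(2) that] by (simp add: fun_eq_iff)
  show "alternating_form k ((\<alpha> + \<beta>) c x)" if "c \<in> A" "x \<in> fst c" for c x
    using alternating_form_add[OF forms_alternating[OF assms(1) that] forms_alternating[OF assms(2) that]]
    by (simp add: plus_fun_def)
  show "smooth_on (snd c ` fst c) (\<lambda>y. (\<alpha> + \<beta>) c (chart_inv c y) vs)" if "c \<in> A" for c vs
    using smooth_on_add[OF open_image[OF that] forms_smooth[OF assms(1) that] forms_smooth[OF assms(2) that]]
    by simp
  show "(\<alpha> + \<beta>) c x vs = (\<alpha> + \<beta>) c' x (map (jac c c' x) vs)"
    if "c \<in> A" "c' \<in> A" "x \<in> fst c" "x \<in> fst c'" for c c' x vs
    using forms_jac[OF assms(1) that] forms_jac[OF assms(2) that] by simp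
qed

lemma fscale_forms [intro]:
  assumes "\<alpha> \<in> forms A k" shows "fscale z \<alpha> \<in> forms A k"
proof (rule formsI)
  show "fscale z \<alpha> c x = 0" if "\<not> (c \<in> A \<and> x \<in> fst c)" for c x
    using forms_outside[OF assms that] by (simp add: fun_eq_iff)
  show "alternating_form k (fscale z \<alpha> c x)" if "c \<in> A" "x \<in> fst c" for c x
    using alternating_form_cmult[OF forms_alternating[OF assms that]] by (simp add: fscale_def)
  show "smooth_on (snd c ` fst c) (\<lambda>y. fscale z \<alpha> c (chart_inv c y) vs)" if "c \<in> A" for c vs
    using smooth_on_cmult[OF open_image[OF that] forms_smooth[OF assms that]] by simp
  show "fscale z \<alpha> c x vs = fscale z \<alpha> c' x (map (jac c c' x) vs)"
    if "c \<in> A" "c' \<in> A" "x \<in> fst c" "x \<in> fst c'" for c c' x vs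
    using forms_jac[OF assms that] by simp
qed

lemma subspace_forms: "fscale.subspace (forms A k)"
  by (rule fscale.subspaceI) auto

lemmas diff_forms = fscale.subspace_diff[OF subspace_forms]
lemmas sum_forms = fscale.subspace_sum[OF subspace_forms]

subsection \<open>The exterior derivative\<close>

text \<open>The direction \<open>v\<close> comes before the remaining arguments \<open>us\<close>,
  the shape that \<open>altsum\<close> expects, so that \<open>ext_d\<close> is the alternating sum
  of \<open>D\<close>.\<close>

definition D :: "('a, 'e) form \<Rightarrow> ('a, 'e) chart \<Rightarrow> 'a \<Rightarrow> 'e \<Rightarrow> 'e list \<Rightarrow> complex" where
  "D \<alpha> c x v us = frechet_derivative (\<lambda>y. \<alpha> c (chart_inv c y) us) (at (snd c x)) v"

lemma ext_d_altsum:
  "c \<in> A \<Longrightarrow> x \<in> fst c \<Longrightarrow> ext_d A \<alpha> c x vs = altsum (D \<alpha> c x) vs"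
  by (simp add: ext_d_def altsum_eq_sum D_def)

lemma has_derivative_form:
  assumes "\<alpha> \<in> forms A k" "c \<in> A" "x \<in> fst c"
  shows "((\<lambda>y. \<alpha> c (chart_inv c y) us) has_derivative (\<lambda>v. D \<alpha> c x v us)) (at (snd c x))"
  using smooth_on_has_derivative[OF forms_smooth[OF assms(1,2)]] assms(3)
  by (simp add: D_def)

lemma D_eqI:
  assumes "((\<lambda>y. \<alpha> c (chart_inv c y) us) has_derivative f) (at (snd c x))"
  shows "D \<alpha> c x v us = f v"
  using frechet_derivative_at[OF assms] by (simp add: D_def)

lemma linear_D:
  "\<alpha> \<in> forms A k \<Longrightarrow> c \<in> A \<Longrightarrow> x \<in> fst c \<Longrightarrow> linear (\<lambda>v. D \<alpha> c x v us)"
  using has_derivative_linear[OF has_derivative_form] .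

lemma alternating_form_D:
  assumes "\<alpha> \<in> forms A k" "c \<in> A" "x \<in> fst c" shows "alternating_form k (D \<alpha> c x v)"
  by (rule alternating_form_derivative[OF open_image[OF assms(2)] _ _ has_derivative_form[OF assms]])
     (use assms chart_inv_mem in \<open>auto intro: forms_alternating\<close>)

lemma smooth_D:
  assumes "\<alpha> \<in> forms A k" "c \<in> A"
  shows "smooth_on (snd c ` fst c) (\<lambda>y. D \<alpha> c (chart_inv c y) v us)"
  by (rule smooth_on_cong[OF open_image[OF assms(2)]
      smooth_on_frechet_derivative[OF forms_smooth[OF assms], of us v]])
     (use assms in \<open>auto simp: D_def\<close>)

lemma D_D_commute:
  assumes "\<alpha> \<in> forms A k" "c \<in> A" "x \<in> fst c"
  shows "frechet_derivative (\<lambda>y. D \<alpha> c (chart_inv c y) u us) (at (snd c x)) v =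
    frechet_derivative (\<lambda>y. D \<alpha> c (chart_inv c y) v us) (at (snd c x)) u"
proof -
  have S: "snd c x \<in> snd c ` fst c" using assms by simp
  have *: "frechet_derivative (\<lambda>y. D \<alpha> c (chart_inv c y) u us) (at (snd c x)) =
      frechet_derivative (\<lambda>y. frechet_derivative (\<lambda>y. \<alpha> c (chart_inv c y) us) (at y) u) (at (snd c x))" for u
    by (rule frechet_derivative_cong[OF open_image[OF assms(2)] S])
       (use assms in \<open>auto simp: D_def\<close>)
  show ?thesis
    unfolding * by (rule second_derivative_commute[OF open_image[OF assms(2)] S forms_smooth[OF assms(1,2)]])
qed

text \<open>Chain rule and Leibniz rule applied to the transformation law. The Jacobians acting on
  \<open>us\<close> vary with the point as well, and their derivatives contribute the Hessian
  \<open>H\<close> of the transition map.\<close>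

lemma D_jac:
  assumes \<alpha>: "\<alpha> \<in> forms A k" and c: "c \<in> A" "c' \<in> A" and x: "x \<in> fst c" "x \<in> fst c'"
  defines "H u v \<equiv> frechet_derivative (\<lambda>y. frechet_derivative (transition c c') (at y) u) (at (snd c x)) v"
  shows "D \<alpha> c x v us = D \<alpha> c' x (jac c c' x v) (map (jac c c' x) us) +
    altsum (\<lambda>u us. \<alpha> c' x (H u v # map (jac c c' x) us)) us"
proof -
  define S where "S = snd c ` (fst c \<inter> fst c')"
  define \<tau> where "\<tau> = transition c c'"
  have S: "open S" "snd c x \<in> S" using x by (auto simp: S_def open_overlap c)
  have \<tau>: "smooth_on S \<tau>" unfolding S_def \<tau>_def by (rule smooth_transition[OF c])
  have \<tau>x: "\<tau> (snd c x) = snd c' x" using c x by (simp add: \<tau>_def)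
  have jx: "frechet_derivative \<tau> (at (snd c x)) = jac c c' x" by (simp add: \<tau>_def jac_def)
  have "((\<lambda>y. \<alpha> c' (chart_inv c' (\<tau> y)) us) has_derivative (\<lambda>h. D \<alpha> c' x (jac c c' x h) us)) (at (snd c x))" for us
  proof (rule has_derivative_compose[where g = "\<lambda>y. \<alpha> c' (chart_inv c' y) us" and g' = "\<lambda>v. D \<alpha> c' x v us"])
    show "(\<tau> has_derivative jac c c' x) (at (snd c x))"
      using smooth_on_has_derivative[OF \<tau> S(2)] by (simp add: jx)
    show "((\<lambda>y. \<alpha> c' (chart_inv c' y) us) has_derivative (\<lambda>v. D \<alpha> c' x v us)) (at (\<tau> (snd c x)))"
      unfolding \<tau>x by (rule has_derivative_form[OF \<alpha> c(2) x(2)])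
  qed
  note der = this
  have "((\<lambda>y. \<alpha> c' (chart_inv c' (\<tau> y)) (map (frechet_derivative \<tau> (at y)) us)) has_derivative
      (\<lambda>h. D \<alpha> c' x (jac c c' x h) (map (frechet_derivative \<tau> (at (snd c x))) us) +
        altsum (\<lambda>u us. \<alpha> c' (chart_inv c' (\<tau> (snd c x))) (H u h # map (frechet_derivative \<tau> (at (snd c x))) us)) us))
      (at (snd c x))"
  proof (rule has_derivative_alternating_map[where \<phi> = "\<lambda>y. \<alpha> c' (chart_inv c' (\<tau> y))"
        and M = "\<lambda>y. frechet_derivative \<tau> (at y)" and M' = H, OF S _ der])
    fix y assume "y \<in> S"
    then show "alternating_form k (\<alpha> c' (chart_inv c' (\<tau> y)))"
      using c unfolding S_def \<tau>_def by (auto intro: forms_alternating[OF \<alpha>])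
  next
    show "((\<lambda>y. frechet_derivative \<tau> (at y) w) has_derivative H w) (at (snd c x))" for w
      unfolding H_def \<tau>_def[symmetric]
      by (rule smooth_on_has_derivative[OF smooth_on_frechet_derivative[OF \<tau>] S(2)])
  qed
  then have "((\<lambda>y. \<alpha> c (chart_inv c y) us) has_derivative
      (\<lambda>h. D \<alpha> c' x (jac c c' x h) (map (jac c c' x) us) +
        altsum (\<lambda>u us. \<alpha> c' x (H u h # map (jac c c' x) us)) us)) (at (snd c x))"
    unfolding jx \<tau>x chart_inv_coord[OF c(2) x(2)]
  proof (rule has_derivative_transform_within_open[OF _ S])
    fix y assume "y \<in> S"
    then obtain z where z: "z \<in> fst c" "z \<in> fst c'" "y = snd c z" unfolding S_def by auto
    show "\<alpha> c' (chart_inv c' (\<tau> y)) (map (frechet_derivative \<tau> (at y)) us) = \<alpha> c (chart_inv c y) us"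
      using forms_jac[OF \<alpha> c z(1,2), of us] z c unfolding \<tau>_def by (simp add: jac_def)
  qed
  from D_eqI[of \<alpha> c us, OF this] show ?thesis .
qed

text \<open>The main point is the transformation law: the Hessian terms of \<open>D_jac\<close> form
  a double alternating sum with symmetric kernel, hence cancel, and only the tensorial part
  remains.\<close>

lemma ext_d_forms [intro]:
  assumes "\<alpha> \<in> forms A k" shows "ext_d A \<alpha> \<in> forms A (k + 1)"
proof (rule formsI)
  show "ext_d A \<alpha> c x = 0" if "\<not> (c \<in> A \<and> x \<in> fst c)" for c x
    using that by (auto simp: ext_d_def fun_eq_iff)
  show "alternating_form (k + 1) (ext_d A \<alpha> c x)" if "c \<in> A" "x \<in> fst c" for c x
  proof -
    have "ext_d A \<alpha> c x = altsum (D \<alpha> c x)"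
      by (rule ext) (rule ext_d_altsum[OF that])
    then show ?thesis
      using alternating_form_altsum[OF alternating_form_D[OF assms that] linear_D[OF assms that]] by simp
  qed
  show "smooth_on (snd c ` fst c) (\<lambda>y. ext_d A \<alpha> c (chart_inv c y) vs)" if "c \<in> A" for c vs
    by (rule smooth_on_cong[OF open_image[OF that]
          smooth_on_altsum[OF open_image[OF that] smooth_D[OF assms that], where vs = vs]])
       (use that in \<open>auto simp: ext_d_altsum\<close>)
  show "ext_d A \<alpha> c x vs = ext_d A \<alpha> c' x (map (jac c c' x) vs)"
    if c: "c \<in> A" "c' \<in> A" and x: "x \<in> fst c" "x \<in> fst c'" for c c' x vs
  proof -
    define H where "H u v =
      frechet_derivative (\<lambda>y. frechet_derivative (transition c c') (at y) u) (at (snd c x)) v" for u v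
    have H: "H u v = H v u" for u v
      unfolding H_def
      by (rule second_derivative_commute[OF open_overlap[OF c] _ smooth_transition[OF c]])
         (use x in auto)
    have "D \<alpha> c x = (\<lambda>v us. D \<alpha> c' x (jac c c' x v) (map (jac c c' x) us) +
        altsum (\<lambda>u us. \<alpha> c' x (H u v # map (jac c c' x) us)) us)"
      using D_jac[OF assms c x] unfolding H_def by (intro ext) blast
    then have "ext_d A \<alpha> c x vs = altsum (\<lambda>v us. D \<alpha> c' x (jac c c' x v) (map (jac c c' x) us)) vs +
        altsum (\<lambda>v us. altsum (\<lambda>u us. \<alpha> c' x (H u v # map (jac c c' x) us)) us) vs"
      by (simp only: ext_d_altsum[OF c(1) x(1)] altsum_add)
    also have "altsum (\<lambda>v us. altsum (\<lambda>u us. \<alpha> c' x (H u v # map (jac c c' x) us)) us) vs = 0"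
      by (rule altsum_twice) (simp only: H)
    finally show ?thesis by (simp add: ext_d_altsum[OF c(2) x(2)] altsum_map)
  qed
qed

lemma D_add:
  assumes "\<alpha> \<in> forms A k" "\<beta> \<in> forms A l" "c \<in> A" "x \<in> fst c"
  shows "D (\<alpha> + \<beta>) c x v us = D \<alpha> c x v us + D \<beta> c x v us"
  by (rule D_eqI) (use has_derivative_add[OF has_derivative_form[OF assms(1,3,4)]
      has_derivative_form[OF assms(2-4)]] in simp)

lemma D_fscale:
  assumes "\<alpha> \<in> forms A k" "c \<in> A" "x \<in> fst c"
  shows "D (fscale z \<alpha>) c x v us = z * D \<alpha> c x v us"
  by (rule D_eqI) (use has_derivative_mult_right[OF has_derivative_form[OF assms]] in simp)

lemma ext_d_outside: "\<not> (c \<in> A \<and> x \<in> fst c) \<Longrightarrow> ext_d A \<alpha> c x vs = 0"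
  unfolding ext_d_def by (rule if_not_P)

lemma ext_d_add:
  assumes "\<alpha> \<in> forms A k" "\<beta> \<in> forms A l"
  shows "ext_d A (\<alpha> + \<beta>) = ext_d A \<alpha> + ext_d A \<beta>"
proof (intro ext)
  fix c x vs
  show "ext_d A (\<alpha> + \<beta>) c x vs = (ext_d A \<alpha> + ext_d A \<beta>) c x vs"
  proof (cases "c \<in> A \<and> x \<in> fst c")
    case True
    then have "D (\<alpha> + \<beta>) c x = (\<lambda>v us. D \<alpha> c x v us + D \<beta> c x v us)"
      using D_add[OF assms] by (intro ext) blast
    then show ?thesis using True by (simp add: ext_d_altsum altsum_add)
  qed (simp add: ext_d_outside)
qed

lemma ext_d_fscale:
  assumes "\<alpha> \<in> forms A k"
  shows "ext_d A (fscale z \<alpha>) = fscale z (ext_d A \<alpha>)"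
proof (intro ext)
  fix c x vs
  show "ext_d A (fscale z \<alpha>) c x vs = fscale z (ext_d A \<alpha>) c x vs"
  proof (cases "c \<in> A \<and> x \<in> fst c")
    case True
    then have "D (fscale z \<alpha>) c x = (\<lambda>v us. z * D \<alpha> c x v us)"
      using D_fscale[OF assms] by (intro ext) blast
    then show ?thesis using True by (simp add: ext_d_altsum altsum_cmult)
  qed (simp add: ext_d_outside)
qed

lemma D_ext_d:
  assumes "\<alpha> \<in> forms A k" "c \<in> A" "x \<in> fst c"
  shows "D (ext_d A \<alpha>) c x v us =
    altsum (\<lambda>u ws. frechet_derivative (\<lambda>y. D \<alpha> c (chart_inv c y) u ws) (at (snd c x)) v) us"
proof (rule D_eqI)
  have S: "snd c x \<in> snd c ` fst c" using assms by simp
  have "((\<lambda>y. altsum (D \<alpha> c (chart_inv c y)) us) has_derivative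
      (\<lambda>v. altsum (\<lambda>u ws. frechet_derivative (\<lambda>y. D \<alpha> c (chart_inv c y) u ws) (at (snd c x)) v) us))
      (at (snd c x))"
    by (rule has_derivative_altsum) (rule smooth_on_has_derivative[OF smooth_D[OF assms(1,2)] S])
  then show "((\<lambda>y. ext_d A \<alpha> c (chart_inv c y) us) has_derivative
      (\<lambda>v. altsum (\<lambda>u ws. frechet_derivative (\<lambda>y. D \<alpha> c (chart_inv c y) u ws) (at (snd c x)) v) us))
      (at (snd c x))"
    by (rule has_derivative_transform_within_open[OF _ open_image[OF assms(2)] S])
       (use assms(2) in \<open>auto simp: ext_d_altsum\<close>)
qed

lemma ext_d_ext_d:
  assumes "\<alpha> \<in> forms A k" shows "ext_d A (ext_d A \<alpha>) = 0"
proof (rule forms_eqI[of _ "k + 1 + 1" _ 0])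
  fix c x vs assume c: "c \<in> A" "x \<in> fst c"
  have "D (ext_d A \<alpha>) c x = (\<lambda>v us. altsum (\<lambda>u ws.
      frechet_derivative (\<lambda>y. D \<alpha> c (chart_inv c y) u ws) (at (snd c x)) v) us)"
    by (intro ext) (rule D_ext_d[OF assms c])
  then have "ext_d A (ext_d A \<alpha>) c x vs = altsum (\<lambda>v us. altsum (\<lambda>u ws.
      frechet_derivative (\<lambda>y. D \<alpha> c (chart_inv c y) u ws) (at (snd c x)) v) us) vs"
    by (simp add: ext_d_altsum[OF c])
  also have "\<dots> = 0"
    by (rule altsum_twice) (rule D_D_commute[OF assms c])
  finally show "ext_d A (ext_d A \<alpha>) c x vs = 0 c x vs" by simp
qed (intro ext_d_forms assms zero_forms)+

subsection \<open>The action of tensor fields\<close>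

text \<open>Stated for any tensor field \<open>T\<close> of type (1,1), since it is applied both to
  \<open>J\<close> and to the rotations. The transformation law survives because \<open>T\<close> is
  intertwined by the Jacobians.\<close>

lemma J_act_forms:
  assumes T: "tensor_field_1_1 A T" and \<alpha>: "\<alpha> \<in> forms A k"
  shows "J_act T \<alpha> \<in> forms A k"
proof (rule formsI)
  show "J_act T \<alpha> c x = 0" if "\<not> (c \<in> A \<and> x \<in> fst c)" for c x
    using forms_outside[OF \<alpha> that] by (simp add: fun_eq_iff J_act_def)
  show "alternating_form k (J_act T \<alpha> c x)" if "c \<in> A" "x \<in> fst c" for c x
  proof -
    have "alternating_form k (\<lambda>vs. \<alpha> c x (map (T c x) vs))"
      using T that forms_alternating[OF \<alpha> that] unfolding tensor_field_1_1_def
      by (intro alternating_form_map) auto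
    then show ?thesis by (simp add: J_act_def[abs_def])
  qed
  show "smooth_on (snd c ` fst c) (\<lambda>y. J_act T \<alpha> c (chart_inv c y) vs)" if "c \<in> A" for c vs
    unfolding J_act_def
  proof (rule smooth_on_alternating_map[OF open_image[OF that]])
    show "smooth_on (snd c ` fst c) (\<lambda>y. T c (chart_inv c y) w)" for w
      using T that unfolding tensor_field_1_1_def by blast
    show "alternating_form k (\<alpha> c (chart_inv c y))" if "y \<in> snd c ` fst c" for y
      using \<open>c \<in> A\<close> that by (auto intro: forms_alternating[OF \<alpha>])
  qed (rule forms_smooth[OF \<alpha> that])
  show "J_act T \<alpha> c x vs = J_act T \<alpha> c' x (map (jac c c' x) vs)"
    if "c \<in> A" "c' \<in> A" "x \<in> fst c" "x \<in> fst c'" for c c' x vs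
  proof -
    have "T c' x (jac c c' x v) = jac c c' x (T c x v)" for v
      using T that unfolding tensor_field_1_1_def by blast
    then show ?thesis
      using forms_jac[OF \<alpha> that, of "map (T c x) vs"] by (simp add: J_act_def o_def)
  qed
qed

lemma J_act_add: "J_act T (\<alpha> + \<beta>) = J_act T \<alpha> + J_act T \<beta>"
  by (simp add: fun_eq_iff J_act_def)

lemma J_act_fscale: "J_act T (fscale z \<alpha>) = fscale z (J_act T \<alpha>)"
  by (simp add: fun_eq_iff J_act_def)

lemma J_act_zero: "J_act T 0 = 0"
  by (simp add: fun_eq_iff J_act_def)

end

section \<open>Almost complex manifolds\<close>

lemma cext_degree:
  "(\<And>vs. length vs = length zs \<Longrightarrow> \<phi> vs = 0) \<Longrightarrow> cext \<phi> zs = 0"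
  by (induction zs arbitrary: \<phi>) auto

text \<open>\<open>J\<close>, \<open>- J\<close> and minus the identity are rotations by special
  angles, so identities for the action of \<open>J\<close> on forms become additions of
  angles.\<close>

lemma rot_0: "rot j 0 = (\<lambda>v. v)"
  and rot_pi_half: "rot j (pi / 2) = j"
  and rot_minus_pi_half: "rot j (- (pi / 2)) = (\<lambda>v. - j v)"
  and rot_pi: "rot j pi = (\<lambda>v. - v)"
  by (simp_all add: rot_def[abs_def])

locale almost_complex = manifold M A
  for M :: "'a topology" and A :: "('a, 'e::euclidean_space) chart set" +
  fixes J :: "('a, 'e) endo"
  assumes tensor_J: "tensor_field_1_1 A J"
    and J_J: "c \<in> A \<Longrightarrow> x \<in> fst c \<Longrightarrow> J c x (J c x v) = - v"
begin

abbreviation d :: "('a, 'e) form \<Rightarrow> ('a, 'e) form" where "d \<equiv> ext_d A"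
abbreviation dc :: "('a, 'e) form \<Rightarrow> ('a, 'e) form" where "dc \<equiv> d_c A J"

definition R :: "real \<Rightarrow> ('a, 'e) form \<Rightarrow> ('a, 'e) form" where
  "R t = J_act (\<lambda>c x. rot (J c x) t)"

lemma R_apply: "R t \<alpha> c x vs = \<alpha> c x (map (rot (J c x) t) vs)"
  by (simp add: R_def J_act_def)

lemma linear_J: "c \<in> A \<Longrightarrow> x \<in> fst c \<Longrightarrow> linear (J c x)"
  using tensor_J unfolding tensor_field_1_1_def by blast

lemma tensor_rot: "tensor_field_1_1 A (\<lambda>c x. rot (J c x) t)"
  unfolding tensor_field_1_1_def
proof (intro conjI ballI allI)
  show "linear (rot (J c x) t)" if "c \<in> A" "x \<in> fst c" for c x
    by (rule linear_rot[OF linear_J[OF that]])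
  show "smooth_on (snd c ` fst c) (\<lambda>y. rot (J c (chart_inv c y)) t v)" if "c \<in> A" for c v
  proof -
    have "smooth_on (snd c ` fst c) (\<lambda>y. J c (chart_inv c y) v)"
      using tensor_J that unfolding tensor_field_1_1_def by blast
    then show ?thesis
      unfolding rot_def
      by (intro smooth_on_add smooth_on_scaleR smooth_on_const open_image that)
  qed
  show "rot (J c' x) t (jac c c' x v) = jac c c' x (rot (J c x) t v)"
    if "c \<in> A" "c' \<in> A" "x \<in> fst c \<inter> fst c'" for c c' x v
  proof -
    have "J c' x (jac c c' x v) = jac c c' x (J c x v)"
      using tensor_J that unfolding tensor_field_1_1_def by blast
    then show ?thesis
      using linear_jac[OF that] by (simp add: rot_def linear_add linear_scale)
  qed
qed

lemma R_forms: "\<alpha> \<in> forms A k \<Longrightarrow> R t \<alpha> \<in> forms A k"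
  unfolding R_def by (rule J_act_forms[OF tensor_rot])

lemma R_add: "R t (\<alpha> + \<beta>) = R t \<alpha> + R t \<beta>"
  and R_fscale: "R t (fscale z \<alpha>) = fscale z (R t \<alpha>)"
  and R_0: "R t 0 = 0"
  unfolding R_def by (rule J_act_add J_act_fscale J_act_zero)+

lemma rot_rot:
  assumes "linear j" "\<And>v. j (j v) = - v"
  shows "rot j s (rot j t v) = rot j (s + t) v"
  using assms by (simp add: rot_def linear_add linear_scale cos_add sin_add algebra_simps)

lemma R_R:
  assumes "\<alpha> \<in> forms A k" shows "R s (R t \<alpha>) = R (s + t) \<alpha>"
proof (rule forms_eqI[where k = k and l = k])
  show "R s (R t \<alpha>) c x vs = R (s + t) \<alpha> c x vs" if "c \<in> A" "x \<in> fst c" for c x vs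
    using rot_rot[OF linear_J[OF that] J_J[OF that], of t s] by (simp add: R_apply o_def add.commute)
qed (intro R_forms assms)+

lemma R_id: "R 0 \<alpha> = \<alpha>"
  by (intro ext) (simp add: R_apply rot_0)

lemma J_act_R: "J_act J \<alpha> = R (pi / 2) \<alpha>"
  by (intro ext) (simp add: R_apply rot_pi_half J_act_def)

lemma J_act_inv_R:
  assumes "\<alpha> \<in> forms A k" shows "J_act_inv J \<alpha> = R (- (pi / 2)) \<alpha>"
proof (intro ext)
  fix c x vs
  show "J_act_inv J \<alpha> c x vs = R (- (pi / 2)) \<alpha> c x vs"
  proof (cases "c \<in> A \<and> x \<in> fst c")
    case True
    then have inv: "J c x (- J c x v) = v" for v
      using J_J linear_J linear_neg[of "J c x" "J c x v"] by simp
    have "inj (J c x)"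
      by (rule injI) (metis True J_J neg_equal_iff_equal)
    then have "inv_into UNIV (J c x) = (\<lambda>v. - J c x v)"
      using inv by (intro ext) (metis inv_f_f)
    then show ?thesis
      by (simp add: J_act_inv_def R_apply rot_minus_pi_half)
  next
    \<comment> \<open>Off the atlas \<open>J\<close> is unconstrained, but forms vanish
      there.\<close>
    case False
    show ?thesis
      unfolding J_act_inv_def R_apply by (simp only: forms_outside[OF assms False])
  qed
qed

text \<open>Each of the \<open>k\<close> arguments changes its sign; for negative \<open>k\<close>
  both sides are zero.\<close>

lemma R_pi:
  assumes "\<alpha> \<in> forms A k" shows "R pi \<alpha> = fscale ((-1) ^ nat k) \<alpha>"
proof (rule forms_eqI[where k = k and l = k])
  fix c x vs assume c: "c \<in> A" "x \<in> fst c"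
  have "R pi \<alpha> c x vs = (-1) ^ length vs * \<alpha> c x vs"
    using alternating_form_neg[OF forms_alternating[OF assms c], of "\<lambda>v. v" vs]
    by (simp add: R_apply rot_pi)
  then show "R pi \<alpha> c x vs = fscale ((-1) ^ nat k) \<alpha> c x vs"
    using alternating_form_degree[OF forms_alternating[OF assms c], of vs]
    by (cases "int (length vs) = k") auto
qed (intro R_forms fscale_forms assms)+

lemma d_forms: "\<alpha> \<in> forms A l \<Longrightarrow> k = l + 1 \<Longrightarrow> d \<alpha> \<in> forms A k"
  using ext_d_forms by simp

lemma dc_eq: "\<alpha> \<in> forms A k \<Longrightarrow> dc \<alpha> = R (- (pi / 2)) (d (R (pi / 2) \<alpha>))"
  unfolding d_c_def J_act_R by (rule J_act_inv_R[OF ext_d_forms[OF R_forms]])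

lemma dc_forms:
  assumes "\<alpha> \<in> forms A l" "k = l + 1" shows "dc \<alpha> \<in> forms A k"
  unfolding dc_eq[OF assms(1)] by (intro R_forms d_forms[OF _ assms(2)] assms(1))

lemma dc_add:
  assumes "\<alpha> \<in> forms A k" "\<beta> \<in> forms A k" shows "dc (\<alpha> + \<beta>) = dc \<alpha> + dc \<beta>"
  by (simp only: dc_eq[OF add_forms[OF assms]] dc_eq[OF assms(1)] dc_eq[OF assms(2)] R_add
      ext_d_add[OF R_forms[OF assms(1)] R_forms[OF assms(2)]])

lemma dc_fscale:
  assumes "\<alpha> \<in> forms A k" shows "dc (fscale z \<alpha>) = fscale z (dc \<alpha>)"
  by (simp only: dc_eq[OF fscale_forms[OF assms]] dc_eq[OF assms(1)] R_fscale
      ext_d_fscale[OF R_forms[OF assms]])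

lemma d_0: "d 0 = 0"
  using ext_d_fscale[OF zero_forms, of 0] by simp

lemma dc_0: "dc 0 = 0"
  using dc_fscale[OF zero_forms, of 0] by simp

lemma d_sum: "(\<And>i. i \<in> I \<Longrightarrow> f i \<in> forms A k) \<Longrightarrow> d (\<Sum>i\<in>I. f i) = (\<Sum>i\<in>I. d (f i))"
  by (induction I rule: infinite_finite_induct)
    (simp_all add: d_0 ext_d_add[where k = k and l = k] sum_forms)

lemma dc_sum: "(\<And>i. i \<in> I \<Longrightarrow> f i \<in> forms A k) \<Longrightarrow> dc (\<Sum>i\<in>I. f i) = (\<Sum>i\<in>I. dc (f i))"
  by (induction I rule: infinite_finite_induct)
    (simp_all add: dc_0 dc_add[where k = k] sum_forms)

lemma R_R_neg: "\<alpha> \<in> forms A k \<Longrightarrow> R t (R (- t) \<alpha>) = \<alpha>"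
  by (simp add: R_R R_id)

lemma dc_dc:
  assumes "\<alpha> \<in> forms A k" shows "dc (dc \<alpha>) = 0"
proof -
  have d: "d (R (pi / 2) \<alpha>) \<in> forms A (k + 1)" by (intro ext_d_forms R_forms assms)
  have "dc (dc \<alpha>) = R (- (pi / 2)) (d (R (pi / 2) (dc \<alpha>)))"
    by (rule dc_eq[OF dc_forms[OF assms refl]])
  also have "R (pi / 2) (dc \<alpha>) = d (R (pi / 2) \<alpha>)"
    by (simp only: dc_eq[OF assms] R_R_neg[OF d])
  finally show ?thesis by (simp only: ext_d_ext_d[OF R_forms[OF assms]] R_0)
qed

subsection \<open>Forms of type \<open>(p, q)\<close>\<close>

lemma forms_eq_0_if_cext:
  assumes "\<alpha> \<in> forms A k"
    and "\<And>c x zs ws. c \<in> A \<Longrightarrow> x \<in> fst c \<Longrightarrow> set zs \<subseteq> T10 (J c x) \<Longrightarrow> set ws \<subseteq> T01 (J c x) \<Longrightarrow>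
      int (length zs) + int (length ws) = k \<Longrightarrow> cext (\<alpha> c x) (zs @ ws) = 0"
  shows "\<alpha> = 0"
proof (rule forms_eqI[OF assms(1) zero_forms[of k]])
  fix c x vs assume c: "c \<in> A" "x \<in> fst c"
  have "\<alpha> c x vs = 0"
  proof (rule alternating_form_eq_0_if_cext[OF forms_alternating[OF assms(1) c] linear_J[OF c] J_J[OF c]])
    fix zs ws assume zw: "set zs \<subseteq> T10 (J c x)" "set ws \<subseteq> T01 (J c x)"
    show "cext (\<alpha> c x) (zs @ ws) = 0"
    proof (cases "int (length zs) + int (length ws) = k")
      case True
      show ?thesis by (rule assms(2)[OF c zw True])
    next
      case False
      then show ?thesis
        by (intro cext_degree alternating_form_degree[OF forms_alternating[OF assms(1) c]]) auto
    qed
  qed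
  then show "\<alpha> c x vs = 0 c x vs" by simp
qed

lemma forms_pq_forms: "\<alpha> \<in> forms_pq A J p q \<Longrightarrow> \<alpha> \<in> forms A (p + q)"
  by (simp add: forms_pq_def)

lemma forms_pq_forms': "\<alpha> \<in> forms_pq A J p (k - p) \<Longrightarrow> \<alpha> \<in> forms A k"
  using forms_pq_forms by force

lemma forms_pq_cext:
  "\<alpha> \<in> forms_pq A J p q \<Longrightarrow> c \<in> A \<Longrightarrow> x \<in> fst c \<Longrightarrow> set zs \<subseteq> T10 (J c x) \<Longrightarrow> set ws \<subseteq> T01 (J c x) \<Longrightarrow>
    \<not> (int (length zs) = p \<and> int (length ws) = q) \<Longrightarrow> cext (\<alpha> c x) (zs @ ws) = 0"
  unfolding forms_pq_def by blast

lemma forms_pqI: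
  assumes \<alpha>: "\<alpha> \<in> forms A (p + q)"
    and "\<And>c x zs ws. c \<in> A \<Longrightarrow> x \<in> fst c \<Longrightarrow> set zs \<subseteq> T10 (J c x) \<Longrightarrow> set ws \<subseteq> T01 (J c x) \<Longrightarrow>
      int (length zs) + int (length ws) = p + q \<Longrightarrow> int (length zs) \<noteq> p \<Longrightarrow> cext (\<alpha> c x) (zs @ ws) = 0"
  shows "\<alpha> \<in> forms_pq A J p q"
  unfolding forms_pq_def mem_Collect_eq
proof (intro conjI ballI allI impI \<alpha>)
  fix c x zs ws assume c: "c \<in> A" "x \<in> fst c"
    and zw: "set zs \<subseteq> T10 (J c x) \<and> set ws \<subseteq> T01 (J c x) \<and> \<not> (int (length zs) = p \<and> int (length ws) = q)"
  show "cext (\<alpha> c x) (zs @ ws) = 0"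
  proof (cases "int (length zs) + int (length ws) = p + q")
    case True
    then show ?thesis using assms(2)[OF c] zw by auto
  next
    case False
    then show ?thesis
      by (intro cext_degree alternating_form_degree[OF forms_alternating[OF \<alpha> c]]) auto
  qed
qed

lemma cext_R:
  assumes "\<alpha> \<in> forms A k" "c \<in> A" "x \<in> fst c" "set zs \<subseteq> T10 (J c x)" "set ws \<subseteq> T01 (J c x)"
  shows "cext (R t \<alpha> c x) (zs @ ws) =
    cis (t * (real (length zs) - real (length ws))) * cext (\<alpha> c x) (zs @ ws)"
  using cext_rot[OF forms_alternating[OF assms(1-3)] assms(4,5), of t]
  by (simp add: R_apply[abs_def])

lemma cext_plus: "cext ((\<alpha> + \<beta>) c x) zs = cext (\<alpha> c x) zs + cext (\<beta> c x) zs"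
  by (simp add: cext_add[symmetric] plus_fun_def)

lemma cext_fscale: "cext (fscale z \<alpha> c x) zs = z * cext (\<alpha> c x) zs"
  by (simp add: cext_cmult[symmetric] fscale_def)

lemma cext_form_sum: "cext ((\<Sum>i\<in>I. f i) c x) zs = (\<Sum>i\<in>I. cext (f i c x) zs)"
  for f :: "'i \<Rightarrow> ('a, 'e) form"
  unfolding cext_sum[symmetric] by (rule arg_cong2[where f = cext]) (auto simp: sum_form_apply)

lemma R_forms_pq:
  assumes "\<alpha> \<in> forms_pq A J p q"
  shows "R t \<alpha> = fscale (cis (t * real_of_int (p - q))) \<alpha>"
proof -
  note \<alpha> = forms_pq_forms[OF assms]
  have "R t \<alpha> + fscale (- cis (t * real_of_int (p - q))) \<alpha> = 0"
  proof (rule forms_eq_0_if_cext)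
    show "R t \<alpha> + fscale (- cis (t * real_of_int (p - q))) \<alpha> \<in> forms A (p + q)"
      by (intro add_forms R_forms fscale_forms \<alpha>)
    fix c x zs ws assume c: "c \<in> A" "x \<in> fst c"
      and zw: "set zs \<subseteq> T10 (J c x)" "set ws \<subseteq> T01 (J c x)"
    show "cext ((R t \<alpha> + fscale (- cis (t * real_of_int (p - q))) \<alpha>) c x) (zs @ ws) = 0"
    proof (cases "int (length zs) = p \<and> int (length ws) = q")
      case True
      then have "real (length zs) - real (length ws) = real_of_int (p - q)" by auto
      then show ?thesis by (simp only: cext_plus cext_R[OF \<alpha> c zw] cext_fscale) simp
    next
      case False
      then show ?thesis
        by (simp only: cext_plus cext_R[OF \<alpha> c zw] cext_fscale forms_pq_cext[OF assms c zw False])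
          simp
    qed
  qed
  then show ?thesis by (simp add: add_eq_0_iff2)
qed

text \<open>A tuple with the wrong number of vectors of type (1,0) has a weight different from
  \<open>p - q\<close>. At a suitable angle the two phases are opposite, which forces the value on
  the tuple to vanish.\<close>

lemma forms_pq_if_R:
  assumes \<alpha>: "\<alpha> \<in> forms A (p + q)"
    and R: "\<And>t. R t \<alpha> = fscale (cis (t * real_of_int (p - q))) \<alpha>"
  shows "\<alpha> \<in> forms_pq A J p q"
proof (rule forms_pqI[OF \<alpha>])
  fix c x zs ws assume c: "c \<in> A" "x \<in> fst c"
    and zw: "set zs \<subseteq> T10 (J c x)" "set ws \<subseteq> T01 (J c x)"
    and deg: "int (length zs) + int (length ws) = p + q" "int (length zs) \<noteq> p"
  define n where "n = real (length zs) - real_of_int p"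
  \<comment> \<open>The weight of the tuple exceeds \<open>p - q\<close> by \<open>2 * n\<close>, so
    at this angle the two phases differ by the factor \<open>cis pi = -1\<close>.\<close>
  define t where "t = pi / (2 * n)"
  have n: "n \<noteq> 0" using deg unfolding n_def by (metis eq_iff_diff_eq_0 of_int_eq_iff of_int_of_nat_eq)
  have "real_of_int (int (length zs) + int (length ws)) = real_of_int (p + q)" using deg(1) by (rule arg_cong)
  then have "real (length zs) - real (length ws) = 2 * n + real_of_int (p - q)"
    by (simp add: n_def)
  moreover have "t * (2 * n) = pi" using n by (simp add: t_def)
  ultimately have "t * (real (length zs) - real (length ws)) = pi + t * real_of_int (p - q)"
    by (simp only: distrib_left)
  then have "cext (R t \<alpha> c x) (zs @ ws) = cis pi * cis (t * real_of_int (p - q)) * cext (\<alpha> c x) (zs @ ws)"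
    by (simp only: cext_R[OF \<alpha> c zw] cis_mult)
  moreover have "cext (R t \<alpha> c x) (zs @ ws) = cis (t * real_of_int (p - q)) * cext (\<alpha> c x) (zs @ ws)"
    by (simp only: R cext_fscale)
  ultimately show "cext (\<alpha> c x) (zs @ ws) = 0" by (simp add: cis_pi)
qed

lemma forms_pq_iff:
  "\<alpha> \<in> forms_pq A J p q \<longleftrightarrow>
    \<alpha> \<in> forms A (p + q) \<and> (\<forall>t. R t \<alpha> = fscale (cis (t * real_of_int (p - q))) \<alpha>)"
  using forms_pq_if_R R_forms_pq forms_pq_forms by blast

lemma subspace_forms_pq: "fscale.subspace (forms_pq A J p q)"
  by (rule fscale.subspaceI; unfold forms_pq_iff)
    (auto simp: R_0 R_add R_fscale fscale.scale_right_distrib mult.commute)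

section \<open>Existence and uniqueness of the decomposition into types\<close>

lemma forms_pq_outside:
  assumes "\<alpha> \<in> forms_pq A J p (k - p)" "p \<notin> {0..k}" shows "\<alpha> = 0"
  by (rule forms_eq_0_if_cext[OF forms_pq_forms[OF assms(1)]], rule forms_pq_cext[OF assms(1)])
     (use assms(2) in auto)

text \<open>Evaluation on \<open>p\<close> vectors of type (1,0) followed by vectors of type (0,1)
  annihilates all summands except the one of index \<open>p\<close>. Indices outside
  \<open>0..k\<close> are included, which makes the family in \<open>part_pq\<close> unique as a
  function on all integers.\<close>

lemma sum_forms_pq_eq_0:
  assumes f: "\<And>p. f p \<in> forms_pq A J p (k - p)" and sum: "(\<Sum>p\<in>{0..k}. f p) = 0"
  shows "f p = 0"
proof (cases "p \<in> {0..k}")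
  case True
  show ?thesis
  proof (rule forms_eq_0_if_cext[OF forms_pq_forms'[OF f]])
    fix c x zs ws assume c: "c \<in> A" "x \<in> fst c"
      and zw: "set zs \<subseteq> T10 (J c x)" "set ws \<subseteq> T01 (J c x)"
    show "cext (f p c x) (zs @ ws) = 0"
    proof (cases "int (length zs) = p")
      case len: True
      have "0 = cext ((\<Sum>p\<in>{0..k}. f p) c x) (zs @ ws)"
        unfolding sum by (simp add: zero_fun_def)
      also have "\<dots> = (\<Sum>r\<in>{0..k}. if r = p then cext (f p c x) (zs @ ws) else 0)"
        unfolding cext_form_sum
        by (rule sum.cong) (use len in \<open>auto intro: forms_pq_cext[OF f c zw]\<close>)
      also have "\<dots> = cext (f p c x) (zs @ ws)" using True by (simp add: sum.delta)
      finally show ?thesis by simp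
    qed (auto intro: forms_pq_cext[OF f c zw])
  qed
qed (rule forms_pq_outside[OF f])

text \<open>Orthogonality of the characters of the cyclic group of order \<open>n\<close>; by the
  bound, 0 is the only admissible \<open>m\<close> divisible by \<open>n\<close>.\<close>

lemma sum_roots_of_unity:
  fixes m n :: int
  assumes "\<bar>m\<bar> < n"
  shows "(\<Sum>s<nat n. cis (2 * pi * real s / real_of_int n * real_of_int m)) =
    (if m = 0 then complex_of_real (real_of_int n) else 0)"
proof (cases "m = 0")
  case False
  define z where "z = cis (2 * pi * real_of_int m / real_of_int n)"
  have n: "n > 0" using assms by linarith
  have pow: "cis (2 * pi * real s / real_of_int n * real_of_int m) = z ^ s" for s
    unfolding z_def Complex.DeMoivre by (rule arg_cong[where f = cis]) (simp add: field_simps)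
  have "z ^ nat n = cis (2 * pi * real_of_int m)"
    unfolding z_def Complex.DeMoivre by (rule arg_cong[where f = cis]) (use n in \<open>simp add: field_simps\<close>)
  then have zn: "z ^ nat n = 1"
    by (metis cis_multiple_2pi Ints_of_int)
  have "z \<noteq> 1"
  proof
    assume "z = 1"
    then have "cos (2 * pi * real_of_int m / real_of_int n) = 1"
      unfolding z_def by (simp add: complex_eq_iff)
    then obtain i :: int where "2 * pi * real_of_int m / real_of_int n = real_of_int i * 2 * pi"
      using cos_one_2pi_int by blast
    then have "real_of_int m = real_of_int (i * n)" using n by (simp add: field_simps)
    then have m: "m = i * n" by (simp only: of_int_eq_iff)
    with False have "\<bar>i\<bar> \<ge> 1" by auto
    then have "\<bar>m\<bar> \<ge> n" using n unfolding m abs_mult by simp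
    with assms show False by simp
  qed
  then show ?thesis using False by (simp only: pow sum_gp_strict zn) simp
qed (use assms in simp)

text \<open>The decomposition into types is a discrete Fourier transform along the rotations \<open>R t\<close>, which act on
  \<open>A\<^sup>p\<^sup>,\<^sup>q\<close> by \<open>e\<^sup>i\<^sup>t\<^sup>(\<^sup>p\<^sup>-\<^sup>q\<^sup>)\<close>.\<close>

definition fourier :: "int \<Rightarrow> ('a, 'e) form \<Rightarrow> int \<Rightarrow> ('a, 'e) form" where
  "fourier k \<alpha> p = fscale (1 / complex_of_real (real_of_int (2 * k + 1)))
    (\<Sum>s<nat (2 * k + 1). fscale (cis (- (2 * pi * real s / real_of_int (2 * k + 1) * real_of_int (2 * p - k))))
      (R (2 * pi * real s / real_of_int (2 * k + 1)) \<alpha>))"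

lemma fourier_forms: "\<alpha> \<in> forms A k \<Longrightarrow> fourier k \<alpha> p \<in> forms A k"
  unfolding fourier_def by (intro fscale_forms sum_forms R_forms)

lemma cext_fourier:
  assumes "\<alpha> \<in> forms A k" "c \<in> A" "x \<in> fst c" "set zs \<subseteq> T10 (J c x)" "set ws \<subseteq> T01 (J c x)"
    and k: "int (length zs) + int (length ws) = k" and p: "p \<in> {0..k}"
  shows "cext (fourier k \<alpha> p c x) (zs @ ws) = (if int (length zs) = p then cext (\<alpha> c x) (zs @ ws) else 0)"
proof -
  define N where "N = 2 * k + 1"
  \<comment> \<open>The frequency that remains after the phase in \<open>fourier\<close> is
    subtracted. Both \<open>length zs\<close> and \<open>p\<close> lie between 0 and
    \<open>k\<close>, so its absolute value is at most \<open>2 * k\<close>, just below the number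
    \<open>N\<close> of angles.\<close>
  define m where "m = 2 * (int (length zs) - p)"
  have ws: "real (length ws) = real_of_int k - real (length zs)" using k by linarith
  have angle: "- (r * real_of_int (2 * p - k)) + r * (real (length zs) - real (length ws)) =
      r * real_of_int m" for r
    by (simp add: m_def ws algebra_simps)
  have "cext (fourier k \<alpha> p c x) (zs @ ws) = 1 / complex_of_real (real_of_int N) *
      ((\<Sum>s<nat N. cis (2 * pi * real s / real_of_int N * real_of_int m)) * cext (\<alpha> c x) (zs @ ws))"
    unfolding fourier_def N_def[symmetric] cext_fscale cext_form_sum cext_R[OF assms(1-5)] sum_distrib_right
    by (simp only: mult.assoc[symmetric] cis_mult angle)
  also have "(\<Sum>s<nat N. cis (2 * pi * real s / real_of_int N * real_of_int m)) =
      (if m = 0 then complex_of_real (real_of_int N) else 0)"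
    by (rule sum_roots_of_unity) (use k p in \<open>auto simp: m_def N_def\<close>)
  finally have "cext (fourier k \<alpha> p c x) (zs @ ws) =
      (if m = 0 then complex_of_real (real_of_int N) / complex_of_real (real_of_int N) else 0) *
      cext (\<alpha> c x) (zs @ ws)" by simp
  moreover have "complex_of_real (real_of_int N) \<noteq> 0"
    unfolding of_real_eq_0_iff of_int_eq_0_iff using p by (simp add: N_def)
  moreover have "m = 0 \<longleftrightarrow> int (length zs) = p" by (auto simp: m_def)
  ultimately show ?thesis by simp
qed

lemma fourier_forms_pq:
  assumes "\<alpha> \<in> forms A k" "p \<in> {0..k}" shows "fourier k \<alpha> p \<in> forms_pq A J p (k - p)"
proof (rule forms_pqI)
  fix c x zs ws assume "c \<in> A" "x \<in> fst c"  "set zs \<subseteq> T10 (J c x)" "set ws \<subseteq> T01 (J c x)"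
    "int (length zs) + int (length ws) = p + (k - p)" "int (length zs) \<noteq> p"
  then show "cext (fourier k \<alpha> p c x) (zs @ ws) = 0"
    using cext_fourier[OF assms(1) _ _ _ _ _ assms(2)] by simp
qed (use fourier_forms[OF assms(1)] in simp)

lemma sum_fourier:
  assumes "\<alpha> \<in> forms A k" shows "(\<Sum>p\<in>{0..k}. fourier k \<alpha> p) = \<alpha>"
proof -
  have "(\<Sum>p\<in>{0..k}. fourier k \<alpha> p) + fscale (-1) \<alpha> = 0"
  proof (rule forms_eq_0_if_cext)
    show "(\<Sum>p\<in>{0..k}. fourier k \<alpha> p) + fscale (-1) \<alpha> \<in> forms A k"
      by (intro add_forms fscale_forms sum_forms fourier_forms assms)
    fix c x zs ws assume c: "c \<in> A" "x \<in> fst c" "set zs \<subseteq> T10 (J c x)" "set ws \<subseteq> T01 (J c x)"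
      and k: "int (length zs) + int (length ws) = k"
    have "cext ((\<Sum>p\<in>{0..k}. fourier k \<alpha> p) c x) (zs @ ws) =
        (\<Sum>p\<in>{0..k}. if int (length zs) = p then cext (\<alpha> c x) (zs @ ws) else 0)"
      unfolding cext_form_sum by (intro sum.cong refl cext_fourier[OF assms c k])
    also have "\<dots> = cext (\<alpha> c x) (zs @ ws)" using k by (simp add: sum.delta)
    finally show "cext (((\<Sum>p\<in>{0..k}. fourier k \<alpha> p) + fscale (-1) \<alpha>) c x) (zs @ ws) = 0"
      by (simp only: cext_plus cext_fscale) simp
  qed
  then show ?thesis by (simp add: add_eq_0_iff2)
qed

abbreviation part :: "int \<Rightarrow> int \<Rightarrow> ('a, 'e) form \<Rightarrow> ('a, 'e) form" where
  "part k p \<equiv> part_pq A J p (k - p)"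

text \<open>\<open>part_pq\<close> is a definite description, so once uniqueness is known, every
  decomposition into types computes it.\<close>

lemma part_pq_eqI:
  assumes f: "\<And>r. f r \<in> forms_pq A J r (k - r)" and \<alpha>: "\<alpha> = (\<Sum>r\<in>{0..k}. f r)"
  shows "part k p \<alpha> = f p"
proof -
  have "(THE f. (\<forall>r. f r \<in> forms_pq A J r (k - r)) \<and> \<alpha> = (\<Sum>r\<in>{0..k}. f r)) = f"
  proof (rule the_equality)
    fix g assume g: "(\<forall>r. g r \<in> forms_pq A J r (k - r)) \<and> \<alpha> = (\<Sum>r\<in>{0..k}. g r)"
    have "g r - f r = 0" for r
      by (rule sum_forms_pq_eq_0[of "\<lambda>r. g r - f r" k])
         (use f g \<alpha> in \<open>auto simp: sum_subtractf intro: fscale.subspace_diff[OF subspace_forms_pq]\<close>)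
    then show "g = f" by (intro ext) simp
  qed (use f \<alpha> in auto)
  then show ?thesis by (simp add: part_pq_def)
qed

text \<open>The discrete transform is periodic in \<open>p\<close> with period
  \<open>2 * k + 1\<close> and repeats components at indices outside \<open>0..k\<close>; hence the
  explicit zero there.\<close>

lemma part_pq_fourier:
  assumes "\<alpha> \<in> forms A k"
  shows "part k p \<alpha> = (if p \<in> {0..k} then fourier k \<alpha> p else 0)"
proof (rule part_pq_eqI)
  show "(if p \<in> {0..k} then fourier k \<alpha> p else 0) \<in> forms_pq A J p (k - p)" for p
    using fourier_forms_pq[OF assms] fscale.subspace_0[OF subspace_forms_pq] by simp
  show "\<alpha> = (\<Sum>p\<in>{0..k}. if p \<in> {0..k} then fourier k \<alpha> p else 0)"
    using sum_fourier[OF assms] by simp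
qed

lemma part_pq_forms_pq:
  assumes "\<alpha> \<in> forms A (p + q)" shows "part_pq A J p q \<alpha> \<in> forms_pq A J p q"
  using part_pq_fourier[OF assms, of p] fourier_forms_pq[OF assms, of p]
    fscale.subspace_0[OF subspace_forms_pq] by simp

lemma part_pq_forms_pq':
  "\<alpha> \<in> forms A k \<Longrightarrow> part k p \<alpha> \<in> forms_pq A J p (k - p)"
  by (rule part_pq_forms_pq) simp

lemma part_pq_forms: "\<alpha> \<in> forms A k \<Longrightarrow> part k p \<alpha> \<in> forms A k"
  using part_pq_forms_pq' forms_pq_forms' by blast

lemma sum_part_pq:
  assumes "\<alpha> \<in> forms A k" shows "(\<Sum>p\<in>{0..k}. part k p \<alpha>) = \<alpha>"
  using sum_fourier[OF assms] by (simp add: part_pq_fourier[OF assms])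

lemma part_pq_add:
  assumes "\<alpha> \<in> forms A k" "\<beta> \<in> forms A k"
  shows "part k p (\<alpha> + \<beta>) = part k p \<alpha> + part k p \<beta>"
  by (rule part_pq_eqI[where f = "\<lambda>p. part k p \<alpha> + part k p \<beta>"])
    (auto simp: sum.distrib sum_part_pq assms
      intro!: fscale.subspace_add[OF subspace_forms_pq] part_pq_forms_pq')

lemma part_pq_fscale:
  assumes "\<alpha> \<in> forms A k"
  shows "part k p (fscale z \<alpha>) = fscale z (part k p \<alpha>)"
  by (rule part_pq_eqI[where f = "\<lambda>p. fscale z (part k p \<alpha>)"])
    (auto simp: fscale.scale_sum_right[symmetric] sum_part_pq assms
      intro!: fscale.subspace_scale[OF subspace_forms_pq] part_pq_forms_pq')

lemma part_pq_0: "part k p 0 = 0"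
  using part_pq_fscale[OF zero_forms, of p k 0] by simp

lemma part_pq_outside:
  "\<alpha> \<in> forms A k \<Longrightarrow> p \<notin> {0..k} \<Longrightarrow> part k p \<alpha> = 0"
  by (simp only: part_pq_fourier if_False)

end

section \<open>Integrable structures\<close>

locale complex_structure = almost_complex +
  assumes integrable: "integrable_acs A J"
begin

lemma flat_chart:
  assumes "x \<in> (\<Union>c\<in>A. fst c)"
  obtains c where "c \<in> A" "x \<in> fst c" "\<And>y. y \<in> fst c \<Longrightarrow> J c y = J c x"
  using integrable assms unfolding integrable_acs_def by metis

section \<open>Computations in a chart where the complex structure is constant\<close>

context
  fixes c x
  assumes c: "c \<in> A" "x \<in> fst c" and flat: "\<And>y. y \<in> fst c \<Longrightarrow> J c y = J c x"
begin

abbreviation (input) "J0 \<equiv> J c x"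

text \<open>The rotation is constant throughout this chart, so differentiation passes through
  it.\<close>

lemma D_R:
  assumes "\<alpha> \<in> forms A k"
  shows "D (R t \<alpha>) c x v us = D \<alpha> c x v (map (rot J0 t) us)"
proof (rule D_eqI)
  have S: "snd c x \<in> snd c ` fst c" using c by simp
  show "((\<lambda>y. R t \<alpha> c (chart_inv c y) us) has_derivative
      (\<lambda>v. D \<alpha> c x v (map (rot J0 t) us))) (at (snd c x))"
  proof (rule has_derivative_transform_within_open[OF has_derivative_form[OF assms c] open_image[OF c(1)] S])
    fix y assume "y \<in> snd c ` fst c"
    then have "J c (chart_inv c y) = J0" using c chart_inv_mem by (intro flat) blast
    then show "\<alpha> c (chart_inv c y) (map (rot J0 t) us) = R t \<alpha> c (chart_inv c y) us"
      by (simp only: R_apply)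
  qed
qed

lemma d_R_flat:
  assumes "\<alpha> \<in> forms A k"
  shows "d (R t \<alpha>) c x vs = altsum (\<lambda>v us. D \<alpha> c x v (map (rot J0 t) us)) vs"
proof -
  have "D (R t \<alpha>) c x = (\<lambda>v us. D \<alpha> c x v (map (rot J0 t) us))"
    by (intro ext D_R[OF assms])
  then show ?thesis by (simp only: ext_d_altsum[OF c])
qed

lemma rot_rot_J0: "rot J0 s (rot J0 t v) = rot J0 (s + t) v"
  by (rule rot_rot[OF linear_J[OF c] J_J[OF c]])

text \<open>Conjugation by \<open>J\<close> rotates the direction of differentiation as well as the
  other arguments, but on the latter the two rotations cancel. Only the direction changes, from
  \<open>v\<close> to its image \<open>- J0 v\<close> under the inverse.\<close>

lemma dc_flat:
  assumes "\<alpha> \<in> forms A k"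
  shows "dc \<alpha> c x vs = altsum (\<lambda>v us. D \<alpha> c x (- J0 v) us) vs"
proof -
  have "dc \<alpha> c x vs = d (R (pi / 2) \<alpha>) c x (map (rot J0 (- (pi / 2))) vs)"
    by (simp only: dc_eq[OF assms] R_apply)
  also have "\<dots> = altsum (\<lambda>v us. D \<alpha> c x (rot J0 (- (pi / 2)) v)
      (map (rot J0 (pi / 2)) (map (rot J0 (- (pi / 2))) us))) vs"
    by (simp only: d_R_flat[OF assms] altsum_map)
  also have "\<dots> = altsum (\<lambda>v us. D \<alpha> c x (- J0 v) us) vs"
    by (simp add: o_def rot_rot_J0 rot_0) (simp add: rot_minus_pi_half)
  finally show ?thesis .
qed

lemma d_R_eq_flat:
  assumes "\<alpha> \<in> forms A k"
  shows "d (R t \<alpha>) c x vs =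
    R t (fscale (complex_of_real (cos t)) (d \<alpha>) + fscale (complex_of_real (sin t)) (dc \<alpha>)) c x vs"
proof -
  \<comment> \<open>Rotating back by \<open>- t\<close> recovers \<open>v\<close>; expanding the
    direction of \<open>D\<close> linearly along this combination produces the terms with
    \<open>cos t\<close> and \<open>sin t\<close>.\<close>
  have vec: "cos t *\<^sub>R rot J0 t v + sin t *\<^sub>R - J0 (rot J0 t v) = v" for v
  proof -
    have "cos t *\<^sub>R w + sin t *\<^sub>R - J0 w = rot J0 (- t) w" for w by (simp add: rot_def)
    then show ?thesis by (simp add: rot_rot_J0 rot_0)
  qed
  have "R t (fscale (complex_of_real (cos t)) (d \<alpha>) + fscale (complex_of_real (sin t)) (dc \<alpha>)) c x vs =
      complex_of_real (cos t) * altsum (D \<alpha> c x) (map (rot J0 t) vs) +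
      complex_of_real (sin t) * altsum (\<lambda>v us. D \<alpha> c x (- J0 v) us) (map (rot J0 t) vs)"
    by (simp add: R_apply dc_flat[OF assms] ext_d_altsum[OF c])
  also have "\<dots> = altsum (\<lambda>v us. complex_of_real (cos t) * D \<alpha> c x (rot J0 t v) (map (rot J0 t) us) +
      complex_of_real (sin t) * D \<alpha> c x (- J0 (rot J0 t v)) (map (rot J0 t) us)) vs"
    by (simp only: altsum_map altsum_add altsum_cmult)
  also have "\<dots> = altsum (\<lambda>v us. D \<alpha> c x v (map (rot J0 t) us)) vs"
  proof (rule arg_cong[where f = "\<lambda>F. altsum F vs"], intro ext)
    fix v us
    let ?f = "\<lambda>w. D \<alpha> c x w (map (rot J0 t) us)"
    have "?f v = ?f (cos t *\<^sub>R rot J0 t v + sin t *\<^sub>R - J0 (rot J0 t v))" by (simp only: vec)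
    also have "\<dots> = complex_of_real (cos t) * ?f (rot J0 t v) + complex_of_real (sin t) * ?f (- J0 (rot J0 t v))"
      unfolding linear_add[OF linear_D[OF assms c]] linear_scale[OF linear_D[OF assms c]]
      by (simp only: scaleR_conv_of_real)
    finally show "complex_of_real (cos t) * ?f (rot J0 t v) +
      complex_of_real (sin t) * ?f (- J0 (rot J0 t v)) = ?f v" ..
  qed
  finally show ?thesis by (simp only: d_R_flat[OF assms])
qed

text \<open>Both composites differentiate \<alpha> twice, once along a vector turned by
  \<open>- J0\<close>: the inner direction in \<open>d dc\<close>, the outer one in
  \<open>dc d\<close>. As second derivatives commute, the sum has a symmetric kernel and
  \<open>altsum_twice\<close> applies.\<close>

lemma anti_d_flat:
  assumes "\<alpha> \<in> forms A k"
  shows "d (dc \<alpha>) c x vs + dc (d \<alpha>) c x vs = 0"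
proof -
  define P where "P v u ws = frechet_derivative (\<lambda>y. D \<alpha> c (chart_inv c y) u ws) (at (snd c x)) v"
    for v u ws
  have S: "snd c x \<in> snd c ` fst c" using c by simp
  have "D (dc \<alpha>) c x v us = altsum (\<lambda>u ws. P v (- J0 u) ws) us" for v us
  proof (rule D_eqI)
    have "((\<lambda>y. altsum (\<lambda>u ws. D \<alpha> c (chart_inv c y) (- J0 u) ws) us) has_derivative
        (\<lambda>v. altsum (\<lambda>u ws. P v (- J0 u) ws) us)) (at (snd c x))"
      unfolding P_def
      by (rule has_derivative_altsum) (rule smooth_on_has_derivative[OF smooth_D[OF assms c(1)] S])
    then show "((\<lambda>y. dc \<alpha> c (chart_inv c y) us) has_derivative
        (\<lambda>v. altsum (\<lambda>u ws. P v (- J0 u) ws) us)) (at (snd c x))"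
    proof (rule has_derivative_transform_within_open[OF _ open_image[OF c(1)] S])
      fix y assume "y \<in> snd c ` fst c"
      then have y: "chart_inv c y \<in> fst c" using chart_inv_mem c by blast
      have "J c z = J c (chart_inv c y)" if "z \<in> fst c" for z
        using flat[OF that] flat[OF y] by simp
      \<comment> \<open>Differentiating \<open>dc \<alpha>\<close> needs its formula at all points
        near \<open>x\<close>, so \<open>dc_flat\<close> is invoked at the varying point of the same
        chart.\<close>
      from complex_structure.dc_flat[OF complex_structure_axioms c(1) y this assms]
      show "altsum (\<lambda>u ws. D \<alpha> c (chart_inv c y) (- J0 u) ws) us = dc \<alpha> c (chart_inv c y) us"
        by (simp only: flat[OF y])
    qed
  qed
  then have 1: "D (dc \<alpha>) c x = (\<lambda>v us. altsum (\<lambda>u ws. P v (- J0 u) ws) us)" by (intro ext)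
  have 2: "D (d \<alpha>) c x v us = altsum (P v) us" for v us
    unfolding P_def by (rule D_ext_d[OF assms c])
  have "d (dc \<alpha>) c x vs + dc (d \<alpha>) c x vs =
      altsum (\<lambda>v us. altsum (\<lambda>u ws. P v (- J0 u) ws + P (- J0 v) u ws) us) vs"
    by (simp only: ext_d_altsum[OF c] 1 dc_flat[OF ext_d_forms[OF assms]] 2 altsum_add)
  also have "\<dots> = 0"
  proof (rule altsum_twice)
    fix u v us
    have "P u (- J0 v) us = P (- J0 v) u us" "P (- J0 u) v us = P v (- J0 u) us"
      unfolding P_def by (rule D_D_commute[OF assms c])+
    then show "P u (- J0 v) us + P (- J0 u) v us = P v (- J0 u) us + P (- J0 v) u us" by simp
  qed
  finally show ?thesis .
qed

end

lemma d_R: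
  assumes "\<alpha> \<in> forms A k"
  shows "d (R t \<alpha>) =
    R t (fscale (complex_of_real (cos t)) (d \<alpha>) + fscale (complex_of_real (sin t)) (dc \<alpha>))"
proof (rule forms_eqI_cover[where k = "k + 1" and l = "k + 1"])
  show "\<exists>c\<in>A. x \<in> fst c \<and> (\<forall>vs. d (R t \<alpha>) c x vs =
      R t (fscale (complex_of_real (cos t)) (d \<alpha>) + fscale (complex_of_real (sin t)) (dc \<alpha>)) c x vs)"
    if "x \<in> (\<Union>c\<in>A. fst c)" for x
    using flat_chart[OF that] d_R_eq_flat[OF _ _ _ assms] by metis
qed (intro R_forms add_forms fscale_forms ext_d_forms dc_forms[OF _ refl] assms)+

lemma d_dc_anticommute:
  assumes "\<alpha> \<in> forms A k" shows "d (dc \<alpha>) + dc (d \<alpha>) = 0"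
proof (rule forms_eqI_cover[where k = "k + 1 + 1" and l = k])
  show "\<exists>c\<in>A. x \<in> fst c \<and> (\<forall>vs. (d (dc \<alpha>) + dc (d \<alpha>)) c x vs = 0 c x vs)"
    if x: "x \<in> (\<Union>c\<in>A. fst c)" for x
  proof -
    obtain c where c: "c \<in> A" "x \<in> fst c" and flat: "\<forall>y\<in>fst c. J c y = J c x"
      using flat_chart[OF x] by metis
    have "d (dc \<alpha>) c x vs + dc (d \<alpha>) c x vs = 0" for vs
      by (rule anti_d_flat[OF c _ assms]) (rule bspec[OF flat])
    then show ?thesis using c by (intro bexI[of _ c]) simp_all
  qed
qed (intro zero_forms add_forms ext_d_forms dc_forms[OF _ refl] assms)+

lemma d_dc: "\<alpha> \<in> forms A k \<Longrightarrow> d (dc \<alpha>) = - dc (d \<alpha>)"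
  using d_dc_anticommute by (simp add: eq_neg_iff_add_eq_0)

text \<open>Since \<open>dc\<close> is \<open>d\<close> conjugated by a quarter turn, this is
  \<open>d_R\<close> at the angle \<open>pi / 2 + t\<close>, rotated back by \<open>pi / 2\<close>;
  the shift turns cosine and sine into \<open>- sin t\<close> and \<open>cos t\<close>.\<close>

lemma dc_R:
  assumes "\<alpha> \<in> forms A k"
  shows "dc (R t \<alpha>) =
    R t (fscale (complex_of_real (- sin t)) (d \<alpha>) + fscale (complex_of_real (cos t)) (dc \<alpha>))"
proof -
  let ?\<beta> = "fscale (complex_of_real (- sin t)) (d \<alpha>) + fscale (complex_of_real (cos t)) (dc \<alpha>)"
  have \<beta>: "?\<beta> \<in> forms A (k + 1)"
    by (intro add_forms fscale_forms ext_d_forms dc_forms[OF _ refl] assms)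
  have "dc (R t \<alpha>) = R (- (pi / 2)) (d (R (pi / 2 + t) \<alpha>))"
    by (simp only: dc_eq[OF R_forms[OF assms]] R_R[OF assms])
  also have "\<dots> = R (- (pi / 2)) (R (pi / 2 + t) ?\<beta>)"
    by (simp only: d_R[OF assms]) (simp add: cos_add sin_add)
  also have "\<dots> = R t ?\<beta>"
    by (simp only: R_R[OF \<beta>]) simp
  finally show ?thesis .
qed

subsection \<open>The Dolbeault operators\<close>

text \<open>\<open>J\<close> multiplies forms of type (p, q) by the power \<open>p - q\<close> of
  \<open>\<i>\<close>, so \<open>dc\<close> is \<open>- \<i>\<close> times the (1,0)-part of
  \<open>d\<close> plus \<open>\<i>\<close> times its (0,1)-part. Solving for the two parts gives
  this formula and that of \<open>delbar\<close>.\<close>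

definition del :: "('a, 'b) form \<Rightarrow> ('a, 'b) form" where
  "del \<alpha> = fscale (1 / 2) (d \<alpha>) + fscale (\<i> / 2) (dc \<alpha>)"

definition delbar :: "('a, 'b) form \<Rightarrow> ('a, 'b) form" where
  "delbar \<alpha> = fscale (1 / 2) (d \<alpha>) + fscale (- \<i> / 2) (dc \<alpha>)"

lemma del_forms: "\<alpha> \<in> forms A l \<Longrightarrow> k = l + 1 \<Longrightarrow> del \<alpha> \<in> forms A k"
  unfolding del_def by (intro add_forms fscale_forms; rule d_forms dc_forms; assumption)

lemma delbar_forms: "\<alpha> \<in> forms A l \<Longrightarrow> k = l + 1 \<Longrightarrow> delbar \<alpha> \<in> forms A k"
  unfolding delbar_def by (intro add_forms fscale_forms; rule d_forms dc_forms; assumption)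

lemma d_eq_del: "d \<alpha> = del \<alpha> + delbar \<alpha>"
  by (simp add: del_def delbar_def fun_eq_iff)

lemma dc_eq_del: "dc \<alpha> = fscale (- \<i>) (del \<alpha>) + fscale \<i> (delbar \<alpha>)"
  by (simp add: del_def delbar_def fun_eq_iff algebra_simps)

lemma del_fscale: "\<alpha> \<in> forms A k \<Longrightarrow> del (fscale z \<alpha>) = fscale z (del \<alpha>)"
  and delbar_fscale: "\<alpha> \<in> forms A k \<Longrightarrow> delbar (fscale z \<alpha>) = fscale z (delbar \<alpha>)"
  unfolding del_def delbar_def
  by (simp_all add: ext_d_fscale dc_fscale fscale.scale_right_distrib fscale.scale_right_diff_distrib
      mult.commute)

lemma del_sum: "(\<And>i. i \<in> I \<Longrightarrow> f i \<in> forms A k) \<Longrightarrow> del (\<Sum>i\<in>I. f i) = (\<Sum>i\<in>I. del (f i))"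
  and delbar_sum: "(\<And>i. i \<in> I \<Longrightarrow> f i \<in> forms A k) \<Longrightarrow> delbar (\<Sum>i\<in>I. f i) = (\<Sum>i\<in>I. delbar (f i))"
  unfolding del_def delbar_def
  by (simp_all add: d_sum[where k = k] dc_sum[where k = k] sum.distrib sum_negf sum_subtractf fscale.scale_sum_right)

lemma del_0: "del 0 = 0"
  and delbar_0: "delbar 0 = 0"
  by (simp_all add: del_def delbar_def d_0 dc_0)

text \<open>The pair \<open>d\<close>, \<open>dc\<close> is mixed by a plane rotation, which
  \<open>d + \<i> dc\<close> and \<open>d - \<i> dc\<close> diagonalise. The phases say that
  \<open>del\<close> raises the weight \<open>p - q\<close> by one and \<open>delbar\<close> lowers
  it by one.\<close>

lemma del_R:
  assumes "\<alpha> \<in> forms A k" shows "R t (del \<alpha>) = fscale (cis t) (del (R t \<alpha>))"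
  and "R t (delbar \<alpha>) = fscale (cis (- t)) (delbar (R t \<alpha>))"
proof -
  have *: "complex_of_real (cos t) * complex_of_real (cos t) =
      1 - complex_of_real (sin t) * complex_of_real (sin t)"
  proof -
    have "cos t * cos t = 1 - sin t * sin t"
      using sin_cos_squared_add3[of t] by linarith
    from arg_cong[where f = complex_of_real, OF this] show ?thesis
      by (simp only: of_real_mult of_real_diff of_real_1)
  qed
  have cis: "cis t = complex_of_real (cos t) + \<i> * complex_of_real (sin t)" for t
    by (simp add: complex_eq_iff)
  \<comment> \<open>\<open>C\<close> and \<open>S\<close> stand for cosine and sine,
    \<open>a\<close> and \<open>b\<close> for half the rotated values of \<open>d\<close> and
    \<open>dc\<close>; the product collapses through \<open>C * C + S * S = 1\<close>.\<close>
  have del: "a + \<i> * b = (C + \<i> * S) * ((C * a + S * b) + \<i> * (- S * a + C * b))"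
    and delbar: "a - \<i> * b = (C - \<i> * S) * ((C * a + S * b) - \<i> * (- S * a + C * b))"
    if "C * C = 1 - S * S" for a b C S
  proof -
    have "(C + \<i> * S) * ((C * a + S * b) + \<i> * (- S * a + C * b)) = (C * C + S * S) * (a + \<i> * b)"
      "(C - \<i> * S) * ((C * a + S * b) - \<i> * (- S * a + C * b)) = (C * C + S * S) * (a - \<i> * b)"
      by (simp_all add: algebra_simps)
    then show "a + \<i> * b = (C + \<i> * S) * ((C * a + S * b) + \<i> * (- S * a + C * b))"
      "a - \<i> * b = (C - \<i> * S) * ((C * a + S * b) - \<i> * (- S * a + C * b))"
      by (simp_all add: that)
  qed
  show "R t (del \<alpha>) = fscale (cis t) (del (R t \<alpha>))"
    unfolding del_def d_R[OF assms] dc_R[OF assms] R_add R_fscale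
  proof (intro ext)
    fix c x vs
    from del[OF *, of "R t (d \<alpha>) c x vs / 2" "R t (dc \<alpha>) c x vs / 2"]
    show "(fscale (1 / 2) (R t (d \<alpha>)) + fscale (\<i> / 2) (R t (dc \<alpha>))) c x vs = fscale (cis t)
        (fscale (1 / 2) (fscale (complex_of_real (cos t)) (R t (d \<alpha>)) + fscale (complex_of_real (sin t)) (R t (dc \<alpha>))) +
         fscale (\<i> / 2) (fscale (complex_of_real (- sin t)) (R t (d \<alpha>)) + fscale (complex_of_real (cos t)) (R t (dc \<alpha>)))) c x vs"
      by (simp add: cis algebra_simps add_divide_distrib diff_divide_distrib)
  qed
  show "R t (delbar \<alpha>) = fscale (cis (- t)) (delbar (R t \<alpha>))"
    unfolding delbar_def d_R[OF assms] dc_R[OF assms] R_add R_fscale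
  proof (intro ext)
    fix c x vs
    from delbar[OF *, of "R t (d \<alpha>) c x vs / 2" "R t (dc \<alpha>) c x vs / 2"]
    show "(fscale (1 / 2) (R t (d \<alpha>)) + fscale (- \<i> / 2) (R t (dc \<alpha>))) c x vs = fscale (cis (- t))
        (fscale (1 / 2) (fscale (complex_of_real (cos t)) (R t (d \<alpha>)) + fscale (complex_of_real (sin t)) (R t (dc \<alpha>))) +
         fscale (- \<i> / 2) (fscale (complex_of_real (- sin t)) (R t (d \<alpha>)) + fscale (complex_of_real (cos t)) (R t (dc \<alpha>)))) c x vs"
      by (simp add: cis algebra_simps add_divide_distrib diff_divide_distrib)
  qed
qed

section \<open>The Dolbeault operators and the components of forms\<close>

lemma del_forms_pq:
  assumes "\<alpha> \<in> forms_pq A J p q"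
  shows "del \<alpha> \<in> forms_pq A J (p + 1) q"
proof (rule forms_pq_if_R)
  note \<alpha> = forms_pq_forms[OF assms]
  show "del \<alpha> \<in> forms A (p + 1 + q)" by (rule del_forms[OF \<alpha>]) simp
  fix t
  have "t + t * real_of_int (p - q) = t * real_of_int (p + 1 - q)"
    by (simp add: algebra_simps)
  then show "R t (del \<alpha>) = fscale (cis (t * real_of_int (p + 1 - q))) (del \<alpha>)"
    by (simp only: del_R[OF \<alpha>] R_forms_pq[OF assms] del_fscale[OF \<alpha>] fscale.scale_scale cis_mult)
qed

lemma delbar_forms_pq:
  assumes "\<alpha> \<in> forms_pq A J p q"
  shows "delbar \<alpha> \<in> forms_pq A J p (q + 1)"
proof (rule forms_pq_if_R)
  note \<alpha> = forms_pq_forms[OF assms]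
  show "delbar \<alpha> \<in> forms A (p + (q + 1))" by (rule delbar_forms[OF \<alpha>]) simp
  fix t
  have "- t + t * real_of_int (p - q) = t * real_of_int (p - (q + 1))"
    by (simp add: algebra_simps)
  then show "R t (delbar \<alpha>) = fscale (cis (t * real_of_int (p - (q + 1)))) (delbar \<alpha>)"
    by (simp only: del_R[OF \<alpha>] R_forms_pq[OF assms] delbar_fscale[OF \<alpha>] fscale.scale_scale cis_mult)
qed

text \<open>Applying \<open>del\<close> to the type decomposition of \<alpha> yields a decomposition
  of \<open>del \<alpha>\<close> with the first index shifted by one, and uniqueness identifies its
  members with the components.\<close>

lemma part_del:
  assumes \<alpha>: "\<alpha> \<in> forms A k"
  shows "part (k + 1) p (del \<alpha>) = del (part k (p - 1) \<alpha>)"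
proof (rule part_pq_eqI[where f = "\<lambda>p. del (part k (p - 1) \<alpha>)"])
  show "del (part k (r - 1) \<alpha>) \<in> forms_pq A J r (k + 1 - r)" for r
    using del_forms_pq[OF part_pq_forms_pq'[OF \<alpha>, of "r - 1"]] by (simp add: algebra_simps)
  let ?g = "\<lambda>r. del (part k r \<alpha>)"
  have "del \<alpha> = del (\<Sum>r\<in>{0..k}. part k r \<alpha>)" by (simp only: sum_part_pq[OF \<alpha>])
  also have "\<dots> = (\<Sum>r\<in>{0..k}. ?g r)" by (rule del_sum) (rule part_pq_forms[OF \<alpha>])
  \<comment> \<open>The index -1 is added with value zero, so that the shift lands exactly on
    \<open>0..k + 1\<close>.\<close>
  also have "\<dots> = (\<Sum>r\<in>{-1..k}. ?g r)"
    by (rule sum.mono_neutral_left) (auto simp: part_pq_outside[OF \<alpha>] del_0)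
  also have "\<dots> = (\<Sum>r\<in>{0..k + 1}. ?g (r - 1))"
    by (rule sum.reindex_bij_witness[where i = "\<lambda>r. r - 1" and j = "\<lambda>r. r + 1"]) auto
  finally show "del \<alpha> = (\<Sum>r\<in>{0..k + 1}. ?g (r - 1))" .
qed

lemma part_delbar:
  assumes \<alpha>: "\<alpha> \<in> forms A k"
  shows "part (k + 1) p (delbar \<alpha>) = delbar (part k p \<alpha>)"
proof (rule part_pq_eqI[where f = "\<lambda>p. delbar (part k p \<alpha>)"])
  show "delbar (part k r \<alpha>) \<in> forms_pq A J r (k + 1 - r)" for r
    using delbar_forms_pq[OF part_pq_forms_pq'[OF \<alpha>, of r]] by (simp add: algebra_simps)
  let ?g = "\<lambda>r. delbar (part k r \<alpha>)"
  have "delbar \<alpha> = delbar (\<Sum>r\<in>{0..k}. part k r \<alpha>)" by (simp only: sum_part_pq[OF \<alpha>])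
  also have "\<dots> = (\<Sum>r\<in>{0..k}. ?g r)" by (rule delbar_sum) (rule part_pq_forms[OF \<alpha>])
  also have "\<dots> = (\<Sum>r\<in>{0..k + 1}. ?g r)"
    by (rule sum.mono_neutral_left) (auto simp: part_pq_outside[OF \<alpha>] delbar_0)
  finally show "delbar \<alpha> = (\<Sum>r\<in>{0..k + 1}. ?g r)" .
qed

text \<open>\<open>d\<close> and \<open>dc\<close> square to zero and anticommute, so in the
  expansion of \<open>del (delbar \<alpha>)\<close> only the mixed terms survive; each contributes
  \<open>- \<i> / 4\<close> times \<open>d (dc \<alpha>)\<close>.\<close>

lemma ddc_eq_del_delbar:
  assumes \<alpha>: "\<alpha> \<in> forms A k" shows "d (dc \<alpha>) = fscale (2 * \<i>) (del (delbar \<alpha>))"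
proof -
  note d = ext_d_forms[OF \<alpha>] and dc = dc_forms[OF \<alpha> refl]
  have "d (delbar \<alpha>) = fscale (- \<i> / 2) (d (dc \<alpha>))"
    unfolding delbar_def ext_d_add[OF fscale_forms[OF d] fscale_forms[OF dc]]
      ext_d_fscale[OF d] ext_d_fscale[OF dc] ext_d_ext_d[OF \<alpha>] by simp
  moreover have "dc (delbar \<alpha>) = fscale (1 / 2) (dc (d \<alpha>))"
    unfolding delbar_def dc_add[OF fscale_forms[OF d] fscale_forms[OF dc]]
      dc_fscale[OF d] dc_fscale[OF dc] dc_dc[OF \<alpha>] by simp
  moreover have "dc (d \<alpha>) = - d (dc \<alpha>)" using d_dc[OF \<alpha>] by simp
  ultimately show ?thesis
    unfolding del_def by (simp add: fun_eq_iff algebra_simps)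
qed

lemma part_ddc:
  assumes \<alpha>: "\<alpha> \<in> forms A k"
  shows "part (k + 2) p (d (dc \<alpha>)) = d (dc (part k (p - 1) \<alpha>))"
proof -
  note \<beta> = delbar_forms[OF \<alpha> refl]
  have k2: "k + 2 = k + 1 + 1" by simp
  have "part (k + 1 + 1) p (d (dc \<alpha>)) =
      fscale (2 * \<i>) (part (k + 1 + 1) p (del (delbar \<alpha>)))"
    unfolding ddc_eq_del_delbar[OF \<alpha>] by (rule part_pq_fscale[OF del_forms[OF \<beta> refl]])
  also have "\<dots> = d (dc (part k (p - 1) \<alpha>))"
    by (simp only: part_del[OF \<beta>] part_delbar[OF \<alpha>] ddc_eq_del_delbar[OF part_pq_forms[OF \<alpha>]])
  finally show ?thesis unfolding k2 .
qed

text \<open>The component of \<open>d\<beta> + d\<^sup>c\<gamma>\<close> is again of this shape because \<open>d\<close> and \<open>d\<^sup>c\<close> span the same space of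
  operators as \<open>del\<close> and \<open>delbar\<close>.\<close>

lemma part_d_add_dc:
  assumes \<beta>: "\<beta> \<in> forms A (k - 1)" and \<gamma>: "\<gamma> \<in> forms A (k - 1)"
  shows "\<exists>\<beta>'\<in>forms A (k - 1). \<exists>\<gamma>'\<in>forms A (k - 1).
    part k p (d \<beta> + dc \<gamma>) = d \<beta>' + dc \<gamma>'"
proof -
  \<comment> \<open>\<open>d \<beta> + dc \<gamma>\<close> equals \<open>del (\<beta> - \<i>
    \<gamma>) + delbar (\<beta> + \<i> \<gamma>)\<close>. Its component of index \<open>p\<close>
    comes from index \<open>p - 1\<close> under \<open>del\<close> and from index \<open>p\<close>
    under \<open>delbar\<close>.\<close>
  define u where "u = part (k - 1) (p - 1) (\<beta> + fscale (- \<i>) \<gamma>)"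
  define v where "v = part (k - 1) p (\<beta> + fscale \<i> \<gamma>)"
  have uv: "u \<in> forms A (k - 1)" "v \<in> forms A (k - 1)"
    unfolding u_def v_def by (intro part_pq_forms add_forms fscale_forms \<beta> \<gamma>)+
  have sum: "\<beta> + fscale z \<gamma> \<in> forms A (k - 1)" for z by (intro add_forms fscale_forms \<beta> \<gamma>)
  have lin: "d (\<beta> + fscale z \<gamma>) = d \<beta> + fscale z (d \<gamma>)" "dc (\<beta> + fscale z \<gamma>) = dc \<beta> + fscale z (dc \<gamma>)" for z
    by (simp_all only: ext_d_add[OF \<beta> fscale_forms[OF \<gamma>]] ext_d_fscale[OF \<gamma>]
        dc_add[OF \<beta> fscale_forms[OF \<gamma>]] dc_fscale[OF \<gamma>])
  have "d \<beta> + dc \<gamma> = del (\<beta> + fscale (- \<i>) \<gamma>) + delbar (\<beta> + fscale \<i> \<gamma>)"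
    unfolding del_def delbar_def lin by (simp add: fun_eq_iff algebra_simps)
  moreover have "part (k - 1 + 1) p (del (\<beta> + fscale (- \<i>) \<gamma>) + delbar (\<beta> + fscale \<i> \<gamma>)) =
      del u + delbar v"
    unfolding u_def v_def part_del[OF sum, symmetric] part_delbar[OF sum, symmetric]
    by (rule part_pq_add[OF del_forms[OF sum refl] delbar_forms[OF sum refl]])
  \<comment> \<open>Collecting the coefficients of \<open>d\<close> and \<open>dc\<close> in the
    definitions of \<open>del\<close> and \<open>delbar\<close> provides the two witnesses.\<close>
  moreover have "del u + delbar v = d (fscale (1 / 2) (u + v)) + dc (fscale (\<i> / 2) (u + fscale (-1) v))"
    unfolding del_def delbar_def
      ext_d_fscale[OF add_forms[OF uv]] ext_d_add[OF uv]
      dc_fscale[OF add_forms[OF uv(1) fscale_forms[OF uv(2)]]] dc_add[OF uv(1) fscale_forms[OF uv(2)]]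
      dc_fscale[OF uv(2)]
    by (simp add: fun_eq_iff algebra_simps)
  ultimately have "part k p (d \<beta> + dc \<gamma>) =
      d (fscale (1 / 2) (u + v)) + dc (fscale (\<i> / 2) (u + fscale (-1) v))"
    by simp
  moreover have "fscale (1 / 2) (u + v) \<in> forms A (k - 1)"
    "fscale (\<i> / 2) (u + fscale (-1) v) \<in> forms A (k - 1)"
    by (intro fscale_forms add_forms uv)+
  ultimately show ?thesis by blast
qed

text \<open>\<open>d\<close> mixes adjacent components, but \<open>del\<close> and
  \<open>delbar\<close> each send a component to a single component; so both vanish on every
  component as soon as they vanish on \<alpha>.\<close>

lemma part_closed:
  assumes \<alpha>: "\<alpha> \<in> forms A k" and "d \<alpha> = 0" "dc \<alpha> = 0"
  shows "d (part k p \<alpha>) = 0" "dc (part k p \<alpha>) = 0"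
proof -
  have del: "del \<alpha> = 0" "delbar \<alpha> = 0" by (simp_all add: del_def delbar_def assms)
  have "del (part k p \<alpha>) = 0"
    using part_del[OF \<alpha>, of "p + 1"] part_pq_0[where k = "k + 1" and p = "p + 1"] by (simp add: del)
  moreover have "delbar (part k p \<alpha>) = 0"
    using part_delbar[OF \<alpha>, of p] part_pq_0[where k = "k + 1" and p = p] by (simp add: del)
  ultimately show "d (part k p \<alpha>) = 0" "dc (part k p \<alpha>) = 0"
    unfolding d_eq_del dc_eq_del by simp_all
qed

end

section \<open>Quotients of spaces of forms\<close>

text \<open>Linearity is relative to \<open>S\<close> because \<open>ext_d\<close> is defined on
  arbitrary families, while additivity of \<open>frechet_derivative\<close> requires
  differentiability.\<close>

definition lin_on :: "('a, 'e) form set \<Rightarrow> (('a, 'e) form \<Rightarrow> ('b, 'f) form) \<Rightarrow> bool" where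
  "lin_on S f \<longleftrightarrow> (\<forall>\<alpha>\<in>S. \<forall>\<beta>\<in>S. f (\<alpha> + \<beta>) = f \<alpha> + f \<beta>) \<and> (\<forall>z. \<forall>\<alpha>\<in>S. f (fscale z \<alpha>) = fscale z (f \<alpha>))"

lemma lin_on_subset: "lin_on S f \<Longrightarrow> T \<subseteq> S \<Longrightarrow> lin_on T f"
  unfolding lin_on_def by blast

lemma lin_on_id: "lin_on S id"
  by (simp add: lin_on_def)

lemma subspace_image:
  assumes "fscale.subspace S" "lin_on S f" shows "fscale.subspace (f ` S)"
proof (rule fscale.subspaceI)
  have "f (fscale 0 0) = fscale 0 (f 0)"
    using assms fscale.subspace_0 unfolding lin_on_def by blast
  then have "f 0 = 0" by simp
  then show "0 \<in> f ` S" using fscale.subspace_0[OF assms(1)] by force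
next
  fix x y assume "x \<in> f ` S" "y \<in> f ` S"
  then obtain \<alpha> \<beta> where "\<alpha> \<in> S" "\<beta> \<in> S" "x = f \<alpha>" "y = f \<beta>" by blast
  then have "x + y = f (\<alpha> + \<beta>)" "\<alpha> + \<beta> \<in> S"
    using assms fscale.subspace_add[OF assms(1)] unfolding lin_on_def by simp_all
  then show "x + y \<in> f ` S" by (rule image_eqI)
next
  fix z x assume "x \<in> f ` S"
  then obtain \<alpha> where "\<alpha> \<in> S" "x = f \<alpha>" by blast
  then have "fscale z x = f (fscale z \<alpha>)" "fscale z \<alpha> \<in> S"
    using assms fscale.subspace_scale[OF assms(1)] unfolding lin_on_def by simp_all
  then show "fscale z x \<in> f ` S" by (rule image_eqI)
qed

lemma subspace_kernel:
  assumes "fscale.subspace S" "lin_on S f" shows "fscale.subspace {\<alpha> \<in> S. f \<alpha> = 0}"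
proof (rule fscale.subspaceI)
  have "f (fscale 0 0) = fscale 0 (f 0)"
    using assms fscale.subspace_0 unfolding lin_on_def by blast
  then show "0 \<in> {\<alpha> \<in> S. f \<alpha> = 0}" using fscale.subspace_0[OF assms(1)] by simp
next
  fix x y assume "x \<in> {\<alpha> \<in> S. f \<alpha> = 0}" "y \<in> {\<alpha> \<in> S. f \<alpha> = 0}"
  then show "x + y \<in> {\<alpha> \<in> S. f \<alpha> = 0}"
    using assms fscale.subspace_add[OF assms(1)] unfolding lin_on_def by simp
next
  fix z x assume "x \<in> {\<alpha> \<in> S. f \<alpha> = 0}"
  then show "fscale z x \<in> {\<alpha> \<in> S. f \<alpha> = 0}"
    using assms fscale.subspace_scale[OF assms(1)] unfolding lin_on_def by simp
qed

lemma form_module_simps [simp]: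
  "carrier (form_module Z) = Z" "\<alpha> \<oplus>\<^bsub>form_module Z\<^esub> \<beta> = \<alpha> + \<beta>"
  "z \<odot>\<^bsub>form_module Z\<^esub> \<alpha> = fscale z \<alpha>" "\<zero>\<^bsub>form_module Z\<^esub> = 0"
  by (simp_all add: form_module_def fscale_def)

lemma module_form_subspace: "fscale.subspace Z \<Longrightarrow> Module.module complex_ring (form_module Z)"
  by (rule module_form_module)
    (auto simp: fscale_def[symmetric] fscale.subspace_0 fscale.subspace_add fscale.subspace_scale)

lemma form_pair:
  assumes "fscale.subspace Z" "fscale.subspace N" "N \<subseteq> Z"
  shows "module_pair complex_ring (form_module Z) N"
proof -
  interpret module complex_ring "form_module Z" by (rule module_form_subspace[OF assms(1)])
  have "submodule N complex_ring (form_module Z)"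
    by (rule submoduleI') (use assms in \<open>auto simp: fscale.subspace_0 fscale.subspace_add fscale.subspace_scale\<close>)
  then show ?thesis
    by (simp add: module_pair_def module_pair_axioms_def module_axioms)
qed

lemma form_coset_eq_iff:
  assumes "fscale.subspace Z" "fscale.subspace N" "N \<subseteq> Z" "\<alpha> \<in> Z" "\<beta> \<in> Z"
  shows "N +>\<^bsub>form_module Z\<^esub> \<alpha> = N +>\<^bsub>form_module Z\<^esub> \<beta> \<longleftrightarrow> \<alpha> - \<beta> \<in> N"
proof -
  interpret module_pair complex_ring "form_module Z" N by (rule form_pair[OF assms(1-3)])
  have "(\<exists>n\<in>N. \<alpha> = n + \<beta>) \<longleftrightarrow> \<alpha> - \<beta> \<in> N"
    by (metis add_diff_cancel_right' diff_add_cancel)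
  then show ?thesis using coset_eq_iff[of \<alpha> \<beta>] assms by simp
qed

lemma finsum_form_module:
  assumes "fscale.subspace Z" "finite A" "a \<in> A \<rightarrow> Z"
  shows "(\<Oplus>\<^bsub>form_module Z\<^esub>p\<in>A. a p) = (\<Sum>p\<in>A. a p)"
proof -
  interpret module complex_ring "form_module Z" by (rule module_form_subspace[OF assms(1)])
  show ?thesis
    using assms(2,3) by (induction A rule: finite_induct) (simp_all add: Pi_def)
qed

text \<open>The map \<open>e\<close> places representatives into the carrier of \<open>V\<close>: it
  is the identity when these are forms and \<open>to_C\<close> when the source is Aeppli cohomology,
  whose elements are cosets of cosets.\<close>

lemma (in pair_map) induced_quot_map:
  assumes "\<And>\<alpha>. \<alpha> \<in> Z \<Longrightarrow> e \<alpha> \<in> carrier V" "\<And>\<alpha>. \<alpha> \<in> Z \<Longrightarrow> cl \<alpha> = N +>\<^bsub>V\<^esub> e \<alpha>"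
    and "\<And>\<alpha>. \<alpha> \<in> Z \<Longrightarrow> cl' (h \<alpha>) = K +>\<^bsub>W\<^esub> f (e \<alpha>)"
  shows "induced (quot_module V N) (quot_module W K) Z cl cl' h (quot_map W K f)"
  using assms by (simp add: induced_def complex_linear_quot_map quot_map_coset)

lemma form_map_of_pairs:
  assumes "fscale.subspace Z" "fscale.subspace N" "N \<subseteq> Z"
    and "fscale.subspace Z'" "fscale.subspace N'" "N' \<subseteq> Z'"
    and "lin_on Z f" "\<And>\<alpha>. \<alpha> \<in> Z \<Longrightarrow> f \<alpha> \<in> Z'" "\<And>\<alpha>. \<alpha> \<in> N \<Longrightarrow> f \<alpha> \<in> N'"
  shows "pair_map (form_module Z) N (form_module Z') N' f"
  unfolding pair_map_def pair_map_axioms_def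
  using form_pair[OF assms(1-3)] form_pair[OF assms(4-6)] assms(7-9)
  by (simp add: lin_on_def)

text \<open>Aeppli cohomology is a quotient inside the quotient C; its numerator and denominator are
  obtained as images of subspaces of forms.\<close>

lemma (in module_pair) image_submodule:
  assumes "S \<subseteq> carrier V" "\<zero> \<in> S" "\<And>x y. x \<in> S \<Longrightarrow> y \<in> S \<Longrightarrow> x \<oplus> y \<in> S"
    and "\<And>a x. a \<in> carrier R \<Longrightarrow> x \<in> S \<Longrightarrow> a \<odot> x \<in> S"
  shows "submodule ((\<lambda>x. N +> x) ` S) R (quot_module V N)"
proof -
  interpret Q: module R "quot_module V N" by (rule module_quot)
  show ?thesis
  proof (rule Q.submoduleI')
    show "\<zero>\<^bsub>quot_module V N\<^esub> \<in> (\<lambda>x. N +> x) ` S"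
      using assms(1,2) a_coset_join2[OF _ a_subgroup, of \<zero>] by (intro image_eqI[of _ _ \<zero>]) (auto simp: quot_zero)
  next
    fix X Y assume "X \<in> (\<lambda>x. N +> x) ` S" "Y \<in> (\<lambda>x. N +> x) ` S"
    then obtain x y where xy: "x \<in> S" "y \<in> S" "X = N +> x" "Y = N +> y" by blast
    then have "X \<oplus>\<^bsub>quot_module V N\<^esub> Y = N +> (x \<oplus> y)"
      using assms(1) by (auto intro!: quot_add)
    then show "X \<oplus>\<^bsub>quot_module V N\<^esub> Y \<in> (\<lambda>x. N +> x) ` S"
      using assms(3) xy by blast
  next
    fix a X assume a: "a \<in> carrier R" and "X \<in> (\<lambda>x. N +> x) ` S"
    then obtain x where x: "x \<in> S" "X = N +> x" by blast
    then have "a \<odot>\<^bsub>quot_module V N\<^esub> X = N +> (a \<odot> x)"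
      using assms(1) a by (auto intro!: quot_smult)
    then show "a \<odot>\<^bsub>quot_module V N\<^esub> X \<in> (\<lambda>x. N +> x) ` S"
      using assms(4) a x by blast
  qed (use assms(1) in \<open>auto simp: carrier_quot\<close>)
qed

lemma restricted_pair:
  fixes Q :: "('r, 'm) module"
  assumes Q: "Module.module R Q" and K: "submodule K R Q" and T: "submodule T R Q" "T \<subseteq> K"
  shows "module_pair R (Q\<lparr>carrier := K\<rparr>) T"
proof -
  have m: "Module.module R (Q\<lparr>carrier := K\<rparr>)" by (rule submodule.submodule_is_module[OF K Q])
  interpret module R "Q\<lparr>carrier := K\<rparr>" by (rule m)
  have "subgroup T (add_monoid Q)" using T(1) by (simp add: submodule_def)
  then have "submodule T R (Q\<lparr>carrier := K\<rparr>)"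
    using T(2) submodule.smult_closed[OF T(1)] subgroup.one_closed[of T "add_monoid Q"]
      subgroup.m_closed[of T "add_monoid Q"]
    by (intro submoduleI') auto
  then show ?thesis using m by (simp add: module_pair_def module_pair_axioms_def)
qed

lemma a_r_coset_carrier_update: "a_r_coset (Q\<lparr>carrier := K\<rparr>) = a_r_coset Q"
  by (simp add: a_r_coset_def r_coset_def fun_eq_iff)

section \<open>Cohomologies of almost complex manifolds\<close>

context almost_complex
begin

lemma lin_on_d: "lin_on (forms A k) d"
  by (simp add: lin_on_def ext_d_add ext_d_fscale)

lemma lin_on_dc: "lin_on (forms A k) dc"
  by (simp add: lin_on_def dc_add dc_fscale)

lemma lin_on_ddc: "lin_on (forms A k) (dd_c A J)"
  unfolding lin_on_def dd_c_def
  by (auto simp: dc_add dc_fscale ext_d_add[OF dc_forms[OF _ refl] dc_forms[OF _ refl]]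
      ext_d_fscale[OF dc_forms[OF _ refl]])

lemma lin_on_anti_d: "lin_on (forms A k) (anti_d A J)"
  unfolding lin_on_def anti_d_def
  by (auto simp: dc_add dc_fscale ext_d_add[OF dc_forms[OF _ refl] dc_forms[OF _ refl]]
      ext_d_fscale[OF dc_forms[OF _ refl]] ext_d_add ext_d_fscale
      dc_add[OF ext_d_forms ext_d_forms] dc_fscale[OF ext_d_forms] fscale.scale_right_distrib)

lemma ddc_forms: "\<alpha> \<in> forms A l \<Longrightarrow> k = l + 2 \<Longrightarrow> d (dc \<alpha>) \<in> forms A k"
  by (rule d_forms[OF dc_forms[OF _ refl]]) auto

lemma anti_d_forms: "\<alpha> \<in> forms A l \<Longrightarrow> k = l + 2 \<Longrightarrow> anti_d A J \<alpha> \<in> forms A k"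
  unfolding anti_d_def by (rule add_forms[OF ddc_forms dc_forms[OF ext_d_forms]]) auto

lemma subspace_Z_d: "fscale.subspace (Z_d A k)"
  unfolding Z_d_def by (rule subspace_kernel[OF subspace_forms lin_on_d])

lemma subspace_N_d: "fscale.subspace (N_d A k)"
  unfolding N_d_def by (rule subspace_image[OF subspace_forms lin_on_d])

lemma N_d_Z_d: "N_d A k \<subseteq> Z_d A k"
  unfolding N_d_def Z_d_def using ext_d_ext_d d_forms[of _ "k - 1" k] by auto

lemma subspace_Z_dc: "fscale.subspace (Z_dc A J k)"
  unfolding Z_dc_def by (rule subspace_kernel[OF subspace_forms lin_on_dc])

lemma subspace_N_dc: "fscale.subspace (N_dc A J k)"
  unfolding N_dc_def by (rule subspace_image[OF subspace_forms lin_on_dc])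

lemma N_dc_Z_dc: "N_dc A J k \<subseteq> Z_dc A J k"
  unfolding N_dc_def Z_dc_def using dc_dc dc_forms[of _ "k - 1" k] by auto

subsection \<open>The isomorphism of \<open>d\<close>- and \<open>d\<^sup>c\<close>-cohomology\<close>

lemma lin_on_J_act: "lin_on S (J_act J)"
  by (simp add: lin_on_def J_act_add J_act_fscale)

lemma J_act_in_forms: "\<alpha> \<in> forms A k \<Longrightarrow> J_act J \<alpha> \<in> forms A k"
  by (rule J_act_forms[OF tensor_J])

lemma J_act_J_act:
  assumes "\<alpha> \<in> forms A k" shows "J_act J (J_act J \<alpha>) = fscale ((-1) ^ nat k) \<alpha>"
  by (simp add: J_act_R R_R[OF assms] R_pi[OF assms])

lemma J_act_dc:
  assumes "\<alpha> \<in> forms A k" shows "J_act J (dc \<alpha>) = d (J_act J \<alpha>)"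
  unfolding J_act_R dc_eq[OF assms] by (rule R_R_neg[OF ext_d_forms[OF R_forms[OF assms]]])

lemma dc_J_act:
  assumes "\<alpha> \<in> forms A k" shows "dc (J_act J \<alpha>) = fscale ((-1) ^ nat k) (R (- (pi / 2)) (d \<alpha>))"
  unfolding dc_eq[OF J_act_in_forms[OF assms]] J_act_R[symmetric] J_act_J_act[OF assms]
    ext_d_fscale[OF assms] R_fscale ..

lemma J_act_inj: "\<alpha> \<in> forms A k \<Longrightarrow> J_act J \<alpha> = 0 \<Longrightarrow> \<alpha> = 0"
  using R_R_neg[of \<alpha> k "- (pi / 2)"] by (simp add: J_act_R R_0)

lemma J_act_surj:
  assumes "\<alpha> \<in> forms A k"
  shows "R (- (pi / 2)) \<alpha> \<in> forms A k" "J_act J (R (- (pi / 2)) \<alpha>) = \<alpha>"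
  using R_forms[OF assms] R_R_neg[OF assms] by (simp_all add: J_act_R)

lemma J_act_Z_d_iff: "\<alpha> \<in> forms A k \<Longrightarrow> J_act J \<alpha> \<in> Z_dc A J k \<longleftrightarrow> \<alpha> \<in> Z_d A k"
proof -
  assume \<alpha>: "\<alpha> \<in> forms A k"
  have "dc (J_act J \<alpha>) = 0 \<longleftrightarrow> R (- (pi / 2)) (d \<alpha>) = 0"
    unfolding dc_J_act[OF \<alpha>] by (simp add: fscale.scale_eq_0_iff)
  also have "\<dots> \<longleftrightarrow> d \<alpha> = 0"
    using R_R_neg[OF ext_d_forms[OF \<alpha>], of "pi / 2"] R_0 by metis
  finally show ?thesis using \<alpha> J_act_in_forms by (simp add: Z_dc_def Z_d_def)
qed

lemma J_act_Z_dc_iff: "\<alpha> \<in> forms A k \<Longrightarrow> J_act J \<alpha> \<in> Z_d A k \<longleftrightarrow> \<alpha> \<in> Z_dc A J k"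
  using J_act_dc[of \<alpha> k] J_act_inj[OF dc_forms[OF _ refl]] J_act_in_forms
  by (auto simp: Z_d_def Z_dc_def J_act_R R_0)

lemma J_act_N_dc: "J_act J ` N_dc A J k = N_d A k"
proof -
  have "J_act J ` N_dc A J k = d ` J_act J ` forms A (k - 1)"
    unfolding N_dc_def image_image by (intro image_cong refl J_act_dc)
  also have "J_act J ` forms A (k - 1) = forms A (k - 1)"
    using J_act_in_forms J_act_surj by (auto simp: image_iff) metis
  finally show ?thesis unfolding N_d_def .
qed

text \<open>Apply \<open>J\<close> to \<open>J_act_N_dc\<close>: its square on forms is a sign,
  which a subspace absorbs.\<close>

lemma J_act_N_d: "J_act J ` N_d A k = N_dc A J k"
proof -
  have "J_act J ` N_d A k = (\<lambda>\<alpha>. fscale ((-1) ^ nat k) \<alpha>) ` N_dc A J k"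
    unfolding J_act_N_dc[symmetric] image_image
    by (intro image_cong refl J_act_J_act) (use N_dc_Z_dc Z_dc_def in blast)
  also have "\<dots> = N_dc A J k"
  proof
    show "(\<lambda>\<alpha>. fscale ((-1) ^ nat k) \<alpha>) ` N_dc A J k \<subseteq> N_dc A J k"
      using fscale.subspace_scale[OF subspace_N_dc] by blast
    show "N_dc A J k \<subseteq> (\<lambda>\<alpha>. fscale ((-1) ^ nat k) \<alpha>) ` N_dc A J k"
    proof
      fix \<alpha> assume "\<alpha> \<in> N_dc A J k"
      then have "fscale ((-1) ^ nat k) \<alpha> \<in> N_dc A J k" by (rule fscale.subspace_scale[OF subspace_N_dc])
      moreover have "\<alpha> = fscale ((-1) ^ nat k) (fscale ((-1) ^ nat k) \<alpha>)"
        by (simp flip: power_mult_distrib)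
      ultimately show "\<alpha> \<in> (\<lambda>\<alpha>. fscale ((-1) ^ nat k) \<alpha>) ` N_dc A J k" by blast
    qed
  qed
  finally show ?thesis .
qed

lemma J_map: "pair_map (form_module (Z_d A k)) (N_d A k) (form_module (Z_dc A J k)) (N_dc A J k) (J_act J)"
  by (rule form_map_of_pairs[OF subspace_Z_d subspace_N_d N_d_Z_d subspace_Z_dc subspace_N_dc N_dc_Z_dc lin_on_J_act])
    (use J_act_Z_d_iff in \<open>auto simp: Z_d_def J_act_N_d[symmetric]\<close>)

lemma J_map': "pair_map (form_module (Z_dc A J k)) (N_dc A J k) (form_module (Z_d A k)) (N_d A k) (J_act J)"
  by (rule form_map_of_pairs[OF subspace_Z_dc subspace_N_dc N_dc_Z_dc subspace_Z_d subspace_N_d N_d_Z_d lin_on_J_act])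
    (use J_act_Z_dc_iff in \<open>auto simp: Z_dc_def J_act_N_dc[symmetric]\<close>)

lemma J_act_reflect:
  assumes "\<alpha> \<in> forms A k" "J_act J \<alpha> \<in> J_act J ` N" "N \<subseteq> forms A k" shows "\<alpha> \<in> N"
proof -
  obtain \<beta> where \<beta>: "\<beta> \<in> N" "J_act J \<alpha> = J_act J \<beta>" using assms(2) by blast
  then have "R (- (pi / 2)) (R (pi / 2) \<alpha>) = R (- (pi / 2)) (R (pi / 2) \<beta>)" by (simp add: J_act_R)
  then have "\<alpha> = \<beta>" using R_R_neg[of _ k "- (pi / 2)"] \<beta> assms(1,3) by force
  then show ?thesis using \<beta> by simp
qed

text \<open>Covers both directions of the isomorphism: \<open>J\<close> is invertible on forms and
  matches numerators with numerators and denominators with denominators.\<close>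

lemma bij_quot_map_J_act:
  assumes "pair_map (form_module Z) N (form_module Z') N' (J_act J)"
    and "N \<subseteq> Z" "Z \<subseteq> forms A k" "Z' \<subseteq> forms A k"
    and "J_act J ` N = N'" "\<And>\<alpha>. \<alpha> \<in> forms A k \<Longrightarrow> J_act J \<alpha> \<in> Z' \<longleftrightarrow> \<alpha> \<in> Z"
  shows "bij_betw (quot_map (form_module Z') N' (J_act J))
    (carrier (quot_module (form_module Z) N)) (carrier (quot_module (form_module Z') N'))"
  unfolding bij_betw_def
proof
  interpret pair_map "form_module Z" N "form_module Z'" N' "J_act J" by (rule assms(1))
  show "inj_on (quot_map (form_module Z') N' (J_act J)) (carrier (quot_module (form_module Z) N))"
    by (rule inj_on_quot_map, rule J_act_reflect[of _ k]) (use assms(2,3,5) in auto)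
  show "quot_map (form_module Z') N' (J_act J) ` carrier (quot_module (form_module Z) N) =
      carrier (quot_module (form_module Z') N')"
  proof (rule surj_quot_map)
    fix \<beta> assume "\<beta> \<in> carrier (form_module Z')"
    then have \<beta>: "\<beta> \<in> forms A k" "\<beta> \<in> Z'" using assms(4) by auto
    then show "\<exists>\<alpha>\<in>carrier (form_module Z). J_act J \<alpha> = \<beta>"
      using J_act_surj[OF \<beta>(1)] assms(6)[OF J_act_surj(1)[OF \<beta>(1)]] by auto
  qed
qed

lemma bij_J:
  "bij_betw (quot_map (form_module (Z_dc A J k)) (N_dc A J k) (J_act J)) (carrier (H_d A k)) (carrier (H_dc A J k))"
  unfolding H_d_def H_dc_def
  by (rule bij_quot_map_J_act[OF J_map N_d_Z_d _ _ J_act_N_d J_act_Z_d_iff]) (auto simp: Z_d_def Z_dc_def)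

lemma bij_J':
  "bij_betw (quot_map (form_module (Z_d A k)) (N_d A k) (J_act J)) (carrier (H_dc A J k)) (carrier (H_d A k))"
  unfolding H_d_def H_dc_def
  by (rule bij_quot_map_J_act[OF J_map' N_dc_Z_dc _ _ J_act_N_dc J_act_Z_dc_iff]) (auto simp: Z_d_def Z_dc_def)

subsection \<open>Bott-Chern cohomology\<close>

text \<open>A form killed by \<open>d\<close> and \<open>dc\<close> is killed by
  \<open>anti_d\<close>, so membership in B is automatic for representatives; the passage to B
  constrains the potentials in \<open>N_BC\<close>.\<close>

lemma Z_BC_eq: "Z_BC A J k = {\<alpha> \<in> {\<alpha> \<in> forms A k. d \<alpha> = 0}. dc \<alpha> = 0}"
  by (auto simp: Z_BC_def B_forms_def anti_d_def d_0 dc_0)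

lemma subspace_Z_BC: "fscale.subspace (Z_BC A J k)"
  unfolding Z_BC_eq
  by (intro subspace_kernel subspace_forms lin_on_d lin_on_subset[OF lin_on_dc[of k]]) auto

lemma subspace_B_forms: "fscale.subspace (B_forms A J k)"
  unfolding B_forms_def by (rule subspace_kernel[OF subspace_forms lin_on_anti_d])

lemma subspace_N_BC: "fscale.subspace (N_BC A J k)"
  unfolding N_BC_def
  by (intro subspace_image subspace_B_forms lin_on_subset[OF lin_on_ddc[of "k - 2"]]) (auto simp: B_forms_def)

text \<open>On B the two operators anticommute, so \<open>d (dc \<beta>)\<close> is also
  \<open>dc\<close>-exact, with primitive \<open>d (- \<beta>)\<close>. This gives both the
  \<open>dc\<close>-closedness of \<open>N_BC\<close> and the arrow to
  \<open>dc\<close>-cohomology.\<close>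

lemma B_forms_D:
  assumes "\<beta> \<in> B_forms A J k" shows "\<beta> \<in> forms A k" "d (dc \<beta>) = dc (d (fscale (-1) \<beta>))"
proof -
  show \<beta>: "\<beta> \<in> forms A k" using assms by (simp add: B_forms_def)
  have "d (dc \<beta>) + dc (d \<beta>) = 0" using assms by (simp add: B_forms_def anti_d_def)
  then show "d (dc \<beta>) = dc (d (fscale (-1) \<beta>))"
    unfolding ext_d_fscale[OF \<beta>] dc_fscale[OF ext_d_forms[OF \<beta>]] by (simp add: eq_neg_iff_add_eq_0)
qed

lemma N_BC_Z_BC: "N_BC A J k \<subseteq> Z_BC A J k"
proof
  fix \<alpha> assume "\<alpha> \<in> N_BC A J k"
  then obtain \<beta> where \<beta>: "\<beta> \<in> B_forms A J (k - 2)" "\<alpha> = d (dc \<beta>)"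
    by (auto simp: N_BC_def dd_c_def)
  note b = B_forms_D[OF \<beta>(1)]
  have "\<alpha> \<in> forms A k" unfolding \<beta> by (rule ddc_forms[OF b(1)]) simp
  moreover have "d \<alpha> = 0" unfolding \<beta> by (rule ext_d_ext_d[OF dc_forms[OF b(1) refl]])
  moreover have "dc \<alpha> = 0"
    unfolding \<beta> b(2) by (rule dc_dc[OF ext_d_forms[OF fscale_forms[OF b(1)]]])
  ultimately show "\<alpha> \<in> Z_BC A J k" by (simp add: Z_BC_eq)
qed

lemma BC_d_map: "pair_map (form_module (Z_BC A J k)) (N_BC A J k) (form_module (Z_d A k)) (N_d A k) id"
proof (rule form_map_of_pairs[OF subspace_Z_BC subspace_N_BC N_BC_Z_BC subspace_Z_d subspace_N_d N_d_Z_d lin_on_id])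
  fix \<alpha> assume "\<alpha> \<in> N_BC A J k"
  then obtain \<beta> where \<beta>: "\<beta> \<in> B_forms A J (k - 2)" "\<alpha> = d (dc \<beta>)"
    by (auto simp: N_BC_def dd_c_def)
  have "dc \<beta> \<in> forms A (k - 1)" by (rule dc_forms[OF B_forms_D(1)[OF \<beta>(1)]]) simp
  then show "id \<alpha> \<in> N_d A k" using \<beta> by (simp add: N_d_def)
qed (simp add: Z_BC_eq Z_d_def)

lemma BC_dc_map: "pair_map (form_module (Z_BC A J k)) (N_BC A J k) (form_module (Z_dc A J k)) (N_dc A J k) id"
proof (rule form_map_of_pairs[OF subspace_Z_BC subspace_N_BC N_BC_Z_BC subspace_Z_dc subspace_N_dc N_dc_Z_dc lin_on_id])
  fix \<alpha> assume "\<alpha> \<in> N_BC A J k"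
  then obtain \<beta> where \<beta>: "\<beta> \<in> B_forms A J (k - 2)" "\<alpha> = d (dc \<beta>)"
    by (auto simp: N_BC_def dd_c_def)
  have "d (fscale (-1) \<beta>) \<in> forms A (k - 1)"
    by (rule d_forms[OF fscale_forms[OF B_forms_D(1)[OF \<beta>(1)]]]) simp
  then show "id \<alpha> \<in> N_dc A J k" using \<beta> B_forms_D(2)[OF \<beta>(1)] by (simp add: N_dc_def)
qed (simp add: Z_BC_eq Z_dc_def)

subsection \<open>Aeppli cohomology\<close>

abbreviation "anti_im k \<equiv> anti_d A J ` forms A (k - 2)"

lemma subspace_anti_im: "fscale.subspace (anti_im k)"
  by (rule subspace_image[OF subspace_forms lin_on_anti_d])

lemma anti_im_forms: "anti_im k \<subseteq> forms A k"
  using anti_d_forms[of _ "k - 2" k] by auto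

lemma C_pair: "module_pair complex_ring (form_module (forms A k)) (anti_im k)"
  by (rule form_pair[OF subspace_forms subspace_anti_im anti_im_forms])

lemma carrier_C: "carrier (C_forms A J k) = to_C A J k ` forms A k"
  unfolding C_forms_def to_C_def module_pair.carrier_quot[OF C_pair] by simp

lemma to_C_add:
  "\<alpha> \<in> forms A k \<Longrightarrow> \<beta> \<in> forms A k \<Longrightarrow>
    to_C A J k \<alpha> \<oplus>\<^bsub>C_forms A J k\<^esub> to_C A J k \<beta> = to_C A J k (\<alpha> + \<beta>)"
  using module_pair.quot_add[OF C_pair, of \<alpha> k \<beta>] by (simp add: C_forms_def to_C_def)

lemma to_C_fscale:
  "\<alpha> \<in> forms A k \<Longrightarrow> z \<odot>\<^bsub>C_forms A J k\<^esub> to_C A J k \<alpha> = to_C A J k (fscale z \<alpha>)"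
  using module_pair.quot_smult[OF C_pair, of z \<alpha> k] by (simp add: C_forms_def to_C_def)

lemma to_C_eq_iff:
  "\<alpha> \<in> forms A k \<Longrightarrow> \<beta> \<in> forms A k \<Longrightarrow> to_C A J k \<alpha> = to_C A J k \<beta> \<longleftrightarrow> \<alpha> - \<beta> \<in> anti_im k"
  unfolding to_C_def by (rule form_coset_eq_iff[OF subspace_forms subspace_anti_im anti_im_forms])

lemma zero_C: "\<zero>\<^bsub>C_forms A J k\<^esub> = to_C A J k 0"
proof -
  have "anti_im k +>\<^bsub>form_module (forms A k)\<^esub> 0 = anti_im k"
    by (auto simp: a_r_coset_def')
  then show ?thesis by (simp add: C_forms_def to_C_def quot_module_def)
qed

text \<open>Both sides reduce to \<open>d (dc (d \<beta>))\<close>, the other terms containing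
  \<open>d d\<close>. Hence \<open>d\<close> preserves the image of \<open>anti_d\<close> and acts
  on C; \<open>dc_anti_d\<close> is the mirror image.\<close>

lemma d_anti_d:
  assumes "\<beta> \<in> forms A k" shows "d (anti_d A J \<beta>) = anti_d A J (d \<beta>)"
proof -
  note 1 = ext_d_forms[OF assms] and 2 = dc_forms[OF assms refl]
  have "d (anti_d A J \<beta>) = d (dc (d \<beta>))"
    unfolding anti_d_def ext_d_add[OF ext_d_forms[OF 2] dc_forms[OF 1 refl]] ext_d_ext_d[OF 2] by simp
  then show ?thesis unfolding anti_d_def ext_d_ext_d[OF assms] dc_0 by simp
qed

lemma dc_anti_d:
  assumes "\<beta> \<in> forms A k" shows "dc (anti_d A J \<beta>) = anti_d A J (dc \<beta>)"
proof -
  note 1 = ext_d_forms[OF assms] and 2 = dc_forms[OF assms refl]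
  have "dc (anti_d A J \<beta>) = dc (d (dc \<beta>))"
    unfolding anti_d_def dc_add[OF ext_d_forms[OF 2] dc_forms[OF 1 refl]] dc_dc[OF 1] by simp
  then show ?thesis unfolding anti_d_def dc_dc[OF assms] d_0 by simp
qed

lemma quot_map_to_C:
  assumes "lin_on (forms A k) f" "\<And>\<alpha> l. \<alpha> \<in> forms A l \<Longrightarrow> f \<alpha> \<in> forms A (l + 1)"
    and "\<And>\<beta>. \<beta> \<in> forms A (k - 2) \<Longrightarrow> f (anti_d A J \<beta>) = anti_d A J (f \<beta>)" "\<alpha> \<in> forms A k"
  shows "quot_map (form_module (forms A (k + 1))) (anti_im (k + 1)) f (to_C A J k \<alpha>) =
    to_C A J (k + 1) (f \<alpha>)"
proof -
  interpret pair_map "form_module (forms A k)" "anti_im k"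
    "form_module (forms A (k + 1))" "anti_im (k + 1)" f
  proof (rule form_map_of_pairs[OF subspace_forms subspace_anti_im anti_im_forms
        subspace_forms subspace_anti_im anti_im_forms assms(1,2)])
    fix \<alpha> assume "\<alpha> \<in> anti_im k"
    then obtain \<beta> where \<beta>: "\<beta> \<in> forms A (k - 2)" "\<alpha> = anti_d A J \<beta>" by blast
    have "k - 2 + 1 = k + 1 - 2" by simp
    with assms(2)[OF \<beta>(1)] have "f \<beta> \<in> forms A (k + 1 - 2)" by simp
    then show "f \<alpha> \<in> anti_im (k + 1)" unfolding \<beta>(2) assms(3)[OF \<beta>(1)] by (rule imageI)
  qed
  show ?thesis
    using quot_map_coset[of \<alpha>] assms(4) by (simp add: to_C_def)
qed

lemma d_C_to_C: "\<alpha> \<in> forms A k \<Longrightarrow> d_C A J k (to_C A J k \<alpha>) = to_C A J (k + 1) (d \<alpha>)"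
  using quot_map_to_C[OF lin_on_d ext_d_forms d_anti_d, where \<alpha> = \<alpha>] by (simp add: quot_map_def d_C_def to_C_def)

lemma dc_C_to_C: "\<alpha> \<in> forms A k \<Longrightarrow> dc_C A J k (to_C A J k \<alpha>) = to_C A J (k + 1) (dc \<alpha>)"
  using quot_map_to_C[OF lin_on_dc dc_forms[OF _ refl] dc_anti_d, where \<alpha> = \<alpha>]
  by (simp add: quot_map_def dc_C_def to_C_def)

lemma ddc_C_to_C:
  assumes "\<alpha> \<in> forms A k"
  shows "d_C A J (k + 1) (dc_C A J k (to_C A J k \<alpha>)) = to_C A J (k + 2) (d (dc \<alpha>))"
proof -
  have k: "k + 2 = k + 1 + 1" by simp
  show ?thesis unfolding k dc_C_to_C[OF assms] by (rule d_C_to_C[OF dc_forms[OF assms refl]])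
qed

text \<open>Brings the kernel in C down to forms. The class of \<open>d (dc \<alpha>)\<close> lives
  in degree \<open>k + 2\<close>, so the image of \<open>anti_d\<close> to be met starts in degree
  \<open>k\<close>.\<close>

lemma Z_A_eq: "Z_A A J k = {\<alpha> \<in> forms A k. d (dc \<alpha>) \<in> anti_d A J ` forms A k}"
proof -
  have "to_C A J k \<alpha> \<in> ker_ddc_C A J k \<longleftrightarrow> d (dc \<alpha>) \<in> anti_d A J ` forms A k"
    if "\<alpha> \<in> forms A k" for \<alpha>
    using to_C_eq_iff[OF ddc_forms[OF that refl] zero_forms] that
    unfolding ker_ddc_C_def mem_Collect_eq ddc_C_to_C[OF that] zero_C carrier_C by auto
  then show ?thesis unfolding Z_A_def by blast
qed

lemma ker_ddc_C_eq: "ker_ddc_C A J k = to_C A J k ` Z_A A J k"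
  by (auto simp: Z_A_def ker_ddc_C_def carrier_C)

lemma subspace_Z_A: "fscale.subspace (Z_A A J k)"
proof -
  have I: "fscale.subspace (anti_d A J ` forms A k)"
    by (rule subspace_image[OF subspace_forms lin_on_anti_d])
  show ?thesis
  proof (rule fscale.subspaceI)
    show "0 \<in> Z_A A J k" using fscale.subspace_0[OF I] by (simp add: Z_A_eq dc_0 d_0)
    show "\<alpha> + \<beta> \<in> Z_A A J k" if "\<alpha> \<in> Z_A A J k" "\<beta> \<in> Z_A A J k" for \<alpha> \<beta>
    proof -
      have "\<alpha> \<in> forms A k" "\<beta> \<in> forms A k" using that by (auto simp: Z_A_eq)
      then have "d (dc (\<alpha> + \<beta>)) = d (dc \<alpha>) + d (dc \<beta>)"
        using lin_on_ddc[of k] by (simp add: lin_on_def dd_c_def)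
      then show ?thesis using that fscale.subspace_add[OF I] by (auto simp: Z_A_eq simp del: image_iff)
    qed
    show "fscale z \<alpha> \<in> Z_A A J k" if "\<alpha> \<in> Z_A A J k" for z \<alpha>
    proof -
      have "\<alpha> \<in> forms A k" using that by (auto simp: Z_A_eq)
      then have "d (dc (fscale z \<alpha>)) = fscale z (d (dc \<alpha>))"
        using lin_on_ddc[of k] by (simp add: lin_on_def dd_c_def)
      then show ?thesis using that fscale.subspace_scale[OF I] by (auto simp: Z_A_eq simp del: image_iff)
    qed
  qed
qed

text \<open>The denominator of Aeppli cohomology on the level of forms; \<open>N_A\<close> is its
  image in C.\<close>

definition exact_sums :: "int \<Rightarrow> ('a, 'e) form set" where
  "exact_sums k = {d \<beta> + dc \<gamma> | \<beta> \<gamma>. \<beta> \<in> forms A (k - 1) \<and> \<gamma> \<in> forms A (k - 1)}"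

lemma subspace_exact_sums: "fscale.subspace (exact_sums k)"
proof -
  have "exact_sums k = {x + y | x y. x \<in> N_d A k \<and> y \<in> N_dc A J k}"
    unfolding exact_sums_def N_d_def N_dc_def by blast
  then show ?thesis using fscale.subspace_sums[OF subspace_N_d subspace_N_dc] by simp
qed

lemma N_d_exact_sums: "N_d A k \<subseteq> exact_sums k"
proof
  fix \<alpha> assume "\<alpha> \<in> N_d A k"
  then obtain \<beta> where "\<beta> \<in> forms A (k - 1)" "\<alpha> = d \<beta> + dc 0" by (auto simp: N_d_def dc_0)
  then show "\<alpha> \<in> exact_sums k" unfolding exact_sums_def using zero_forms by blast
qed

lemma N_dc_exact_sums: "N_dc A J k \<subseteq> exact_sums k"
proof
  fix \<alpha> assume "\<alpha> \<in> N_dc A J k"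
  then obtain \<gamma> where "\<gamma> \<in> forms A (k - 1)" "\<alpha> = d 0 + dc \<gamma>" by (auto simp: N_dc_def d_0)
  then show "\<alpha> \<in> exact_sums k" unfolding exact_sums_def using zero_forms by blast
qed

text \<open>\<open>d dc\<close> sends \<open>d \<beta> + dc \<gamma>\<close> to
  \<open>d (dc (d \<beta>))\<close>, which is \<open>anti_d\<close> of the \<open>d\<close>-closed
  form \<open>d \<beta>\<close>.\<close>

lemma exact_sums_Z_A: "exact_sums k \<subseteq> Z_A A J k"
proof
  fix \<alpha> assume "\<alpha> \<in> exact_sums k"
  then obtain \<beta> \<gamma> where \<alpha>: "\<beta> \<in> forms A (k - 1)" "\<gamma> \<in> forms A (k - 1)" "\<alpha> = d \<beta> + dc \<gamma>"
    by (auto simp: exact_sums_def)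
  have \<beta>: "d \<beta> \<in> forms A k" by (rule d_forms[OF \<alpha>(1)]) simp
  have \<gamma>: "dc \<gamma> \<in> forms A k" by (rule dc_forms[OF \<alpha>(2)]) simp
  have "d (dc \<alpha>) = anti_d A J (d \<beta>)"
    unfolding \<alpha>(3) dc_add[OF \<beta> \<gamma>] dc_dc[OF \<alpha>(2)] anti_d_def ext_d_ext_d[OF \<alpha>(1)] dc_0 by simp
  then show "\<alpha> \<in> Z_A A J k" using \<alpha>(3) \<beta> \<gamma> by (auto simp: Z_A_eq)
qed

lemma N_A_eq: "N_A A J k = to_C A J k ` exact_sums k"
proof -
  have "d_C A J (k - 1) ` carrier (C_forms A J (k - 1)) = to_C A J k ` d ` forms A (k - 1)"
    unfolding carrier_C image_image using d_C_to_C[where k = "k - 1"] by (intro image_cong) auto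
  moreover have "dc_C A J (k - 1) ` carrier (C_forms A J (k - 1)) = to_C A J k ` dc ` forms A (k - 1)"
    unfolding carrier_C image_image using dc_C_to_C[where k = "k - 1"] by (intro image_cong) auto
  moreover have "to_C A J k (d \<beta>) \<oplus>\<^bsub>C_forms A J k\<^esub> to_C A J k (dc \<gamma>) = to_C A J k (d \<beta> + dc \<gamma>)"
    if "\<beta> \<in> forms A (k - 1)" "\<gamma> \<in> forms A (k - 1)" for \<beta> \<gamma>
    by (rule to_C_add[OF d_forms[OF that(1)] dc_forms[OF that(2)]]) auto
  ultimately show ?thesis
    unfolding N_A_def set_add_def' exact_sums_def by auto
qed

abbreviation "ker_module k \<equiv> (C_forms A J k)\<lparr>carrier := ker_ddc_C A J k\<rparr>"

lemma A_pair: "module_pair complex_ring (ker_module k) (N_A A J k)"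
proof (rule restricted_pair)
  interpret module_pair complex_ring "form_module (forms A k)" "anti_im k" by (rule C_pair)
  show "Module.module complex_ring (C_forms A J k)"
    unfolding C_forms_def by (rule module_quot)
  have "submodule (to_C A J k ` S) complex_ring (C_forms A J k)"
    if S: "fscale.subspace S" "S \<subseteq> forms A k" for S
    unfolding C_forms_def to_C_def
    by (rule image_submodule) (use S in \<open>auto simp: fscale.subspace_0 fscale.subspace_add fscale.subspace_scale\<close>)
  note sub = this
  have Z: "Z_A A J k \<subseteq> forms A k" by (auto simp: Z_A_eq)
  show "submodule (ker_ddc_C A J k) complex_ring (C_forms A J k)"
    unfolding ker_ddc_C_eq by (rule sub[OF subspace_Z_A Z])
  show "submodule (N_A A J k) complex_ring (C_forms A J k)"
    unfolding N_A_eq using exact_sums_Z_A Z by (intro sub[OF subspace_exact_sums]) blast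
  show "N_A A J k \<subseteq> ker_ddc_C A J k"
    unfolding N_A_eq ker_ddc_C_eq using exact_sums_Z_A by blast
qed

text \<open>The arrows from \<open>d\<close>- and \<open>dc\<close>-cohomology are both induced by
  the quotient map to C, so only numerators and denominators remain to be compared.\<close>

lemma to_A_map:
  assumes "fscale.subspace Z" "fscale.subspace N" "N \<subseteq> Z" "Z \<subseteq> Z_A A J k" "N \<subseteq> exact_sums k"
  shows "pair_map (form_module Z) N (ker_module k) (N_A A J k) (to_C A J k)"
  unfolding pair_map_def pair_map_axioms_def
proof (intro conjI allI impI form_pair[OF assms(1-3)] A_pair)
  have Z: "Z \<subseteq> forms A k" using assms(4) by (auto simp: Z_A_eq)
  show "to_C A J k \<alpha> \<in> carrier (ker_module k)" if "\<alpha> \<in> carrier (form_module Z)" for \<alpha>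
    using that assms(4) by (auto simp: ker_ddc_C_eq)
  show "to_C A J k (\<alpha> \<oplus>\<^bsub>form_module Z\<^esub> \<beta>) = to_C A J k \<alpha> \<oplus>\<^bsub>ker_module k\<^esub> to_C A J k \<beta>"
    if "\<alpha> \<in> carrier (form_module Z)" "\<beta> \<in> carrier (form_module Z)" for \<alpha> \<beta>
    using that Z by (simp add: to_C_add subset_iff)
  show "to_C A J k (z \<odot>\<^bsub>form_module Z\<^esub> \<alpha>) = z \<odot>\<^bsub>ker_module k\<^esub> to_C A J k \<alpha>"
    if "\<alpha> \<in> carrier (form_module Z)" for \<alpha> z
    using that Z by (simp add: to_C_fscale subset_iff)
  show "to_C A J k \<alpha> \<in> N_A A J k" if "\<alpha> \<in> N" for \<alpha>
    using that assms(5) by (auto simp: N_A_eq)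
qed

text \<open>For \<open>d\<close>-closed \<alpha> the form \<open>d (dc \<alpha>)\<close> is
  \<open>anti_d A J \<alpha>\<close>, hence zero in C. This is what the passage to C
  achieves.\<close>

lemma Z_d_Z_A: "Z_d A k \<subseteq> Z_A A J k"
proof
  fix \<alpha> assume "\<alpha> \<in> Z_d A k"
  then have "\<alpha> \<in> forms A k" "d (dc \<alpha>) = anti_d A J \<alpha>" by (auto simp: Z_d_def anti_d_def dc_0)
  then show "\<alpha> \<in> Z_A A J k" by (simp add: Z_A_eq)
qed

lemma Z_dc_Z_A: "Z_dc A J k \<subseteq> Z_A A J k"
proof
  fix \<alpha> assume "\<alpha> \<in> Z_dc A J k"
  then have "\<alpha> \<in> forms A k" "d (dc \<alpha>) = anti_d A J 0" by (auto simp: Z_dc_def anti_d_def d_0 dc_0)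
  then show "\<alpha> \<in> Z_A A J k" using zero_forms by (simp only: Z_A_eq) blast
qed

lemma d_A_map: "pair_map (form_module (Z_d A k)) (N_d A k) (ker_module k) (N_A A J k) (to_C A J k)"
  by (rule to_A_map[OF subspace_Z_d subspace_N_d N_d_Z_d Z_d_Z_A N_d_exact_sums])

lemma dc_A_map: "pair_map (form_module (Z_dc A J k)) (N_dc A J k) (ker_module k) (N_A A J k) (to_C A J k)"
  by (rule to_A_map[OF subspace_Z_dc subspace_N_dc N_dc_Z_dc Z_dc_Z_A N_dc_exact_sums])

end

subsection \<open>The diagram\<close>

lemma carrier_form_quot:
  "carrier (quot_module (form_module Z) N) = (\<lambda>\<alpha>. N +>\<^bsub>form_module Z\<^esub> \<alpha>) ` Z"
  by (auto simp: quot_module_def A_RCOSETS_def')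

text \<open>Every class has a representative, and on representatives both sides are
  \<open>f\<close>. It yields the commuting triangles between bigraded and graded groups.\<close>

lemma induced_comp:
  assumes "induced V W Z cl cl' f F" "induced V U Z cl cl'' id G" "induced U W Z' cl'' cl' f H"
    and "Z \<subseteq> Z'" "X \<in> cl ` Z"
  shows "F X = H (G X)"
  using assms unfolding induced_def by auto

context almost_complex
begin

definition bc_d where "bc_d k = quot_map (form_module (Z_d A k)) (N_d A k) id"
definition bc_dc where "bc_dc k = quot_map (form_module (Z_dc A J k)) (N_dc A J k) id"
text \<open>A single function for both arrows into Aeppli cohomology, since \<open>quot_map\<close>
  refers to the target only.\<close>

definition to_A where "to_A k = quot_map (ker_module k) (N_A A J k) (to_C A J k)"
definition j_d where "j_d k = quot_map (form_module (Z_dc A J k)) (N_dc A J k) (J_act J)"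
definition j_dc where "j_dc k = quot_map (form_module (Z_d A k)) (N_d A k) (J_act J)"

lemma induced_bc_d:
  "induced (H_BC A J k) (H_d A k) (Z_BC A J k) (cl_BC A J k) (cl_d A k) id (bc_d k)"
  unfolding H_BC_def H_d_def bc_d_def
  by (rule pair_map.induced_quot_map[OF BC_d_map, where e = id])
    (simp_all add: cl_BC_def cl_d_def)

lemma induced_bc_dc:
  "induced (H_BC A J k) (H_dc A J k) (Z_BC A J k) (cl_BC A J k) (cl_dc A J k) id (bc_dc k)"
  unfolding H_BC_def H_dc_def bc_dc_def
  by (rule pair_map.induced_quot_map[OF BC_dc_map, where e = id])
    (simp_all add: cl_BC_def cl_dc_def)

lemma induced_d_A:
  "induced (H_d A k) (H_A A J k) (Z_d A k) (cl_d A k) (cl_A A J k) id (to_A k)"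
  unfolding H_d_def H_A_def to_A_def
  by (rule pair_map.induced_quot_map[OF d_A_map, where e = id])
    (simp_all add: cl_d_def cl_A_def a_r_coset_carrier_update)

lemma induced_dc_A:
  "induced (H_dc A J k) (H_A A J k) (Z_dc A J k) (cl_dc A J k) (cl_A A J k) id (to_A k)"
  unfolding H_dc_def H_A_def to_A_def
  by (rule pair_map.induced_quot_map[OF dc_A_map, where e = id])
    (simp_all add: cl_dc_def cl_A_def a_r_coset_carrier_update)

lemma induced_j_d:
  "induced (H_d A k) (H_dc A J k) (Z_d A k) (cl_d A k) (cl_dc A J k) (J_act J) (j_d k)"
  unfolding H_d_def H_dc_def j_d_def
  by (rule pair_map.induced_quot_map[OF J_map, where e = id])
    (simp_all add: cl_d_def cl_dc_def)

lemma induced_j_dc: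
  "induced (H_dc A J k) (H_d A k) (Z_dc A J k) (cl_dc A J k) (cl_d A k) (J_act J) (j_dc k)"
  unfolding H_d_def H_dc_def j_dc_def
  by (rule pair_map.induced_quot_map[OF J_map', where e = id])
    (simp_all add: cl_d_def cl_dc_def)

lemma carrier_H_d: "carrier (H_d A k) = cl_d A k ` Z_d A k"
  unfolding H_d_def cl_d_def carrier_form_quot ..

lemma carrier_H_dc: "carrier (H_dc A J k) = cl_dc A J k ` Z_dc A J k"
  unfolding H_dc_def cl_dc_def carrier_form_quot ..

lemma carrier_H_BC: "carrier (H_BC A J k) = cl_BC A J k ` Z_BC A J k"
  unfolding H_BC_def cl_BC_def carrier_form_quot ..

lemma carrier_H_BC_pq: "carrier (H_BC_pq A J p q) = cl_BC_pq A J p q ` Z_BC_pq A J p q"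
  unfolding H_BC_pq_def cl_BC_pq_def carrier_form_quot ..

lemma carrier_H_A_pq: "carrier (H_A_pq A J p q) = cl_A_pq A J p q ` Z_A_pq A J p q"
  unfolding H_A_pq_def cl_A_pq_def carrier_form_quot ..

lemma carrier_H_A: "carrier (H_A A J k) = cl_A A J k ` Z_A A J k"
  unfolding H_A_def module_pair.carrier_quot[OF A_pair]
  by (simp add: a_r_coset_carrier_update cl_A_def ker_ddc_C_eq image_image)

lemma cl_A_eqI:
  assumes "\<alpha> \<in> Z_A A J k" "\<beta> \<in> Z_A A J k" "\<alpha> - \<beta> \<in> exact_sums k"
  shows "cl_A A J k \<alpha> = cl_A A J k \<beta>"
proof -
  have f: "\<alpha> \<in> forms A k" "\<beta> \<in> forms A k" using assms by (auto simp: Z_A_eq)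
  have "to_C A J k \<alpha> = to_C A J k (\<alpha> - \<beta>) \<oplus>\<^bsub>ker_module k\<^esub> to_C A J k \<beta>"
    using to_C_add[OF diff_forms[OF f] f(2)] by simp
  moreover have "to_C A J k (\<alpha> - \<beta>) \<in> N_A A J k" using assms(3) by (simp add: N_A_eq)
  ultimately have ex: "\<exists>n\<in>N_A A J k. to_C A J k \<alpha> = n \<oplus>\<^bsub>ker_module k\<^esub> to_C A J k \<beta>"
    by (rule bexI)
  have "to_C A J k \<alpha> \<in> carrier (ker_module k)" "to_C A J k \<beta> \<in> carrier (ker_module k)"
    using assms by (auto simp: ker_ddc_C_eq)
  from module_pair.coset_eq_iff[OF A_pair this] ex
  have "N_A A J k +>\<^bsub>ker_module k\<^esub> to_C A J k \<alpha> = N_A A J k +>\<^bsub>ker_module k\<^esub> to_C A J k \<beta>"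
    by simp
  then show ?thesis by (simp add: a_r_coset_carrier_update cl_A_def)
qed

end

subsection \<open>The diagram in the integrable case\<close>

context complex_structure
begin

lemma anti_d_0: "\<alpha> \<in> forms A k \<Longrightarrow> anti_d A J \<alpha> = 0"
  unfolding anti_d_def by (rule d_dc_anticommute)

lemma anti_d_image: "anti_d A J ` forms A k = {0}"
proof -
  have "anti_d A J ` forms A k = (\<lambda>_. 0) ` forms A k"
    by (intro image_cong refl anti_d_0)
  moreover have "forms A k \<noteq> {}" using zero_forms[of k] by blast
  ultimately show ?thesis by (simp only: image_constant_conv if_False)
qed

text \<open>The image of \<open>anti_d\<close> is zero, so C is the space of forms with each form
  wrapped into a singleton.\<close>

lemma to_C_singleton: "to_C A J k \<alpha> = {\<alpha>}"
  by (simp add: to_C_def anti_d_image a_r_coset_def')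

lemma B_forms_eq: "B_forms A J k = forms A k"
  using anti_d_0[of _ k] by (auto simp: B_forms_def)

lemma Z_A_eq': "Z_A A J k = {\<alpha> \<in> forms A k. d (dc \<alpha>) = 0}"
  by (simp add: Z_A_eq anti_d_image)

lemma Z_BC_pq_eq: "Z_BC_pq A J p q = Z_BC A J (p + q) \<inter> forms_pq A J p q"
  using forms_pq_forms by (auto simp: Z_BC_pq_def Z_BC_eq)

lemma N_BC_pq_eq: "N_BC_pq A J p q = N_BC A J (p + q) \<inter> forms_pq A J p q"
  by (simp add: N_BC_pq_def N_BC_def B_forms_eq)

lemma Z_A_pq_eq: "Z_A_pq A J p q = Z_A A J (p + q) \<inter> forms_pq A J p q"
  using forms_pq_forms by (auto simp: Z_A_pq_def Z_A_eq' dd_c_def)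

lemma N_A_pq_eq: "N_A_pq A J p q = exact_sums (p + q) \<inter> forms_pq A J p q"
  by (simp add: N_A_pq_def exact_sums_def)

lemma subspaces_pq:
  "fscale.subspace (Z_BC_pq A J p q)" "fscale.subspace (N_BC_pq A J p q)"
  "N_BC_pq A J p q \<subseteq> Z_BC_pq A J p q"
  "fscale.subspace (Z_A_pq A J p q)" "fscale.subspace (N_A_pq A J p q)"
  "N_A_pq A J p q \<subseteq> Z_A_pq A J p q"
  unfolding Z_BC_pq_eq N_BC_pq_eq Z_A_pq_eq N_A_pq_eq
  using N_BC_Z_BC exact_sums_Z_A
  by (auto intro!: fscale.subspace_inter subspace_Z_BC subspace_N_BC subspace_Z_A
      subspace_exact_sums subspace_forms_pq)

lemma lin_on_part_pq: "lin_on (forms A (p + q)) (part_pq A J p q)"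
  using part_pq_add[of _ "p + q" _ p] part_pq_fscale[of _ "p + q" p] by (simp add: lin_on_def)

lemma part_pq_Z_A:
  assumes "\<alpha> \<in> Z_A A J (p + q)" shows "part_pq A J p q \<alpha> \<in> Z_A_pq A J p q"
proof -
  have \<alpha>: "\<alpha> \<in> forms A (p + q)" "d (dc \<alpha>) = 0" using assms by (auto simp: Z_A_eq')
  \<comment> \<open>\<open>d dc\<close> raises the first index by one, so component \<open>p\<close>
    of \<alpha> is tested by component \<open>p + 1\<close> of
    \<open>d (dc \<alpha>)\<close>.\<close>
  have "d (dc (part_pq A J p q \<alpha>)) = 0"
    using part_ddc[OF \<alpha>(1), of "p + 1"] part_pq_0[of "p + 1" "p + q + 2"] by (simp add: \<alpha>(2))
  then show ?thesis
    using part_pq_forms_pq[OF \<alpha>(1)] by (simp add: Z_A_pq_def dd_c_def)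
qed

lemma part_pq_exact_sums:
  assumes "\<alpha> \<in> exact_sums (p + q)" shows "part_pq A J p q \<alpha> \<in> N_A_pq A J p q"
proof -
  obtain \<beta> \<gamma> where *: "\<beta> \<in> forms A (p + q - 1)" "\<gamma> \<in> forms A (p + q - 1)" "\<alpha> = d \<beta> + dc \<gamma>"
    using assms by (auto simp: exact_sums_def)
  have "part_pq A J p q \<alpha> \<in> exact_sums (p + q)"
    using part_d_add_dc[OF *(1,2), of p] *(3) by (auto simp: exact_sums_def)
  moreover have "\<alpha> \<in> forms A (p + q)" using assms exact_sums_Z_A by (auto simp: Z_A_eq)
  ultimately show ?thesis using part_pq_forms_pq by (simp add: N_A_pq_eq)
qed

lemma part_map:
  assumes "fscale.subspace Z" "fscale.subspace N" "N \<subseteq> Z" "Z \<subseteq> Z_A A J (p + q)" "N \<subseteq> exact_sums (p + q)"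
  shows "pair_map (form_module Z) N (form_module (Z_A_pq A J p q)) (N_A_pq A J p q) (part_pq A J p q)"
proof (rule form_map_of_pairs[OF assms(1-3) subspaces_pq(4-6)])
  have "Z \<subseteq> forms A (p + q)" using assms(4) by (auto simp: Z_A_eq)
  then show "lin_on Z (part_pq A J p q)" by (rule lin_on_subset[OF lin_on_part_pq])
qed (use assms(4,5) part_pq_Z_A part_pq_exact_sums in blast)+

section \<open>Maps between bigraded and graded cohomology\<close>

definition to_A_pq where
  "to_A_pq p q = quot_map (form_module (Z_A_pq A J p q)) (N_A_pq A J p q) (part_pq A J p q)"
definition incl where
  "incl p q = quot_map (form_module (Z_BC A J (p + q))) (N_BC A J (p + q)) id"
text \<open>Elements of \<open>ker_module\<close> are cosets in C, which are singletons here;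
  \<open>the_elem\<close> unwraps the form whose component is taken.\<close>

definition proj where
  "proj p q = quot_map (form_module (Z_A_pq A J p q)) (N_A_pq A J p q) (\<lambda>Y. part_pq A J p q (the_elem Y))"

text \<open>Bigraded numerators and denominators lie inside the graded ones, so both arrows out of
  Bott-Chern cohomology restrict.\<close>

lemma BC_pq_map:
  assumes "pair_map (form_module (Z_BC A J (p + q))) (N_BC A J (p + q)) (form_module Z) N id"
    "fscale.subspace Z" "fscale.subspace N" "N \<subseteq> Z"
  shows "pair_map (form_module (Z_BC_pq A J p q)) (N_BC_pq A J p q) (form_module Z) N id"
proof (rule form_map_of_pairs[OF subspaces_pq(1-3) assms(2-4) lin_on_id])
  show "id \<alpha> \<in> Z" if "\<alpha> \<in> Z_BC_pq A J p q" for \<alpha>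
    using pair_map.f_mem[OF assms(1), of \<alpha>] that by (simp add: Z_BC_pq_eq)
  show "id \<alpha> \<in> N" if "\<alpha> \<in> N_BC_pq A J p q" for \<alpha>
    using pair_map.f_sub[OF assms(1), of \<alpha>] that by (simp add: N_BC_pq_eq)
qed

lemma incl_map:
  "pair_map (form_module (Z_BC_pq A J p q)) (N_BC_pq A J p q)
    (form_module (Z_BC A J (p + q))) (N_BC A J (p + q)) id"
  by (rule form_map_of_pairs[OF subspaces_pq(1-3) subspace_Z_BC subspace_N_BC N_BC_Z_BC lin_on_id])
    (auto simp: Z_BC_pq_eq N_BC_pq_eq)

lemma proj_map:
  "pair_map (ker_module (p + q)) (N_A A J (p + q))
    (form_module (Z_A_pq A J p q)) (N_A_pq A J p q) (\<lambda>Y. part_pq A J p q (the_elem Y))"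
  unfolding pair_map_def pair_map_axioms_def
proof (intro conjI allI impI A_pair form_pair[OF subspaces_pq(4-6)])
  have forms: "\<alpha> \<in> forms A (p + q)" if "\<alpha> \<in> Z_A A J (p + q)" for \<alpha>
    using that by (simp add: Z_A_eq)
  fix X assume X: "X \<in> carrier (ker_module (p + q))"
  then obtain \<alpha> where \<alpha>: "\<alpha> \<in> Z_A A J (p + q)" "X = to_C A J (p + q) \<alpha>" by (auto simp: ker_ddc_C_eq)
  then show "part_pq A J p q (the_elem X) \<in> carrier (form_module (Z_A_pq A J p q))"
    using part_pq_Z_A by (simp add: to_C_singleton)
  show "part_pq A J p q (the_elem (z \<odot>\<^bsub>ker_module (p + q)\<^esub> X)) =
      z \<odot>\<^bsub>form_module (Z_A_pq A J p q)\<^esub> part_pq A J p q (the_elem X)" for z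
    using \<alpha> forms[OF \<alpha>(1)] lin_on_part_pq[of p q] by (simp add: to_C_fscale) (simp add: to_C_singleton lin_on_def)
  fix Y assume Y: "Y \<in> carrier (ker_module (p + q))"
  then obtain \<beta> where \<beta>: "\<beta> \<in> Z_A A J (p + q)" "Y = to_C A J (p + q) \<beta>" by (auto simp: ker_ddc_C_eq)
  show "part_pq A J p q (the_elem (X \<oplus>\<^bsub>ker_module (p + q)\<^esub> Y)) = part_pq A J p q (the_elem X)
      \<oplus>\<^bsub>form_module (Z_A_pq A J p q)\<^esub> part_pq A J p q (the_elem Y)"
    using \<alpha> \<beta> forms[OF \<alpha>(1)] forms[OF \<beta>(1)] lin_on_part_pq[of p q]
    by (simp add: to_C_add) (simp add: to_C_singleton lin_on_def)
next
  fix X assume "X \<in> N_A A J (p + q)"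
  then obtain \<alpha> where "\<alpha> \<in> exact_sums (p + q)" "X = to_C A J (p + q) \<alpha>" by (auto simp: N_A_eq)
  then show "part_pq A J p q (the_elem X) \<in> N_A_pq A J p q"
    using part_pq_exact_sums by (simp add: to_C_singleton)
qed

lemma induced_bc_d_pq:
  "induced (H_BC_pq A J p q) (H_d A (p + q)) (Z_BC_pq A J p q) (cl_BC_pq A J p q) (cl_d A (p + q)) id
    (bc_d (p + q))"
  unfolding H_BC_pq_def H_d_def bc_d_def
  by (rule pair_map.induced_quot_map[OF BC_pq_map[OF BC_d_map subspace_Z_d subspace_N_d N_d_Z_d],
        where e = id]) (simp_all add: cl_BC_pq_def cl_d_def)

lemma induced_bc_dc_pq:
  "induced (H_BC_pq A J p q) (H_dc A J (p + q)) (Z_BC_pq A J p q) (cl_BC_pq A J p q) (cl_dc A J (p + q)) id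
    (bc_dc (p + q))"
  unfolding H_BC_pq_def H_dc_def bc_dc_def
  by (rule pair_map.induced_quot_map[OF BC_pq_map[OF BC_dc_map subspace_Z_dc subspace_N_dc N_dc_Z_dc],
        where e = id]) (simp_all add: cl_BC_pq_def cl_dc_def)

lemma induced_d_A_pq:
  "induced (H_d A (p + q)) (H_A_pq A J p q) (Z_d A (p + q)) (cl_d A (p + q)) (cl_A_pq A J p q)
    (part_pq A J p q) (to_A_pq p q)"
  unfolding H_A_pq_def H_d_def to_A_pq_def
  by (rule pair_map.induced_quot_map[OF part_map[OF subspace_Z_d subspace_N_d N_d_Z_d
          Z_d_Z_A N_d_exact_sums], where e = id]) (simp_all add: cl_A_pq_def cl_d_def)

lemma induced_dc_A_pq:
  "induced (H_dc A J (p + q)) (H_A_pq A J p q) (Z_dc A J (p + q)) (cl_dc A J (p + q)) (cl_A_pq A J p q)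
    (part_pq A J p q) (to_A_pq p q)"
  unfolding H_A_pq_def H_dc_def to_A_pq_def
  by (rule pair_map.induced_quot_map[OF part_map[OF subspace_Z_dc subspace_N_dc N_dc_Z_dc
          Z_dc_Z_A N_dc_exact_sums], where e = id]) (simp_all add: cl_A_pq_def cl_dc_def)

lemma induced_incl:
  "induced (H_BC_pq A J p q) (H_BC A J (p + q)) (Z_BC_pq A J p q) (cl_BC_pq A J p q) (cl_BC A J (p + q)) id
    (incl p q)"
  unfolding H_BC_pq_def H_BC_def incl_def
  by (rule pair_map.induced_quot_map[OF incl_map, where e = id])
    (simp_all add: cl_BC_pq_def cl_BC_def)

lemma induced_proj:
  "induced (H_A A J (p + q)) (H_A_pq A J p q) (Z_A A J (p + q)) (cl_A A J (p + q)) (cl_A_pq A J p q)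
    (part_pq A J p q) (proj p q)"
  unfolding H_A_def H_A_pq_def proj_def
  by (rule pair_map.induced_quot_map[OF proj_map, where e = "to_C A J (p + q)"])
    (simp_all add: cl_A_pq_def cl_A_def a_r_coset_carrier_update ker_ddc_C_eq, simp add: to_C_singleton)

lemma incl_cl: "\<alpha> \<in> Z_BC_pq A J p q \<Longrightarrow> incl p q (cl_BC_pq A J p q \<alpha>) = cl_BC A J (p + q) \<alpha>"
  using induced_incl by (simp add: induced_def)

lemma proj_cl: "\<alpha> \<in> Z_A A J (p + q) \<Longrightarrow> proj p q (cl_A A J (p + q) \<alpha>) = cl_A_pq A J p q (part_pq A J p q \<alpha>)"
  using induced_proj by (simp add: induced_def)

lemma bc_incl:
  assumes "X \<in> carrier (H_BC_pq A J p q)"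
  shows "bc_d (p + q) X = bc_d (p + q) (incl p q X)" "bc_dc (p + q) X = bc_dc (p + q) (incl p q X)"
  using induced_comp[OF induced_bc_d_pq induced_incl induced_bc_d]
    induced_comp[OF induced_bc_dc_pq induced_incl induced_bc_dc] assms
  unfolding carrier_H_BC_pq Z_BC_pq_eq by auto

lemma to_A_pq_d: "X \<in> carrier (H_d A (p + q)) \<Longrightarrow> to_A_pq p q X = proj p q (to_A (p + q) X)"
  using induced_comp[OF induced_d_A_pq induced_d_A induced_proj Z_d_Z_A] unfolding carrier_H_d .

lemma to_A_pq_dc: "X \<in> carrier (H_dc A J (p + q)) \<Longrightarrow> to_A_pq p q X = proj p q (to_A (p + q) X)"
  using induced_comp[OF induced_dc_A_pq induced_dc_A induced_proj Z_dc_Z_A] unfolding carrier_H_dc .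

section \<open>Splitting of graded cohomology into bidegrees\<close>

lemma cl_BC_eq_iff:
  "\<alpha> \<in> Z_BC A J k \<Longrightarrow> \<beta> \<in> Z_BC A J k \<Longrightarrow> cl_BC A J k \<alpha> = cl_BC A J k \<beta> \<longleftrightarrow> \<alpha> - \<beta> \<in> N_BC A J k"
  unfolding cl_BC_def by (rule form_coset_eq_iff[OF subspace_Z_BC subspace_N_BC N_BC_Z_BC])

lemma cl_BC_pq_eq_iff:
  "\<alpha> \<in> Z_BC_pq A J p q \<Longrightarrow> \<beta> \<in> Z_BC_pq A J p q \<Longrightarrow>
    cl_BC_pq A J p q \<alpha> = cl_BC_pq A J p q \<beta> \<longleftrightarrow> \<alpha> - \<beta> \<in> N_BC_pq A J p q"
  unfolding cl_BC_pq_def by (rule form_coset_eq_iff[OF subspaces_pq(1-3)])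

lemma cl_A_pq_eq_iff:
  "\<alpha> \<in> Z_A_pq A J p q \<Longrightarrow> \<beta> \<in> Z_A_pq A J p q \<Longrightarrow>
    cl_A_pq A J p q \<alpha> = cl_A_pq A J p q \<beta> \<longleftrightarrow> \<alpha> - \<beta> \<in> N_A_pq A J p q"
  unfolding cl_A_pq_def by (rule form_coset_eq_iff[OF subspaces_pq(4-6)])

text \<open>Turns the \<open>finsum\<close> in the module \<open>H_BC\<close> into the class of an
  ordinary sum of forms, whose components can be taken.\<close>

lemma finsum_incl:
  assumes a: "\<And>p. p \<in> {0..k} \<Longrightarrow> a p \<in> Z_BC_pq A J p (k - p)"
    and X: "\<And>p. p \<in> {0..k} \<Longrightarrow> X p = cl_BC_pq A J p (k - p) (a p)"
  shows "(\<Oplus>\<^bsub>H_BC A J k\<^esub>p\<in>{0..k}. incl p (k - p) (X p)) = cl_BC A J k (\<Sum>p\<in>{0..k}. a p)"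
proof -
  interpret module_pair complex_ring "form_module (Z_BC A J k)" "N_BC A J k"
    by (rule form_pair[OF subspace_Z_BC subspace_N_BC N_BC_Z_BC])
  interpret H: module complex_ring "H_BC A J k" unfolding H_BC_def by (rule module_quot)
  have Z: "a p \<in> Z_BC A J k" if "p \<in> {0..k}" for p
    using a[OF that] by (simp add: Z_BC_pq_eq)
  have "incl p (k - p) (X p) = cl_BC A J k (a p)" if "p \<in> {0..k}" for p
    using incl_cl[OF a[OF that]] by (simp add: X[OF that])
  then have "(\<Oplus>\<^bsub>H_BC A J k\<^esub>p\<in>{0..k}. incl p (k - p) (X p)) = (\<Oplus>\<^bsub>H_BC A J k\<^esub>p\<in>{0..k}. cl_BC A J k (a p))"
    using Z by (intro H.finsum_cong') (auto simp: carrier_H_BC)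
  also have "\<dots> = cl_BC A J k (\<Oplus>\<^bsub>form_module (Z_BC A J k)\<^esub>p\<in>{0..k}. a p)"
    unfolding cl_BC_def H_BC_def by (rule finsum_quot) (use Z in auto)
  also have "(\<Oplus>\<^bsub>form_module (Z_BC A J k)\<^esub>p\<in>{0..k}. a p) = (\<Sum>p\<in>{0..k}. a p)"
    by (rule finsum_form_module[OF subspace_Z_BC]) (use Z in auto)
  finally show ?thesis .
qed

lemma part_Z_BC:
  assumes "\<alpha> \<in> Z_BC A J k" shows "part k p \<alpha> \<in> Z_BC_pq A J p (k - p)"
  using assms part_closed[of \<alpha> k p] part_pq_forms_pq'[of \<alpha> k p] by (simp add: Z_BC_eq Z_BC_pq_def)

text \<open>Exactness passes to components: the one of index \<open>p\<close> of
  \<open>d (dc \<beta>)\<close> is \<open>d dc\<close> of the component of index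
  \<open>p - 1\<close> of \<beta>. This is the heart of the injectivity of the splitting.\<close>

lemma N_BC_pq_if_sum:
  assumes a: "\<And>p. p \<in> {0..k} \<Longrightarrow> a p \<in> forms_pq A J p (k - p)"
    and sum: "(\<Sum>p\<in>{0..k}. a p) \<in> N_BC A J k" and p: "p \<in> {0..k}"
  shows "a p \<in> N_BC_pq A J p (k - p)"
proof -
  obtain \<beta> where \<beta>: "\<beta> \<in> forms A (k - 2)" "(\<Sum>p\<in>{0..k}. a p) = d (dc \<beta>)"
    using sum by (auto simp: N_BC_def B_forms_eq dd_c_def)
  have "part k p (\<Sum>p\<in>{0..k}. a p) = (if p \<in> {0..k} then a p else 0)"
    by (rule part_pq_eqI[where f = "\<lambda>p. if p \<in> {0..k} then a p else 0"]) (use a fscale.subspace_0[OF subspace_forms_pq] in auto)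
  then have "a p = part (k - 2 + 2) p (d (dc \<beta>))" using p \<beta>(2) by simp
  also have "\<dots> = d (dc (part (k - 2) (p - 1) \<beta>))" by (rule part_ddc[OF \<beta>(1)])
  finally have "a p = d (dc (part (k - 2) (p - 1) \<beta>))" .
  then have "a p \<in> N_BC A J k"
    unfolding N_BC_def B_forms_eq dd_c_def using part_pq_forms[OF \<beta>(1)] by blast
  then show ?thesis using a[OF p] by (simp add: N_BC_pq_eq)
qed

text \<open>Injective because a sum of pure forms is \<open>d dc\<close>-exact only if every summand
  is; surjective because the components of a form closed under \<open>d\<close> and
  \<open>dc\<close> are closed as well and add up to it.\<close>

lemma bij_incl:
  "bij_betw (\<lambda>X. \<Oplus>\<^bsub>H_BC A J k\<^esub>p\<in>{0..k}. incl p (k - p) (X p))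
    (\<Pi>\<^sub>E p\<in>{0..k}. carrier (H_BC_pq A J p (k - p))) (carrier (H_BC A J k))"
  (is "bij_betw ?F ?P ?H")
proof -
  have rep: "\<exists>a. \<forall>p\<in>{0..k}. a p \<in> Z_BC_pq A J p (k - p) \<and> X p = cl_BC_pq A J p (k - p) (a p)"
    if "X \<in> ?P" for X
  proof (rule bchoice, rule ballI)
    fix p assume "p \<in> {0..k}"
    from PiE_mem[OF that this]
    show "\<exists>\<alpha>. \<alpha> \<in> Z_BC_pq A J p (k - p) \<and> X p = cl_BC_pq A J p (k - p) \<alpha>"
      unfolding carrier_H_BC_pq by blast
  qed
  have Z_sum: "(\<Sum>p\<in>{0..k}. a p) \<in> Z_BC A J k"
    if "\<And>p. p \<in> {0..k} \<Longrightarrow> a p \<in> Z_BC_pq A J p (k - p)" for a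
    using that by (intro fscale.subspace_sum[OF subspace_Z_BC]) (auto simp: Z_BC_pq_eq)
  have "inj_on ?F ?P"
  proof (rule inj_onI)
    fix X Y assume X: "X \<in> ?P" and Y: "Y \<in> ?P" and eq: "?F X = ?F Y"
    obtain a where a: "\<And>p. p \<in> {0..k} \<Longrightarrow> a p \<in> Z_BC_pq A J p (k - p)"
      "\<And>p. p \<in> {0..k} \<Longrightarrow> X p = cl_BC_pq A J p (k - p) (a p)" using rep[OF X] by metis
    obtain b where b: "\<And>p. p \<in> {0..k} \<Longrightarrow> b p \<in> Z_BC_pq A J p (k - p)"
      "\<And>p. p \<in> {0..k} \<Longrightarrow> Y p = cl_BC_pq A J p (k - p) (b p)" using rep[OF Y] by metis
    have "cl_BC A J k (\<Sum>p\<in>{0..k}. a p) = cl_BC A J k (\<Sum>p\<in>{0..k}. b p)"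
      using eq finsum_incl[of k a X, OF a] finsum_incl[of k b Y, OF b] by simp
    then have "(\<Sum>p\<in>{0..k}. a p) - (\<Sum>p\<in>{0..k}. b p) \<in> N_BC A J k"
      using cl_BC_eq_iff[OF Z_sum[OF a(1)] Z_sum[OF b(1)]] by blast
    then have sum: "(\<Sum>p\<in>{0..k}. a p - b p) \<in> N_BC A J k" by (simp only: sum_subtractf)
    show "X = Y"
    proof (rule PiE_ext[OF X Y])
      fix p assume p: "p \<in> {0..k}"
      have "a p - b p \<in> forms_pq A J p (k - p)" if "p \<in> {0..k}" for p
        using a(1)[OF that] b(1)[OF that] fscale.subspace_diff[OF subspace_forms_pq]
        by (simp add: Z_BC_pq_eq)
      from N_BC_pq_if_sum[of k "\<lambda>p. a p - b p", OF this sum p]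
      show "X p = Y p"
        using cl_BC_pq_eq_iff[OF a(1)[OF p] b(1)[OF p]] a(2)[OF p] b(2)[OF p] by simp
    qed
  qed
  moreover have "?F ` ?P = ?H"
  proof
    show "?F ` ?P \<subseteq> ?H"
    proof (rule image_subsetI)
      fix X assume X: "X \<in> ?P"
      obtain a where a: "\<And>p. p \<in> {0..k} \<Longrightarrow> a p \<in> Z_BC_pq A J p (k - p)"
        "\<And>p. p \<in> {0..k} \<Longrightarrow> X p = cl_BC_pq A J p (k - p) (a p)" using rep[OF X] by metis
      show "?F X \<in> ?H"
        using finsum_incl[of k a X, OF a] Z_sum[of a, OF a(1)] by (simp add: carrier_H_BC)
    qed
    show "?H \<subseteq> ?F ` ?P"
    proof
      fix Y assume "Y \<in> ?H"
      then obtain \<alpha> where \<alpha>: "\<alpha> \<in> Z_BC A J k" "Y = cl_BC A J k \<alpha>" by (auto simp: carrier_H_BC)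
      \<comment> \<open>The restricted abstraction makes \<open>X\<close> undefined outside
        \<open>0..k\<close>, as the extensional product demands.\<close>
      define X where "X = (\<lambda>p\<in>{0..k}. cl_BC_pq A J p (k - p) (part k p \<alpha>))"
      have X: "X \<in> ?P"
        unfolding X_def by (rule restrict_PiE_iff[THEN iffD2]) (auto simp: carrier_H_BC_pq intro!: imageI part_Z_BC[OF \<alpha>(1)])
      have "\<alpha> \<in> forms A k" using \<alpha> by (simp add: Z_BC_eq)
      moreover have "?F X = cl_BC A J k (\<Sum>p\<in>{0..k}. part k p \<alpha>)"
        by (rule finsum_incl) (use part_Z_BC[OF \<alpha>(1)] in \<open>auto simp: X_def\<close>)
      ultimately have "Y = ?F X" by (simp only: \<alpha>(2) sum_part_pq)
      then show "Y \<in> ?F ` ?P" using X by (rule image_eqI)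
    qed
  qed
  ultimately show ?thesis by (simp add: bij_betw_def)
qed

lemma proj_cl':
  assumes "\<alpha> \<in> Z_A A J k"
  shows "proj p (k - p) (cl_A A J k \<alpha>) = cl_A_pq A J p (k - p) (part k p \<alpha>)"
  using proj_cl[of \<alpha> p "k - p"] assms by simp

text \<open>A form is the sum of its components and \<open>exact_sums k\<close> is a subspace
  containing the bigraded denominators, so a class is determined by its projections. Conversely, the
  sum of representatives of prescribed projections is a preimage.\<close>

lemma bij_proj:
  "bij_betw (\<lambda>X. \<lambda>p\<in>{0..k}. proj p (k - p) X)
    (carrier (H_A A J k)) (\<Pi>\<^sub>E p\<in>{0..k}. carrier (H_A_pq A J p (k - p)))"
  (is "bij_betw ?F ?H ?P")
proof -
  have part_Z: "part k p \<alpha> \<in> Z_A_pq A J p (k - p)" if "\<alpha> \<in> Z_A A J k" for \<alpha> p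
    using part_pq_Z_A[of \<alpha> p "k - p"] that by simp
  have "inj_on ?F ?H"
  proof (rule inj_onI)
    fix X Y assume "X \<in> ?H" "Y \<in> ?H" and eq: "?F X = ?F Y"
    then obtain \<alpha> \<beta> where \<alpha>: "\<alpha> \<in> Z_A A J k" "X = cl_A A J k \<alpha>"
      and \<beta>: "\<beta> \<in> Z_A A J k" "Y = cl_A A J k \<beta>"
      by (auto simp: carrier_H_A)
    have f: "\<alpha> \<in> forms A k" "\<beta> \<in> forms A k" using \<alpha> \<beta> by (auto simp: Z_A_eq)
    have "part k p \<alpha> - part k p \<beta> \<in> exact_sums k" if "p \<in> {0..k}" for p
    proof -
      have "proj p (k - p) X = proj p (k - p) Y"
        using fun_cong[OF eq, of p] that by simp
      then have "part k p \<alpha> - part k p \<beta> \<in> N_A_pq A J p (k - p)"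
        unfolding \<alpha> \<beta> proj_cl'[OF \<alpha>(1)] proj_cl'[OF \<beta>(1)]
        by (simp only: cl_A_pq_eq_iff[OF part_Z[OF \<alpha>(1)] part_Z[OF \<beta>(1)]])
      then show ?thesis by (simp add: N_A_pq_eq)
    qed
    then have "(\<Sum>p\<in>{0..k}. part k p \<alpha> - part k p \<beta>) \<in> exact_sums k"
      by (rule fscale.subspace_sum[OF subspace_exact_sums])
    then have "\<alpha> - \<beta> \<in> exact_sums k"
      by (simp only: sum_subtractf sum_part_pq[OF f(1)] sum_part_pq[OF f(2)])
    then show "X = Y" unfolding \<alpha>(2) \<beta>(2) by (rule cl_A_eqI[OF \<alpha>(1) \<beta>(1)])
  qed
  moreover have "?F ` ?H = ?P"
  proof
    show "?F ` ?H \<subseteq> ?P"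
    proof (rule image_subsetI)
      fix X assume "X \<in> ?H"
      then obtain \<alpha> where \<alpha>: "\<alpha> \<in> Z_A A J k" "X = cl_A A J k \<alpha>" by (auto simp: carrier_H_A)
      show "?F X \<in> ?P"
        unfolding \<alpha>(2) proj_cl'[OF \<alpha>(1)] carrier_H_A_pq
        by (rule restrict_PiE_iff[THEN iffD2]) (intro ballI imageI part_Z[OF \<alpha>(1)])
    qed
    show "?P \<subseteq> ?F ` ?H"
    proof
      fix Y assume Y: "Y \<in> ?P"
      have "\<exists>a. \<forall>p\<in>{0..k}. a p \<in> Z_A_pq A J p (k - p) \<and> Y p = cl_A_pq A J p (k - p) (a p)"
      proof (rule bchoice, rule ballI)
        fix p assume "p \<in> {0..k}"
        from PiE_mem[OF Y this]
        show "\<exists>\<alpha>. \<alpha> \<in> Z_A_pq A J p (k - p) \<and> Y p = cl_A_pq A J p (k - p) \<alpha>"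
          unfolding carrier_H_A_pq by blast
      qed
      then obtain a where a: "\<And>p. p \<in> {0..k} \<Longrightarrow> a p \<in> Z_A_pq A J p (k - p)"
        "\<And>p. p \<in> {0..k} \<Longrightarrow> Y p = cl_A_pq A J p (k - p) (a p)" by metis
      define \<alpha> where "\<alpha> = (\<Sum>p\<in>{0..k}. a p)"
      have \<alpha>: "\<alpha> \<in> Z_A A J k"
        unfolding \<alpha>_def using a(1) by (intro fscale.subspace_sum[OF subspace_Z_A]) (auto simp: Z_A_pq_eq)
      \<comment> \<open>The summands already have pure type, so uniqueness of the decomposition
        identifies them as the components.\<close>
      have part_a: "part k p \<alpha> = (if p \<in> {0..k} then a p else 0)" for p
        unfolding \<alpha>_def
        by (rule part_pq_eqI[where f = "\<lambda>p. if p \<in> {0..k} then a p else 0"]) (use a(1) fscale.subspace_0[OF subspace_forms_pq] in \<open>auto simp: Z_A_pq_eq\<close>)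
      have "?F (cl_A A J k \<alpha>) = Y"
      proof
        fix p
        show "?F (cl_A A J k \<alpha>) p = Y p"
        proof (cases "p \<in> {0..k}")
          case True
          then show ?thesis using a(2)[OF True] part_a[of p] by (simp add: proj_cl'[OF \<alpha>])
        next
          case False
          then show ?thesis using PiE_arb[OF Y False] by (simp only: restrict_def if_False)
        qed
      qed
      then show "Y \<in> ?F ` ?H" using \<alpha> by (auto simp: carrier_H_A)
    qed
  qed
  ultimately show ?thesis by (simp add: bij_betw_def)
qed

end

theorem proposition3p7:
  fixes M :: "'a topology"
    and \<A> :: "('a, 'e::euclidean_space) chart set"
    and J :: "('a, 'e) endo"
  assumes "almost_complex_manifold M \<A> J"
  shows "\<exists>bc_d bc_dc d_a dc_a j j'.
    (\<forall>k.
      induced (H_BC \<A> J k) (H_d \<A> k) (Z_BC \<A> J k) (cl_BC \<A> J k) (cl_d \<A> k) id (bc_d k) \<and>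
      induced (H_BC \<A> J k) (H_dc \<A> J k) (Z_BC \<A> J k) (cl_BC \<A> J k) (cl_dc \<A> J k) id (bc_dc k) \<and>
      induced (H_d \<A> k) (H_A \<A> J k) (Z_d \<A> k) (cl_d \<A> k) (cl_A \<A> J k) id (d_a k) \<and>
      induced (H_dc \<A> J k) (H_A \<A> J k) (Z_dc \<A> J k) (cl_dc \<A> J k) (cl_A \<A> J k) id (dc_a k) \<and>
      induced (H_d \<A> k) (H_dc \<A> J k) (Z_d \<A> k) (cl_d \<A> k) (cl_dc \<A> J k) (J_act J) (j k) \<and>
      bij_betw (j k) (carrier (H_d \<A> k)) (carrier (H_dc \<A> J k)) \<and>
      induced (H_dc \<A> J k) (H_d \<A> k) (Z_dc \<A> J k) (cl_dc \<A> J k) (cl_d \<A> k) (J_act J) (j' k) \<and>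
      bij_betw (j' k) (carrier (H_dc \<A> J k)) (carrier (H_d \<A> k))) \<and>
    (integrable_acs \<A> J \<longrightarrow>
      (\<exists>bc_d_pq bc_dc_pq d_a_pq dc_a_pq incl proj.
        (\<forall>p q.
          induced (H_BC_pq \<A> J p q) (H_d \<A> (p + q)) (Z_BC_pq \<A> J p q)
            (cl_BC_pq \<A> J p q) (cl_d \<A> (p + q)) id (bc_d_pq p q) \<and>
          induced (H_BC_pq \<A> J p q) (H_dc \<A> J (p + q)) (Z_BC_pq \<A> J p q)
            (cl_BC_pq \<A> J p q) (cl_dc \<A> J (p + q)) id (bc_dc_pq p q) \<and>
          induced (H_d \<A> (p + q)) (H_A_pq \<A> J p q) (Z_d \<A> (p + q))
            (cl_d \<A> (p + q)) (cl_A_pq \<A> J p q) (part_pq \<A> J p q) (d_a_pq p q) \<and>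
          induced (H_dc \<A> J (p + q)) (H_A_pq \<A> J p q) (Z_dc \<A> J (p + q))
            (cl_dc \<A> J (p + q)) (cl_A_pq \<A> J p q) (part_pq \<A> J p q) (dc_a_pq p q) \<and>
          induced (H_BC_pq \<A> J p q) (H_BC \<A> J (p + q)) (Z_BC_pq \<A> J p q)
            (cl_BC_pq \<A> J p q) (cl_BC \<A> J (p + q)) id (incl p q) \<and>
          induced (H_A \<A> J (p + q)) (H_A_pq \<A> J p q) (Z_A \<A> J (p + q))
            (cl_A \<A> J (p + q)) (cl_A_pq \<A> J p q) (part_pq \<A> J p q) (proj p q) \<and>
          (\<forall>X\<in>carrier (H_BC_pq \<A> J p q).
            bc_d_pq p q X = bc_d (p + q) (incl p q X) \<and>
            bc_dc_pq p q X = bc_dc (p + q) (incl p q X)) \<and>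
          (\<forall>X\<in>carrier (H_d \<A> (p + q)). d_a_pq p q X = proj p q (d_a (p + q) X)) \<and>
          (\<forall>X\<in>carrier (H_dc \<A> J (p + q)). dc_a_pq p q X = proj p q (dc_a (p + q) X))) \<and>
        (\<forall>k.
          bij_betw (\<lambda>X. \<Oplus>\<^bsub>H_BC \<A> J k\<^esub>p\<in>{0..k}. incl p (k - p) (X p))
            (\<Pi>\<^sub>E p\<in>{0..k}. carrier (H_BC_pq \<A> J p (k - p))) (carrier (H_BC \<A> J k)) \<and>
          bij_betw (\<lambda>X. \<lambda>p\<in>{0..k}. proj p (k - p) X)
            (carrier (H_A \<A> J k)) (\<Pi>\<^sub>E p\<in>{0..k}. carrier (H_A_pq \<A> J p (k - p))))))"
proof -
  interpret almost_complex M \<A> J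
    using assms unfolding almost_complex_manifold_def by unfold_locales auto
  have complex: "integrable_acs \<A> J \<Longrightarrow> complex_structure M \<A> J" by unfold_locales
  \<comment> \<open>The bigraded arrows out of Bott-Chern cohomology are the functions
    \<open>bc_d (p + q)\<close> and \<open>bc_dc (p + q)\<close> again, and \<open>to_A\<close> and
    \<open>to_A_pq\<close> each serve for \<open>d\<close> and for \<open>dc\<close>:
    \<open>quot_map\<close> is determined by its target and the map on representatives.\<close>
  show ?thesis
    by (rule exI[of _ bc_d], rule exI[of _ bc_dc], rule exI[of _ to_A], rule exI[of _ to_A],
        rule exI[of _ j_d], rule exI[of _ j_dc], intro conjI allI impI,
        (rule induced_bc_d induced_bc_dc induced_d_A induced_dc_A induced_j_d induced_j_dc
          bij_J[folded j_d_def] bij_J'[folded j_dc_def])+,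
        drule complex, rule exI[of _ "\<lambda>p q. bc_d (p + q)"], rule exI[of _ "\<lambda>p q. bc_dc (p + q)"],
        rule exI[of _ "complex_structure.to_A_pq \<A> J"], rule exI[of _ "complex_structure.to_A_pq \<A> J"],
        rule exI[of _ "complex_structure.incl \<A> J"], rule exI[of _ "complex_structure.proj \<A> J"],
        intro conjI allI ballI)
      (erule complex_structure.induced_bc_d_pq complex_structure.induced_bc_dc_pq
        complex_structure.induced_d_A_pq complex_structure.induced_dc_A_pq
        complex_structure.induced_incl complex_structure.induced_proj complex_structure.bij_incl
        complex_structure.bij_proj complex_structure.bc_incl complex_structure.to_A_pq_d
        complex_structure.to_A_pq_dc; assumption?)+
qed

end
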